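(* Let $k$ be a field, $P$ a finite connected poset, and $S\in\mathrm{Int}(P)$. Put $\mathcal E_S=\{R\in\mathrm{Int}(P)\mid S\in\mathcal D(R)\}$. For $R\in\mathrm{Int}(P)$, $$e_R\Delta(S)\cong\begin{cases}k[q_{R,S}],&R\in\mathcal E_S,\\0,&R\notin\mathcal E_S.\end{cases}$$ (That is, for $R\in\mathcal E_S$ this component is one-dimensional with basis $[q_{R,S}]$.) Moreover, let $Q,R\in\mathrm{Int}(P)$, let $C\in\mathrm{Adm}(Q,R)$, and assume $R\in\mathcal E_S$. Then $$(\rho_{Q,R}^C)^{\mathrm{op}}\cdot[q_{R,S}]=\begin{cases}[q_{Q,S}],&\text{if }Q\in\mathcal E_S\text{ and }S\subseteq C,\\0,&\text{otherwise.}\end{cases}$$ In particular, $\Delta(S)$ is a thin $\Lambda_P$-module with support $\mathcal E_S$.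
   Context: A subset $S\subseteq P$ is connected if any $x,y\in S$ are joined by a sequence $x=x_0,\dots,x_r=y$ in $S$ with $x_{i-1},x_i$ comparable for all $i$; convex if $x,y\in S$ and $x\le z\le y$ imply $z\in S$; an interval if it is nonempty, connected and convex. $\mathrm{Int}(P)$ is the set of intervals of $P$. Representations of $P$ are functors from $P$ to finite-dimensional $k$-vector spaces, with morphism spaces $\mathrm{Hom}_P$. For $S\in\mathrm{Int}(P)$, $\mathbb I_S$ is the representation with $\mathbb I_S(x)=k$ for $x\in S$ and $0$ otherwise, and $\mathbb I_S(x\le y)=\mathrm{id}$ if $x,y\in S$ and $0$ otherwise. Put $G_P=\bigoplus_{S\in\mathrm{Int}(P)}\mathbb I_S$ and $\Lambda_P=\mathrm{End}_P(G_P)^{\mathrm{op}}$; $e_S\in\Lambda_P$ is the idempotent of the summand $\mathbb I_S$, so $e_R\Lambda_Pe_S=\mathrm{Hom}_P(\mathbb I_R,\mathbb I_S)$. A morphism $f$ viewed in $\Lambda_P$ is written $f^{\mathrm{op}}$, so $f^{\mathrm{op}}g^{\mathrm{op}}=(g\circ f)^{\mathrm{op}}$. All modules are finitely generated left modules. $\mathsf P(S)=\Lambda_Pe_S=\bigoplus_R\mathrm{Hom}_P(\mathbb I_R,\mathbb I_S)$ and $\mathsf L(S)=\mathsf P(S)/\operatorname{rad}\mathsf P(S)$. A module $M$ is thin if $\dim_k e_RM\le1$ for all $R$; its support is $\{R\mid e_RM\ne0\}$. For $S\in\mathrm{Int}(P)$, a subset $C\subseteq S$ is a relative upset (resp. relative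 downset) in $S$ if $c\in C$, $x\in S$ and $c\le x$ (resp. $x\le c$) imply $x\in C$. $\mathcal U(S)$ (resp. $\mathcal D(S)$) is the set of intervals contained in $S$ that are relative upsets (resp. relative downsets) in $S$. Put $\mathrm{Adm}(R,S)=\mathcal D(R)\cap\mathcal U(S)$. For $C\in\mathrm{Adm}(R,S)$, $\rho_{R,S}^C\colon\mathbb I_R\to\mathbb I_S$ is the morphism that is $\mathrm{id}_k$ at points of $C$ and $0$ elsewhere; these morphisms form a basis of $\mathrm{Hom}_P(\mathbb I_R,\mathbb I_S)$. For $U\in\mathcal D(R)$ put $q_{R,U}=\rho_{R,U}^U$. $\Lambda_P$ carries the quasi-hereditary order on $\mathrm{Int}(P)$ given by $R\preceq S$ iff $R=S$ or $|R|>|S|$. The standard module $\Delta(S)$ is the largest quotient of $\mathsf P(S)$ all of whose composition factors are of the form $\mathsf L(R)$ with $R\preceq S$; for $f\in\mathsf P(S)$, $[f]$ denotes its image in $\Delta(S)$. *)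

theory Defs
  imports "HOL-Algebra.QuotRing" "Jordan_Normal_Form.Missing_VectorSpace"
begin

section \<open>Intervals of a poset\<close>

definition poset_connected :: "'p::order set \<Rightarrow> bool" where
  "poset_connected S \<longleftrightarrow>
     (\<forall>x\<in>S. \<forall>y\<in>S. (\<lambda>a b. a \<in> S \<and> b \<in> S \<and> (a \<le> b \<or> b \<le> a))\<^sup>*\<^sup>* x y)"

definition poset_convex :: "'p::order set \<Rightarrow> bool" where
  "poset_convex S \<longleftrightarrow> (\<forall>x\<in>S. \<forall>y\<in>S. \<forall>z. x \<le> z \<and> z \<le> y \<longrightarrow> z \<in> S)"

definition intervals :: "'p::order set set" where
  "intervals = {S. S \<noteq> {} \<and> poset_connected S \<and> poset_convex S}"

definition rel_upset :: "'p::order set \<Rightarrow> 'p set \<Rightarrow> bool" where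
  "rel_upset S C \<longleftrightarrow> C \<subseteq> S \<and> (\<forall>c\<in>C. \<forall>x\<in>S. c \<le> x \<longrightarrow> x \<in> C)"

definition rel_downset :: "'p::order set \<Rightarrow> 'p set \<Rightarrow> bool" where
  "rel_downset S C \<longleftrightarrow> C \<subseteq> S \<and> (\<forall>c\<in>C. \<forall>x\<in>S. x \<le> c \<longrightarrow> x \<in> C)"

definition upset_intervals :: "'p::order set \<Rightarrow> 'p set set" where
  "upset_intervals S = {C \<in> intervals. rel_upset S C}"

definition downset_intervals :: "'p::order set \<Rightarrow> 'p set set" where
  "downset_intervals S = {C \<in> intervals. rel_downset S C}"

definition Adm :: "'p::order set \<Rightarrow> 'p set \<Rightarrow> 'p set set" where
  "Adm R S = downset_intervals R \<inter> upset_intervals S"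

text \<open>\<open>R \<preceq> S\<close> in the quasi-hereditary order: larger intervals are smaller.\<close>

definition qh_le :: "'p::order set \<Rightarrow> 'p set \<Rightarrow> bool" where
  "qh_le R S \<longleftrightarrow> R = S \<or> card R > card S"

definition ext_set :: "'p::order set \<Rightarrow> 'p set set" where
  "ext_set S = {R \<in> intervals. S \<in> downset_intervals R}"


section \<open>Modules over a not necessarily commutative ring\<close>

text \<open>
  The locale \<open>module\<close> of HOL-Algebra requires a commutative ring of scalars, so left modules
  are introduced here, on the same records.  The locale \<open>Module.submodule\<close> and the set
  \<open>module_hom\<close> do not refer to commutativity and are used as they are.
\<close>

locale left_module = R?: ring R + M?: abelian_group M
  for R :: "('a, 'm) ring_scheme" (structure) and M :: "('a, 'b, 'n) module_scheme" (structure) +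
  assumes smult_closed:
      "\<lbrakk>a \<in> carrier R; x \<in> carrier M\<rbrakk> \<Longrightarrow> a \<odot>\<^bsub>M\<^esub> x \<in> carrier M"
    and smult_l_distr:
      "\<lbrakk>a \<in> carrier R; b \<in> carrier R; x \<in> carrier M\<rbrakk> \<Longrightarrow>
        (a \<oplus>\<^bsub>R\<^esub> b) \<odot>\<^bsub>M\<^esub> x = a \<odot>\<^bsub>M\<^esub> x \<oplus>\<^bsub>M\<^esub> b \<odot>\<^bsub>M\<^esub> x"
    and smult_r_distr:
      "\<lbrakk>a \<in> carrier R; x \<in> carrier M; y \<in> carrier M\<rbrakk> \<Longrightarrow>
        a \<odot>\<^bsub>M\<^esub> (x \<oplus>\<^bsub>M\<^esub> y) = a \<odot>\<^bsub>M\<^esub> x \<oplus>\<^bsub>M\<^esub> a \<odot>\<^bsub>M\<^esub> y"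
    and smult_assoc:
      "\<lbrakk>a \<in> carrier R; b \<in> carrier R; x \<in> carrier M\<rbrakk> \<Longrightarrow>
        (a \<otimes>\<^bsub>R\<^esub> b) \<odot>\<^bsub>M\<^esub> x = a \<odot>\<^bsub>M\<^esub> (b \<odot>\<^bsub>M\<^esub> x)"
    and smult_one: "x \<in> carrier M \<Longrightarrow> \<one>\<^bsub>R\<^esub> \<odot>\<^bsub>M\<^esub> x = x"

definition finitely_generated :: "('a, 'm) ring_scheme \<Rightarrow> ('a, 'b) module \<Rightarrow> bool" where
  "finitely_generated R M \<longleftrightarrow>
     (\<exists>A. finite A \<and> A \<subseteq> carrier M \<and>
          (\<forall>N. Module.submodule N R M \<and> A \<subseteq> N \<longrightarrow> N = carrier M))"

definition module_isomorphic ::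
  "('a, 'm) ring_scheme \<Rightarrow> ('a, 'b) module \<Rightarrow> ('a, 'c) module \<Rightarrow> bool" where
  "module_isomorphic R M N \<longleftrightarrow> (\<exists>h \<in> module_hom R M N. bij_betw h (carrier M) (carrier N))"

text \<open>The ring multiplication and unit of a module record play no role and are left unspecified.\<close>

definition quot_module :: "('a, 'b) module \<Rightarrow> 'b set \<Rightarrow> ('a, 'b set) module" where
  "quot_module M N =
     \<lparr>carrier = a_rcosets\<^bsub>M\<^esub> N, mult = undefined, one = undefined,
      zero = N, add = (\<lambda>X Y. X <+>\<^bsub>M\<^esub> Y),
      smult = (\<lambda>a X. \<Union>x\<in>X. N +>\<^bsub>M\<^esub> (a \<odot>\<^bsub>M\<^esub> x))\<rparr>"

definition simple_module :: "('a, 'm) ring_scheme \<Rightarrow> ('a, 'b) module \<Rightarrow> bool" where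
  "simple_module R M \<longleftrightarrow>
     carrier M \<noteq> {\<zero>\<^bsub>M\<^esub>} \<and>
     (\<forall>N. Module.submodule N R M \<longrightarrow> N = {\<zero>\<^bsub>M\<^esub>} \<or> N = carrier M)"

definition maximal_submodule :: "('a, 'm) ring_scheme \<Rightarrow> ('a, 'b) module \<Rightarrow> 'b set \<Rightarrow> bool" where
  "maximal_submodule R M N \<longleftrightarrow>
     Module.submodule N R M \<and> N \<noteq> carrier M \<and>
     (\<forall>N'. Module.submodule N' R M \<and> N \<subseteq> N' \<longrightarrow> N' = N \<or> N' = carrier M)"

definition module_rad :: "('a, 'm) ring_scheme \<Rightarrow> ('a, 'b) module \<Rightarrow> 'b set" where
  "module_rad R M = carrier M \<inter> \<Inter> {N. maximal_submodule R M N}"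

definition composition_series ::
  "('a, 'm) ring_scheme \<Rightarrow> ('a, 'b) module \<Rightarrow> 'b set list \<Rightarrow> bool" where
  "composition_series R M Ns \<longleftrightarrow>
     Ns \<noteq> [] \<and> hd Ns = {\<zero>\<^bsub>M\<^esub>} \<and> last Ns = carrier M \<and>
     (\<forall>N\<in>set Ns. Module.submodule N R M) \<and>
     (\<forall>i. Suc i < length Ns \<longrightarrow> Ns ! i \<subseteq> Ns ! Suc i \<and>
        simple_module R (quot_module (M\<lparr>carrier := Ns ! Suc i\<rparr>) (Ns ! i)))"

definition composition_factors ::
  "('a, 'm) ring_scheme \<Rightarrow> ('a, 'b) module \<Rightarrow> ('a, 'b set) module set" where
  "composition_factors R M =
     {quot_module (M\<lparr>carrier := Ns ! Suc i\<rparr>) (Ns ! i) | Ns i.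
        composition_series R M Ns \<and> Suc i < length Ns}"


section \<open>Representations of a poset\<close>

text \<open>
  A representation assigns to each point a vector space, and to each pair \<open>x \<le> y\<close> a linear
  map; \<open>rmap V x y\<close> is irrelevant unless \<open>x \<le> y\<close>, and outside of the carrier of \<open>space V x\<close>.
\<close>

record ('p, 'k, 'v) poset_rep =
  space :: "'p \<Rightarrow> ('k, 'v) module"
  rmap :: "'p \<Rightarrow> 'p \<Rightarrow> 'v \<Rightarrow> 'v"

definition is_poset_rep ::
  "('k, 'm) ring_scheme \<Rightarrow> ('p::order, 'k, 'v) poset_rep \<Rightarrow> bool" where
  "is_poset_rep K V \<longleftrightarrow>
     (\<forall>x. vectorspace K (space V x) \<and> vectorspace.fin_dim K (space V x)) \<and>
     (\<forall>x y. x \<le> y \<longrightarrow> rmap V x y \<in> module_hom K (space V x) (space V y)) \<and>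
     (\<forall>x. \<forall>v \<in> carrier (space V x). rmap V x x v = v) \<and>
     (\<forall>x y z. x \<le> y \<longrightarrow> y \<le> z \<longrightarrow>
        (\<forall>v \<in> carrier (space V x). rmap V y z (rmap V x y v) = rmap V x z v))"

text \<open>Morphisms are made extensional so that they are equal iff they agree on the carriers.\<close>

definition rep_hom ::
  "('k, 'm) ring_scheme \<Rightarrow> ('p::order, 'k, 'v) poset_rep \<Rightarrow> ('p, 'k, 'w) poset_rep
     \<Rightarrow> ('p \<Rightarrow> 'v \<Rightarrow> 'w) set" where
  "rep_hom K V W =
     {f. (\<forall>x. f x \<in> extensional (carrier (space V x)) \<inter> module_hom K (space V x) (space W x)) \<and>
         (\<forall>x y. x \<le> y \<longrightarrow>
            (\<forall>v \<in> carrier (space V x). rmap W x y (f x v) = f y (rmap V x y v)))}"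

definition rep_id :: "('p, 'k, 'v) poset_rep \<Rightarrow> 'p \<Rightarrow> 'v \<Rightarrow> 'v" where
  "rep_id V = (\<lambda>x. \<lambda>v \<in> carrier (space V x). v)"

text \<open>\<open>rep_comp V g f\<close> is \<open>g \<circ> f\<close>, where \<open>V\<close> is the source of \<open>f\<close>.\<close>

definition rep_comp ::
  "('p, 'k, 'v) poset_rep \<Rightarrow> ('p \<Rightarrow> 'w \<Rightarrow> 'u) \<Rightarrow> ('p \<Rightarrow> 'v \<Rightarrow> 'w) \<Rightarrow> 'p \<Rightarrow> 'v \<Rightarrow> 'u" where
  "rep_comp V g f = (\<lambda>x. compose (carrier (space V x)) (g x) (f x))"

text \<open>The opposite of the endomorphism ring: the product of \<open>f\<close> and \<open>g\<close> is \<open>g \<circ> f\<close>.\<close>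

definition End_op ::
  "('k, 'm) ring_scheme \<Rightarrow> ('p::order, 'k, 'v) poset_rep \<Rightarrow> ('p \<Rightarrow> 'v \<Rightarrow> 'v) ring" where
  "End_op K V =
     \<lparr>carrier = rep_hom K V V,
      mult = (\<lambda>f g. rep_comp V g f),
      one = rep_id V,
      zero = (\<lambda>x. \<lambda>v \<in> carrier (space V x). \<zero>\<^bsub>space V x\<^esub>),
      add = (\<lambda>f g x. \<lambda>v \<in> carrier (space V x). f x v \<oplus>\<^bsub>space V x\<^esub> g x v)\<rparr>"

text \<open>Direct sum over a finite index set, realised as the product.\<close>

definition rep_sum ::
  "'i set \<Rightarrow> ('i \<Rightarrow> ('p, 'k, 'v) poset_rep) \<Rightarrow> ('p, 'k, 'i \<Rightarrow> 'v) poset_rep" where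
  "rep_sum I V =
     \<lparr>space = (\<lambda>x.
        \<lparr>carrier = (\<Pi>\<^sub>E i\<in>I. carrier (space (V i) x)), mult = undefined, one = undefined,
         zero = (\<lambda>i\<in>I. \<zero>\<^bsub>space (V i) x\<^esub>),
         add = (\<lambda>v w. \<lambda>i\<in>I. v i \<oplus>\<^bsub>space (V i) x\<^esub> w i),
         smult = (\<lambda>c v. \<lambda>i\<in>I. c \<odot>\<^bsub>space (V i) x\<^esub> v i)\<rparr>),
      rmap = (\<lambda>x y v. \<lambda>i\<in>I. rmap (V i) x y (v i))\<rparr>"

definition rep_proj ::
  "'i set \<Rightarrow> ('i \<Rightarrow> ('p, 'k, 'v) poset_rep) \<Rightarrow> 'i \<Rightarrow> 'p \<Rightarrow> ('i \<Rightarrow> 'v) \<Rightarrow> 'v" where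
  "rep_proj I V i = (\<lambda>x. \<lambda>v \<in> carrier (space (rep_sum I V) x). v i)"

definition rep_incl ::
  "'i set \<Rightarrow> ('i \<Rightarrow> ('p, 'k, 'v) poset_rep) \<Rightarrow> 'i \<Rightarrow> 'p \<Rightarrow> 'v \<Rightarrow> ('i \<Rightarrow> 'v)" where
  "rep_incl I V i =
     (\<lambda>x. \<lambda>v \<in> carrier (space (V i) x). \<lambda>j\<in>I. if j = i then v else \<zero>\<^bsub>space (V j) x\<^esub>)"


section \<open>Interval representations and their endomorphism algebra\<close>

definition interval_rep :: "('k, 'm) ring_scheme \<Rightarrow> 'p set \<Rightarrow> ('p::order, 'k, 'k) poset_rep" where
  "interval_rep K S =
     \<lparr>space = (\<lambda>x.
        \<lparr>carrier = (if x \<in> S then carrier K else {\<zero>\<^bsub>K\<^esub>}), mult = undefined, one = undefined,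
         zero = \<zero>\<^bsub>K\<^esub>, add = add K, smult = mult K\<rparr>),
      rmap = (\<lambda>x y v. if x \<in> S \<and> y \<in> S then v else \<zero>\<^bsub>K\<^esub>)\<rparr>"

lemma vectorspace_interval_rep:
  assumes "field K" shows "vectorspace K (space (interval_rep K S) x)"
proof -
  interpret K: field K by fact
  have ag: "abelian_group (space (interval_rep K S) x)"
  proof (rule abelian_groupI, goal_cases)
    case (6 v)
    then show ?case
      by (intro bexI[of _ "\<ominus>\<^bsub>K\<^esub> v"]) (simp_all add: interval_rep_def K.l_neg split: if_splits)
  qed (simp_all add: interval_rep_def K.a_ac split: if_splits)
  have "module K (space (interval_rep K S) x)"
    by (rule moduleI[OF K.is_cring ag])
      (auto simp: interval_rep_def K.l_distr K.r_distr K.m_assoc split: if_splits)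
  then show ?thesis using assms by (simp add: vectorspace_def)
qed

lemma fin_dim_interval_rep:
  assumes "field K" shows "vectorspace.fin_dim K (space (interval_rep K S) x)"
proof -
  let ?V = "space (interval_rep K S) x"
  interpret V: vectorspace K ?V by (rule vectorspace_interval_rep[OF assms])
  interpret K: field K by fact
  let ?A = "if x \<in> S then {\<one>\<^bsub>K\<^esub>} else {}"
  have A: "?A \<subseteq> carrier ?V" "finite ?A" by (auto simp: interval_rep_def)
  have "V.gen_set ?A"
  proof
    show "V.span ?A \<subseteq> carrier ?V" by (rule V.span_is_subset2[OF A(1)])
    show "carrier ?V \<subseteq> V.span ?A"
    proof
      fix v assume v: "v \<in> carrier ?V"
      show "v \<in> V.span ?A"
      proof (cases "x \<in> S")
        case True
        then have vK: "v \<in> carrier K" using v by (simp add: interval_rep_def)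
        have s: "smult ?V = mult K" by (simp add: interval_rep_def)
        have o: "\<one>\<^bsub>K\<^esub> \<in> carrier ?V" using True by (simp add: interval_rep_def)
        have "v \<odot>\<^bsub>?V\<^esub> \<one>\<^bsub>K\<^esub> \<in> V.span ?A"
        proof (rule LinearCombinations.submodule.smult_closed[OF V.span_is_submodule[OF A(1)] vK])
          show "\<one>\<^bsub>K\<^esub> \<in> V.span ?A" using V.in_own_span[OF A(1)] True by auto
        qed
        then show ?thesis using vK s by simp
      next
        case False
        then show ?thesis using v V.span_is_submodule[OF A(1)] LinearCombinations.submodule.zero_closed
          by (fastforce simp: interval_rep_def)
      qed
    qed
  qed
  with A show ?thesis by (auto simp: V.fin_dim_def)
qed

lemma is_poset_rep_interval_rep:
  assumes "field K" "S \<in> intervals"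
  shows "is_poset_rep K (interval_rep K S)"
proof -
  interpret K: field K by fact
  have cv: "y \<in> S" if "x \<in> S" "z \<in> S" "x \<le> y" "y \<le> z" for x y z
    using assms(2) that unfolding intervals_def poset_convex_def by blast
  have hom: "rmap (interval_rep K S) x y
      \<in> module_hom K (space (interval_rep K S) x) (space (interval_rep K S) y)" for x y
    by (cases "x \<in> S"; cases "y \<in> S") (simp_all add: interval_rep_def module_hom_def)
  have comp: "rmap (interval_rep K S) y z (rmap (interval_rep K S) x y v) = rmap (interval_rep K S) x z v"
    if "x \<le> y" "y \<le> z" "v \<in> carrier (space (interval_rep K S) x)" for x y z v
    using cv[OF _ _ that(1,2)] that(3)
    by (cases "x \<in> S"; cases "y \<in> S"; cases "z \<in> S") (simp_all add: interval_rep_def)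
  have ident: "rmap (interval_rep K S) x x v = v"
    if "v \<in> carrier (space (interval_rep K S) x)" for x v
    using that by (cases "x \<in> S") (simp_all add: interval_rep_def)
  show ?thesis
    unfolding is_poset_rep_def
    by (intro conjI allI impI ballI vectorspace_interval_rep[OF assms(1)]
        fin_dim_interval_rep[OF assms(1)] hom comp ident)
qed

definition rho ::
  "('k, 'm) ring_scheme \<Rightarrow> 'p::order set \<Rightarrow> 'p set \<Rightarrow> 'p set \<Rightarrow> 'p \<Rightarrow> 'k \<Rightarrow> 'k" where
  "rho K R S C =
     (\<lambda>x. \<lambda>v \<in> carrier (space (interval_rep K R) x).
        if x \<in> C then v else \<zero>\<^bsub>space (interval_rep K S) x\<^esub>)"

definition q_mor :: "('k, 'm) ring_scheme \<Rightarrow> 'p::order set \<Rightarrow> 'p set \<Rightarrow> 'p \<Rightarrow> 'k \<Rightarrow> 'k" where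
  "q_mor K R U = rho K R U U"

definition G_rep :: "('k, 'm) ring_scheme \<Rightarrow> ('p::order, 'k, 'p set \<Rightarrow> 'k) poset_rep" where
  "G_rep K = rep_sum intervals (interval_rep K)"

type_synonym ('p, 'k) lam = "'p \<Rightarrow> ('p set \<Rightarrow> 'k) \<Rightarrow> ('p set \<Rightarrow> 'k)"

definition Lambda :: "('k, 'm) ring_scheme \<Rightarrow> ('p::order, 'k) lam ring" where
  "Lambda K = End_op K (G_rep K)"

text \<open>
  \<open>f\<^sup>o\<^sup>p\<close>: a morphism \<open>f\<close> from the summand of \<open>R\<close> to the summand of \<open>S\<close>, viewed as the
  endomorphism \<open>G \<rightarrow> I\<^sub>R \<rightarrow> I\<^sub>S \<rightarrow> G\<close>.
\<close>

definition op_elt ::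
  "('k, 'm) ring_scheme \<Rightarrow> 'p::order set \<Rightarrow> 'p set \<Rightarrow> ('p \<Rightarrow> 'k \<Rightarrow> 'k) \<Rightarrow> ('p, 'k) lam" where
  "op_elt K R S f =
     rep_comp (G_rep K) (rep_incl intervals (interval_rep K) S)
       (rep_comp (G_rep K) f (rep_proj intervals (interval_rep K) R))"

definition idem :: "('k, 'm) ring_scheme \<Rightarrow> 'p::order set \<Rightarrow> ('p, 'k) lam" where
  "idem K S = op_elt K S S (rep_id (interval_rep K S))"

text \<open>The structure map of the algebra \<open>\<Lambda>\<close> over the base field.\<close>

definition scalar :: "('k, 'm) ring_scheme \<Rightarrow> 'k \<Rightarrow> ('p::order, 'k) lam" where
  "scalar K c = (\<lambda>x. \<lambda>v \<in> carrier (space (G_rep K) x). c \<odot>\<^bsub>space (G_rep K) x\<^esub> v)"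

text \<open>\<open>e\<^sub>R M\<close> as a vector space over the base field, which acts through \<open>scalar\<close>.\<close>

definition component ::
  "('k, 'm) ring_scheme \<Rightarrow> 'p::order set \<Rightarrow> (('p, 'k) lam, 'b) module \<Rightarrow> ('k, 'b) module" where
  "component K R M =
     \<lparr>carrier = {idem K R \<odot>\<^bsub>M\<^esub> m | m. m \<in> carrier M}, mult = undefined, one = undefined,
      zero = \<zero>\<^bsub>M\<^esub>, add = add M, smult = (\<lambda>c m. scalar K c \<odot>\<^bsub>M\<^esub> m)\<rparr>"

definition thin :: "('k, 'm) ring_scheme \<Rightarrow> (('p::order, 'k) lam, 'b) module \<Rightarrow> bool" where
  "thin K M \<longleftrightarrow>
     (\<forall>R\<in>intervals. vectorspace K (component K R M) \<and>
        vectorspace.fin_dim K (component K R M) \<and> vectorspace.dim K (component K R M) \<le> 1)"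

definition supp :: "('k, 'm) ring_scheme \<Rightarrow> (('p::order, 'k) lam, 'b) module \<Rightarrow> 'p set set" where
  "supp K M = {R \<in> intervals. carrier (component K R M) \<noteq> {\<zero>\<^bsub>M\<^esub>}}"

definition P_mod ::
  "('k, 'm) ring_scheme \<Rightarrow> 'p::order set \<Rightarrow> (('p, 'k) lam, ('p, 'k) lam) module" where
  "P_mod K S =
     \<lparr>carrier = {a \<otimes>\<^bsub>Lambda K\<^esub> idem K S | a. a \<in> carrier (Lambda K)},
      mult = undefined, one = undefined,
      zero = \<zero>\<^bsub>Lambda K\<^esub>, add = add (Lambda K), smult = mult (Lambda K)\<rparr>"

definition L_mod ::
  "('k, 'm) ring_scheme \<Rightarrow> 'p::order set \<Rightarrow> (('p, 'k) lam, ('p, 'k) lam set) module" where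
  "L_mod K S = quot_module (P_mod K S) (module_rad (Lambda K) (P_mod K S))"

definition factors_below ::
  "('k, 'm) ring_scheme \<Rightarrow> 'p::order set \<Rightarrow> (('p, 'k) lam, 'b) module \<Rightarrow> bool" where
  "factors_below K S M \<longleftrightarrow>
     (\<forall>F \<in> composition_factors (Lambda K) M.
        \<exists>R\<in>intervals. qh_le R S \<and> module_isomorphic (Lambda K) F (L_mod K R))"

text \<open>The kernel of \<open>P(S) \<rightarrow> \<Delta>(S)\<close>: the largest quotient is the one by the least submodule.\<close>

definition Delta_ker :: "('k, 'm) ring_scheme \<Rightarrow> 'p::order set \<Rightarrow> ('p, 'k) lam set" where
  "Delta_ker K S =
     (THE N. Module.submodule N (Lambda K) (P_mod K S) \<and>
             factors_below K S (quot_module (P_mod K S) N) \<and>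
             (\<forall>N'. Module.submodule N' (Lambda K) (P_mod K S) \<and>
                   factors_below K S (quot_module (P_mod K S) N') \<longrightarrow> N \<subseteq> N'))"

definition Delta ::
  "('k, 'm) ring_scheme \<Rightarrow> 'p::order set \<Rightarrow> (('p, 'k) lam, ('p, 'k) lam set) module" where
  "Delta K S = quot_module (P_mod K S) (Delta_ker K S)"

text \<open>\<open>[f]\<close> for a morphism \<open>f\<close> from the summand of \<open>R\<close> to the summand of \<open>S\<close>.\<close>

definition Delta_class ::
  "('k, 'm) ring_scheme \<Rightarrow> 'p::order set \<Rightarrow> 'p set \<Rightarrow> ('p \<Rightarrow> 'k \<Rightarrow> 'k) \<Rightarrow> ('p, 'k) lam set" where
  "Delta_class K S R f = Delta_ker K S +>\<^bsub>P_mod K S\<^esub> op_elt K R S f"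

end

theory Submission
  imports Defs
begin

text \<open>
  Let \<open>E\<^sub>S\<close> be the set of all \<open>R\<close> with \<open>S \<in> D(R)\<close>.  A morphism \<open>I\<^sub>R \<rightarrow> I\<^sub>S\<close> is a function on
  \<open>R \<inter> S\<close>, constant on the connected components of its support, and these components lie in
  \<open>Adm(R, S)\<close>.  If \<open>R \<notin> E\<^sub>S\<close>, then no component is all of \<open>S\<close>, so the morphism is a sum of morphisms
  that factor through intervals smaller than \<open>S\<close>.  If \<open>R \<in> E\<^sub>S\<close>, then \<open>R \<inter> S = S\<close> is connected and the
  morphism is a multiple of \<open>q\<^sub>R\<^sub>,\<^sub>S\<close>.  Hence the kernel of \<open>P(S) \<rightarrow> \<Delta>(S)\<close> is the set of all \<open>f\<close> with
  \<open>e\<^sub>R f = 0\<close> for \<open>R \<in> E\<^sub>S\<close>; it is a submodule because a composite \<open>I\<^sub>Q \<rightarrow> I\<^sub>R \<rightarrow> I\<^sub>S\<close> with \<open>Q \<in> E\<^sub>S\<close>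
  that is nonzero is nonzero on all of \<open>S\<close>, which forces \<open>R \<in> E\<^sub>S\<close>.

  Composition factors are detected by the idempotents: \<open>L(R)\<close> is the only simple module that
  \<open>e\<^sub>R\<close> does not annihilate, since \<open>rad P(R)\<close> consists of all \<open>f \<in> P(R)\<close> with \<open>e\<^sub>R f = 0\<close>.
\<close>

section \<open>Left modules\<close>

text \<open>The condition on composition factors speaks only of existing composition series, so it
  would be vacuous for a module without one. Hence every quotient of P(S) must be shown to have
  finite length; this is what lets the minimality of the kernel pass from the factors to the
  quotient itself. The radicals are governed by two properties of the idempotents: the corner at S
  is the field k, and every composite from I_S to I_R and back to I_S vanishes for R different from
  S. The second one makes the f in P(S) with e_S f = 0 a submodule. The kernel of the projection
  onto \<Delta>(S) arises in the same way, with the set E_S in place of the single index S, so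
  \<open>vanishing_submodule\<close> serves both. The first half works with idempotents of an
  arbitrary ring; the poset enters through scalar functions on points, under which composition
  becomes pointwise multiplication.\<close>

lemma submoduleD:
  assumes "Module.submodule N R M"
  shows "N \<subseteq> carrier M" "\<zero>\<^bsub>M\<^esub> \<in> N"
    "\<And>x y. \<lbrakk>x \<in> N; y \<in> N\<rbrakk> \<Longrightarrow> x \<oplus>\<^bsub>M\<^esub> y \<in> N"
    "\<And>a x. \<lbrakk>a \<in> carrier R; x \<in> N\<rbrakk> \<Longrightarrow> a \<odot>\<^bsub>M\<^esub> x \<in> N"
  using subgroup.subset[OF Module.submodule.axioms(1)[OF assms]]
    subgroup.one_closed[OF Module.submodule.axioms(1)[OF assms]]
    subgroup.m_closed[OF Module.submodule.axioms(1)[OF assms]]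
    Module.submodule.smult_closed[OF assms] by auto

context left_module
begin

lemma smult_r_null: "a \<in> carrier R \<Longrightarrow> a \<odot>\<^bsub>M\<^esub> \<zero>\<^bsub>M\<^esub> = \<zero>\<^bsub>M\<^esub>"
  by (metis M.add.r_cancel_one' M.r_zero M.zero_closed smult_closed smult_r_distr)

lemma smult_l_null: "x \<in> carrier M \<Longrightarrow> \<zero> \<odot>\<^bsub>M\<^esub> x = \<zero>\<^bsub>M\<^esub>"
  by (metis M.add.r_cancel_one' R.r_zero R.zero_closed smult_closed smult_l_distr)

lemma minus_eq_smult: "x \<in> carrier M \<Longrightarrow> \<ominus>\<^bsub>M\<^esub> x = (\<ominus> \<one>) \<odot>\<^bsub>M\<^esub> x"
  by (metis M.minus_equality R.a_inv_closed R.l_neg R.one_closed smult_closed smult_l_distr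
      smult_l_null smult_one)

lemma submoduleI:
  assumes "H \<subseteq> carrier M" "\<zero>\<^bsub>M\<^esub> \<in> H" "\<And>x y. \<lbrakk>x \<in> H; y \<in> H\<rbrakk> \<Longrightarrow> x \<oplus>\<^bsub>M\<^esub> y \<in> H"
    "\<And>a x. \<lbrakk>a \<in> carrier R; x \<in> H\<rbrakk> \<Longrightarrow> a \<odot>\<^bsub>M\<^esub> x \<in> H"
  shows "Module.submodule H R M"
proof -
  have "inv\<^bsub>add_monoid M\<^esub> x \<in> H" if "x \<in> H" for x
    using assms(4)[of "\<ominus> \<one>" x] that assms(1) minus_eq_smult[of x]
    unfolding a_inv_def[symmetric] by auto
  then show ?thesis
    using assms by (intro Module.submodule.intro subgroup.intro submodule_axioms.intro) auto
qed

lemma carrier_submodule: "Module.submodule (carrier M) R M"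
  by (rule submoduleI) (auto intro: smult_closed)

lemma zero_submodule: "Module.submodule {\<zero>\<^bsub>M\<^esub>} R M"
  by (rule submoduleI) (auto simp: smult_r_null)

lemma submodule_minus:
  assumes "Module.submodule N R M" "x \<in> N" "y \<in> N"
  shows "x \<ominus>\<^bsub>M\<^esub> y \<in> N"
  using submoduleD[OF assms(1)] assms(2,3) minus_eq_smult[of y]
  by (simp add: M.minus_eq subset_iff)

lemma submodule_finsum:
  assumes "Module.submodule N R M" "finite A" "\<And>i. i \<in> A \<Longrightarrow> f i \<in> N"
  shows "finsum M f A \<in> N"
  using assms(2,3)
proof induction
  case (insert i A)
  then show ?case
    using submoduleD[OF assms(1)] by (subst M.finsum_insert) auto
qed (use submoduleD[OF assms(1)] in simp)

lemma finsum_smult: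
  assumes "finite A" "f \<in> A \<rightarrow> carrier R" "x \<in> carrier M"
  shows "finsum R f A \<odot>\<^bsub>M\<^esub> x = finsum M (\<lambda>i. f i \<odot>\<^bsub>M\<^esub> x) A"
  using assms(1,2)
proof induction
  case (insert i A)
  then have "finsum M (\<lambda>i. f i \<odot>\<^bsub>M\<^esub> x) (insert i A) = f i \<odot>\<^bsub>M\<^esub> x \<oplus>\<^bsub>M\<^esub> finsum M (\<lambda>i. f i \<odot>\<^bsub>M\<^esub> x) A"
    using assms(3) by (intro M.finsum_insert) (auto intro: smult_closed)
  moreover have "finsum R f (insert i A) = f i \<oplus> finsum R f A"
    using insert by (intro R.finsum_insert) auto
  ultimately show ?case
    using insert assms(3) by (auto simp: smult_l_distr Pi_def)
qed (simp add: smult_l_null assms(3))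

end

text \<open>A composition factor is a quotient of a term of the series rather than of
  \<open>M\<close>, so each term has to be a module in its own right.\<close>

lemma restrict_left_module:
  assumes "left_module R M" "Module.submodule N R M"
  shows "left_module R (M\<lparr>carrier := N\<rparr>)"
proof -
  interpret left_module R M by fact
  note N = submoduleD[OF assms(2)]
  have c: "x \<in> carrier M" if "x \<in> N" for x using N(1) that by auto
  have "abelian_group (M\<lparr>carrier := N\<rparr>)"
  proof (rule abelian_groupI, goal_cases)
    case (6 x)
    then show ?case
      using submodule_minus[OF assms(2) N(2), of x] c by (intro bexI[of _ "\<zero>\<^bsub>M\<^esub> \<ominus>\<^bsub>M\<^esub> x"])
      (auto simp: M.minus_eq M.l_neg)
  qed (use N c in \<open>auto simp: M.a_ac\<close>)
  then show ?thesis
    using N c by (intro left_module.intro left_module_axioms.intro R.ring_axioms)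
      (auto simp: smult_l_distr smult_r_distr smult_assoc smult_one)
qed

lemma submodule_restrict:
  assumes "left_module R M" "Module.submodule N R M" "Module.submodule X R M" "X \<subseteq> N"
  shows "Module.submodule X R (M\<lparr>carrier := N\<rparr>)"
  using submoduleD[OF assms(3)] assms(4)
  by (intro left_module.submoduleI[OF restrict_left_module[OF assms(1,2)]]) auto

lemma submodule_unrestrict:
  assumes "left_module R M" "Module.submodule N R M" "Module.submodule X R (M\<lparr>carrier := N\<rparr>)"
  shows "Module.submodule X R M"
  using submoduleD[OF assms(3)] submoduleD(1)[OF assms(2)]
  by (intro left_module.submoduleI[OF assms(1)]) auto

subsection \<open>Quotient modules\<close>

locale module_quotient = left_module R M for R :: "('a, 'm) ring_scheme" (structure)
    and M :: "('a, 'b) module" (structure) +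
  fixes N
  assumes submodule: "Module.submodule N R M"
begin

lemmas N = submoduleD[OF submodule]

sublocale abelian_subgroup N M
  using submodule M.abelian_group_axioms
  by (intro abelian_subgroupI3 additive_subgroup.intro) (simp_all add: Module.submodule_def)

abbreviation "Q \<equiv> quot_module M N"

lemma carrier_quot: "carrier Q = (\<lambda>x. N +>\<^bsub>M\<^esub> x) ` carrier M"
  by (auto simp: quot_module_def A_RCOSETS_def')

lemma zero_quot: "\<zero>\<^bsub>Q\<^esub> = N"
  by (simp add: quot_module_def)

lemma coset_mem: "x \<in> carrier M \<Longrightarrow> N +>\<^bsub>M\<^esub> x \<in> carrier Q"
  by (simp add: carrier_quot)

lemma add_quot:
  "\<lbrakk>x \<in> carrier M; y \<in> carrier M\<rbrakk> \<Longrightarrow> (N +>\<^bsub>M\<^esub> x) \<oplus>\<^bsub>Q\<^esub> (N +>\<^bsub>M\<^esub> y) = N +>\<^bsub>M\<^esub> (x \<oplus>\<^bsub>M\<^esub> y)"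
  by (simp add: quot_module_def a_rcos_sum)

lemma coset_eq_iff:
  "\<lbrakk>x \<in> carrier M; y \<in> carrier M\<rbrakk> \<Longrightarrow> N +>\<^bsub>M\<^esub> x = N +>\<^bsub>M\<^esub> y \<longleftrightarrow> x \<ominus>\<^bsub>M\<^esub> y \<in> N"
  by (metis M.a_coset_add_inv1 M.a_coset_add_inv2 M.a_coset_join1 M.a_coset_join2 M.minus_closed
      M.minus_eq N(1) a_subgroup)

lemma coset_eq_N_iff: "x \<in> carrier M \<Longrightarrow> N +>\<^bsub>M\<^esub> x = N \<longleftrightarrow> x \<in> N"
  by (metis M.a_coset_join1 M.a_coset_join2 a_subgroup)

text \<open>\<open>quot_module\<close> defines the action as a union over all representatives of a
  coset. Two representatives differ by an element of \<open>N\<close>, so all the united sets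
  coincide and the union is a single coset.\<close>

lemma smult_quot:
  assumes "a \<in> carrier R" "x \<in> carrier M"
  shows "a \<odot>\<^bsub>Q\<^esub> (N +>\<^bsub>M\<^esub> x) = N +>\<^bsub>M\<^esub> (a \<odot>\<^bsub>M\<^esub> x)"
proof -
  have "N +>\<^bsub>M\<^esub> (a \<odot>\<^bsub>M\<^esub> y) = N +>\<^bsub>M\<^esub> (a \<odot>\<^bsub>M\<^esub> x)" if y: "y \<in> N +>\<^bsub>M\<^esub> x" for y
  proof -
    obtain n where n: "n \<in> N" "y = n \<oplus>\<^bsub>M\<^esub> x" using y by (auto simp: a_r_coset_def')
    then have nM: "n \<in> carrier M" using N(1) by auto
    have "a \<odot>\<^bsub>M\<^esub> y = a \<odot>\<^bsub>M\<^esub> n \<oplus>\<^bsub>M\<^esub> a \<odot>\<^bsub>M\<^esub> x"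
      using assms n nM by (simp add: smult_r_distr)
    moreover have "a \<odot>\<^bsub>M\<^esub> n \<in> N" using N(4) assms(1) n(1) by auto
    ultimately have "a \<odot>\<^bsub>M\<^esub> y \<in> N +>\<^bsub>M\<^esub> (a \<odot>\<^bsub>M\<^esub> x)" by (auto simp: a_r_coset_def')
    then show ?thesis
      using M.a_repr_independence[OF _ smult_closed[OF assms] a_subgroup] by auto
  qed
  moreover have "x \<in> N +>\<^bsub>M\<^esub> x" using a_rcos_self assms(2) by simp
  ultimately have "(\<Union>y\<in>N +>\<^bsub>M\<^esub> x. N +>\<^bsub>M\<^esub> (a \<odot>\<^bsub>M\<^esub> y)) = N +>\<^bsub>M\<^esub> (a \<odot>\<^bsub>M\<^esub> x)"
    by (intro SUP_eq_const) blast+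
  then show ?thesis by (simp add: quot_module_def)
qed

lemma quot_left_module: "left_module R Q"
proof -
  have "abelian_group Q"
  proof (rule abelian_groupI, goal_cases)
    case (6 X)
    then obtain x where x: "x \<in> carrier M" "X = N +>\<^bsub>M\<^esub> x" by (auto simp: carrier_quot)
    show ?case
      by (rule bexI[of _ "N +>\<^bsub>M\<^esub> (\<ominus>\<^bsub>M\<^esub> x)"])
        (use x N(1,2) in \<open>simp_all add: add_quot zero_quot M.l_neg coset_mem coset_eq_N_iff\<close>)
  next
    case 2
    then show ?case by (metis N(2) M.zero_closed zero_quot coset_eq_N_iff coset_mem)
  next
    case (5 X)
    then obtain x where x: "x \<in> carrier M" "X = N +>\<^bsub>M\<^esub> x" by (auto simp: carrier_quot)
    have "\<zero>\<^bsub>Q\<^esub> = N +>\<^bsub>M\<^esub> \<zero>\<^bsub>M\<^esub>" using zero_quot N(2) coset_eq_N_iff M.zero_closed by blast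
    then show ?case using x by (simp add: add_quot)
  qed (auto simp: carrier_quot add_quot M.a_ac)
  moreover have "a \<odot>\<^bsub>Q\<^esub> X \<in> carrier Q" if "a \<in> carrier R" "X \<in> carrier Q" for a X
    using that by (auto simp: carrier_quot smult_quot intro!: smult_closed)
  ultimately show ?thesis
    by (intro left_module.intro left_module_axioms.intro R.ring_axioms)
      (auto simp: carrier_quot add_quot smult_quot smult_l_distr smult_r_distr smult_assoc smult_one
         smult_closed)
qed

lemma submodule_vimage:
  assumes "Module.submodule X R Q"
  shows "Module.submodule {x \<in> carrier M. N +>\<^bsub>M\<^esub> x \<in> X} R M"
proof -
  note X = submoduleD[OF assms]
  have "N +>\<^bsub>M\<^esub> \<zero>\<^bsub>M\<^esub> \<in> X" using X(2) coset_eq_N_iff[of "\<zero>\<^bsub>M\<^esub>"] N(2) by (simp add: zero_quot)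
  then show ?thesis
    using X(3,4) by (intro submoduleI)
    (auto simp: add_quot[symmetric] smult_quot[symmetric] intro: smult_closed)
qed

text \<open>Coset formation is onto, so a submodule of the quotient is recovered from its preimage.
  This transfers maximality and, later, the measure of length to the quotient.\<close>

lemma submodule_eq_image:
  assumes "Module.submodule X R Q"
  shows "X = (\<lambda>x. N +>\<^bsub>M\<^esub> x) ` {x \<in> carrier M. N +>\<^bsub>M\<^esub> x \<in> X}"
  using submoduleD(1)[OF assms] by (auto simp: carrier_quot)

lemma simple_quotient:
  assumes "N \<noteq> carrier M"
    and "\<And>X. \<lbrakk>Module.submodule X R M; N \<subseteq> X\<rbrakk> \<Longrightarrow> X = N \<or> X = carrier M"
  shows "simple_module R Q"
  unfolding simple_module_def
proof (intro conjI allI impI)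
  obtain x where "x \<in> carrier M" "x \<notin> N" using assms(1) N(1) by auto
  then show "carrier Q \<noteq> {\<zero>\<^bsub>Q\<^esub>}"
    by (metis coset_eq_N_iff coset_mem singletonD zero_quot)
next
  fix X assume X: "Module.submodule X R Q"
  let ?Y = "{x \<in> carrier M. N +>\<^bsub>M\<^esub> x \<in> X}"
  have "N +>\<^bsub>M\<^esub> x \<in> X" if "x \<in> N" for x
    using that N(1) submoduleD(2)[OF X] by (metis coset_eq_N_iff subsetD zero_quot)
  then have "N \<subseteq> ?Y" using N(1) by auto
  then consider "?Y = N" | "?Y = carrier M" using assms(2)[OF submodule_vimage[OF X]] by blast
  then show "X = {\<zero>\<^bsub>Q\<^esub>} \<or> X = carrier Q"
  proof cases
    case 1
    have "X = (\<lambda>x. N +>\<^bsub>M\<^esub> x) ` N" using submodule_eq_image[OF X] 1 by simp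
    also have "\<dots> = {N}" using N(1,2) coset_eq_N_iff by blast
    finally show ?thesis by (simp add: zero_quot)
  next
    case 2
    then show ?thesis using submodule_eq_image[OF X] by (simp add: carrier_quot)
  qed
qed

text \<open>The isomorphism sends an element to its fibre.\<close>

lemma first_isomorphism:
  assumes F: "left_module R F" and h: "h \<in> module_hom R M F" and surj: "h ` carrier M = carrier F"
    and ker: "\<And>x. x \<in> carrier M \<Longrightarrow> h x = \<zero>\<^bsub>F\<^esub> \<longleftrightarrow> x \<in> N"
  shows "module_isomorphic R F Q"
proof -
  interpret F: left_module R F by fact
  have hc: "h x \<in> carrier F" if "x \<in> carrier M" for x using that surj by auto
  have ha: "h (x \<oplus>\<^bsub>M\<^esub> y) = h x \<oplus>\<^bsub>F\<^esub> h y" if "x \<in> carrier M" "y \<in> carrier M" for x y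
    using module_hom_add[OF h that] .
  have hs: "h (a \<odot>\<^bsub>M\<^esub> x) = a \<odot>\<^bsub>F\<^esub> h x" if "a \<in> carrier R" "x \<in> carrier M" for a x
    using module_hom_smult[OF h that] .
  have hm: "h (x \<ominus>\<^bsub>M\<^esub> y) = h x \<ominus>\<^bsub>F\<^esub> h y" if "x \<in> carrier M" "y \<in> carrier M" for x y
    using that by
    (simp add: M.minus_eq F.minus_eq ha minus_eq_smult F.minus_eq_smult hs hc smult_closed)
  have eq: "h x = h y \<longleftrightarrow> N +>\<^bsub>M\<^esub> x = N +>\<^bsub>M\<^esub> y" if "x \<in> carrier M" "y \<in> carrier M" for x y
    using that ker[of "x \<ominus>\<^bsub>M\<^esub> y"] by (simp add: hm coset_eq_iff hc)
  define g where "g = (\<lambda>y. {x \<in> carrier M. h x = y})"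
  have fib: "g (h x) = N +>\<^bsub>M\<^esub> x" if x: "x \<in> carrier M" for x
  proof -
    have c1: "y \<in> N +>\<^bsub>M\<^esub> x" if "y \<in> carrier M" "N +>\<^bsub>M\<^esub> y = N +>\<^bsub>M\<^esub> x" for y
      using a_rcos_self[OF that(1)] that(2) by simp
    have c2: "y \<in> carrier M \<and> N +>\<^bsub>M\<^esub> y = N +>\<^bsub>M\<^esub> x" if "y \<in> N +>\<^bsub>M\<^esub> x" for y
      using that x a_elemrcos_carrier M.a_repr_independence[OF that x a_subgroup] by blast
    have "g (h x) = {y \<in> carrier M. N +>\<^bsub>M\<^esub> y = N +>\<^bsub>M\<^esub> x}"
      unfolding g_def by (rule Collect_cong) (use eq[OF _ x] in blast)
    also have "\<dots> = N +>\<^bsub>M\<^esub> x"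
      by (intro equalityI subsetI CollectI) (use c1 in blast, use c2 in blast)
    finally show ?thesis .
  qed
  have "g \<in> module_hom R F Q"
    unfolding module_hom_def surj[symmetric]
    by (auto simp: fib coset_mem ha[symmetric] hs[symmetric] add_quot smult_quot smult_closed)
  moreover have "bij_betw g (carrier F) (carrier Q)"
    unfolding bij_betw_def inj_on_def carrier_quot surj[symmetric] image_image
    using fib eq by auto
  ultimately show ?thesis unfolding module_isomorphic_def by blast
qed

end

lemma module_quotientI:
  "left_module R M \<Longrightarrow> Module.submodule N R M \<Longrightarrow> module_quotient R M N"
  by (simp add: module_quotient.intro module_quotient_axioms.intro)

subsection \<open>Composition series\<close>

text \<open>Any strictly increasing natural number on submodules yields finite length: its values on
  the proper submodules of \<open>X\<close> are bounded by \<open>\<mu> X\<close>, and a proper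
  submodule with the largest value is maximal in \<open>X\<close>. Recursion continues below that
  one.\<close>

lemma ex_composition_series:
  fixes M :: "('a, 'b) module" and \<mu> :: "'b set \<Rightarrow> nat"
  assumes M: "left_module R M"
    and mono: "\<And>X Y. \<lbrakk>Module.submodule X R M; Module.submodule Y R M; X \<subset> Y\<rbrakk> \<Longrightarrow> \<mu> X < \<mu> Y"
  shows "\<exists>Ns. composition_series R M Ns"
proof -
  interpret left_module R M by fact
  let ?step = "\<lambda>X Y. X \<subseteq> Y \<and> simple_module R (quot_module (M\<lparr>carrier := Y\<rparr>) X)"
  have "\<exists>Ns. Ns \<noteq> [] \<and> hd Ns = {\<zero>\<^bsub>M\<^esub>} \<and> last Ns = X \<and> (\<forall>N\<in>set Ns. Module.submodule N R M) \<and>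
      (\<forall>i. Suc i < length Ns \<longrightarrow> ?step (Ns ! i) (Ns ! Suc i))"
    if "Module.submodule X R M" for X
    using that
  proof (induction "\<mu> X" arbitrary: X rule: less_induct)
    case less
    show ?case
    proof (cases "X = {\<zero>\<^bsub>M\<^esub>}")
      case True
      then show ?thesis using less.prems by (intro exI[of _ "[X]"]) auto
    next
      case False
      let ?A = "{\<mu> Y | Y. Module.submodule Y R M \<and> Y \<subset> X}"
      have fin: "finite ?A" using mono[OF _ less.prems]
        by (intro finite_subset[of ?A "{..<\<mu> X}"]) auto
      have "\<mu> {\<zero>\<^bsub>M\<^esub>} \<in> ?A" using zero_submodule False submoduleD(2)[OF less.prems] by blast
      then have "Max ?A \<in> ?A" using fin Max_in by blast
      then obtain Y where Y: "Module.submodule Y R M" "Y \<subset> X" "\<mu> Y = Max ?A"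
        unfolding mem_Collect_eq by metis
      have max: "Z = Y \<or> Z = X" if "Module.submodule Z R M" "Y \<subseteq> Z" "Z \<subseteq> X" for Z
      proof (rule ccontr)
        assume "\<not> (Z = Y \<or> Z = X)"
        then have "\<mu> Z \<in> ?A" "\<mu> Y < \<mu> Z" using that Y(1) mono by blast+
        then show False using Max_ge[OF fin] Y(3) by fastforce
      qed
      interpret q: module_quotient R "M\<lparr>carrier := X\<rparr>" Y
        using Y less.prems
        by (intro module_quotientI restrict_left_module submodule_restrict M) auto
      have simple: "simple_module R (quot_module (M\<lparr>carrier := X\<rparr>) Y)"
      proof (rule q.simple_quotient)
        fix Z assume "Module.submodule Z R (M\<lparr>carrier := X\<rparr>)" "Y \<subseteq> Z"
        then show "Z = Y \<or> Z = carrier (M\<lparr>carrier := X\<rparr>)"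
          using max submodule_unrestrict[OF M less.prems] submoduleD(1) by fastforce
      qed (use Y in auto)
      obtain Ns where Ns: "Ns \<noteq> []" "hd Ns = {\<zero>\<^bsub>M\<^esub>}" "last Ns = Y" "\<forall>N\<in>set Ns. Module.submodule N R M"
        "\<forall>i. Suc i < length Ns \<longrightarrow> ?step (Ns ! i) (Ns ! Suc i)"
        using less.hyps[OF mono[OF Y(1) less.prems Y(2)] Y(1)] by blast
      have "?step ((Ns @ [X]) ! i) ((Ns @ [X]) ! Suc i)" if "Suc i < length (Ns @ [X])" for i
      proof (cases "Suc i < length Ns")
        case True
        then show ?thesis using Ns(5) by (simp add: nth_append)
      next
        case False
        then have "i = length Ns - 1" "Suc i = length Ns" using that by auto
        then have "(Ns @ [X]) ! i = Y" "(Ns @ [X]) ! Suc i = X"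
          using Ns(1,3) by (auto simp: nth_append last_conv_nth)
        then show ?thesis using simple Y(2) by simp
      qed
      then show ?thesis using Ns less.prems by (intro exI[of _ "Ns @ [X]"]) auto
    qed
  qed
  then show ?thesis unfolding composition_series_def using carrier_submodule by blast
qed

text \<open>Submodules of the quotient are measured by \<open>\<mu>\<close> of their preimages, and
  distinct submodules have distinct preimages.\<close>

lemma ex_composition_series_quotient:
  fixes M :: "('a, 'b) module" and \<mu> :: "'b set \<Rightarrow> nat"
  assumes "left_module R M" "Module.submodule N R M"
    and mono: "\<And>X Y. \<lbrakk>Module.submodule X R M; Module.submodule Y R M; X \<subset> Y\<rbrakk> \<Longrightarrow> \<mu> X < \<mu> Y"
  shows "\<exists>Ns. composition_series R (quot_module M N) Ns"
proof -
  interpret module_quotient R M N by (rule module_quotientI[OF assms(1,2)])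
  show ?thesis
  proof (rule ex_composition_series[OF quot_left_module])
    fix X Y assume XY: "Module.submodule X R Q" "Module.submodule Y R Q" "X \<subset> Y"
    let ?p = "\<lambda>X. {x \<in> carrier M. N +>\<^bsub>M\<^esub> x \<in> X}"
    have "?p X \<noteq> ?p Y"
      using submodule_eq_image[OF XY(1)] submodule_eq_image[OF XY(2)] XY(3)
      by (metis (lifting) psubset_eq)
    then have "?p X \<subset> ?p Y" using XY(3) by blast
    then show "\<mu> (?p X) < \<mu> (?p Y)"
      by (rule mono[OF submodule_vimage[OF XY(1)] submodule_vimage[OF XY(2)]])
  qed
qed

text \<open>An element acting by zero on every factor acts nilpotently; being idempotent, it acts by zero.\<close>

lemma idempotent_annihilates:
  fixes M :: "('a, 'b) module"
  assumes M: "left_module R M" and Ns: "composition_series R M Ns"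
    and e: "e \<in> carrier R" "e \<otimes>\<^bsub>R\<^esub> e = e"
    and ann: "\<And>F x. \<lbrakk>F \<in> composition_factors R M; x \<in> carrier F\<rbrakk> \<Longrightarrow> e \<odot>\<^bsub>F\<^esub> x = \<zero>\<^bsub>F\<^esub>"
    and m: "m \<in> carrier M"
  shows "e \<odot>\<^bsub>M\<^esub> m = \<zero>\<^bsub>M\<^esub>"
proof -
  interpret left_module R M by fact
  note cs = Ns[unfolded composition_series_def]
  have "\<forall>m\<in>Ns ! i. e \<odot>\<^bsub>M\<^esub> m = \<zero>\<^bsub>M\<^esub>" if "i < length Ns" for i
    using that
  proof (induction i)
    case 0
    have "Ns ! 0 = {\<zero>\<^bsub>M\<^esub>}" using cs hd_conv_nth by metis
    then show ?case by (simp add: smult_r_null e(1))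
  next
    case (Suc i)
    let ?M' = "M\<lparr>carrier := Ns ! Suc i\<rparr>"
    have sub: "Module.submodule (Ns ! Suc i) R M" "Module.submodule (Ns ! i) R M"
      using cs Suc.prems by auto
    interpret q: module_quotient R ?M' "Ns ! i"
      using sub cs Suc.prems
      by (intro module_quotientI restrict_left_module submodule_restrict M) auto
    have F: "quot_module ?M' (Ns ! i) \<in> composition_factors R M"
      unfolding composition_factors_def using Ns Suc.prems by blast
    show ?case
    proof
      fix m assume m: "m \<in> Ns ! Suc i"
      then have mM: "m \<in> carrier M" using submoduleD(1)[OF sub(1)] by auto
      have "e \<odot>\<^bsub>M\<^esub> m \<in> Ns ! i"
        using ann[OF F q.coset_mem, of m] m e(1) q.smult_quot[OF e(1), of m] q.smult_closed[OF e(1), of m]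
        by (simp add: q.zero_quot q.coset_eq_N_iff)
      then have "e \<odot>\<^bsub>M\<^esub> (e \<odot>\<^bsub>M\<^esub> m) = \<zero>\<^bsub>M\<^esub>" using Suc by auto
      then show "e \<odot>\<^bsub>M\<^esub> m = \<zero>\<^bsub>M\<^esub>" using smult_assoc[OF e(1) e(1) mM] e(2) by simp
    qed
  qed
  then show ?thesis using cs m
    by (metis diff_less last_conv_nth length_greater_0_conv less_numeral_extra(1))
qed

section \<open>Composition factors as modules\<close>

lemma composition_factor_left_module:
  assumes "left_module R M" "F \<in> composition_factors R M"
  shows "left_module R F" "simple_module R F"
proof -
  obtain Ns i where Ns: "composition_series R M Ns" "Suc i < length Ns"
    and F: "F = quot_module (M\<lparr>carrier := Ns ! Suc i\<rparr>) (Ns ! i)"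
    using assms(2) unfolding composition_factors_def by blast
  note cs = Ns(1)[unfolded composition_series_def]
  interpret q: module_quotient R "M\<lparr>carrier := Ns ! Suc i\<rparr>" "Ns ! i"
    using cs Ns(2) by (intro module_quotientI restrict_left_module submodule_restrict assms(1)) auto
  show "left_module R F" "simple_module R F" using q.quot_left_module cs Ns(2) F by auto
qed

text \<open>A counterpart of \<open>idempotent_annihilates\<close> in the opposite direction, for
  any ring element: a factor is a subquotient, so it inherits annihilation.\<close>

lemma composition_factor_annihilated:
  assumes M: "left_module R M" "F \<in> composition_factors R M" and a: "a \<in> carrier R"
    and ann: "\<And>m. m \<in> carrier M \<Longrightarrow> a \<odot>\<^bsub>M\<^esub> m = \<zero>\<^bsub>M\<^esub>" and y: "y \<in> carrier F"
  shows "a \<odot>\<^bsub>F\<^esub> y = \<zero>\<^bsub>F\<^esub>"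
proof -
  obtain Ns i where Ns: "composition_series R M Ns" "Suc i < length Ns"
    and F: "F = quot_module (M\<lparr>carrier := Ns ! Suc i\<rparr>) (Ns ! i)"
    using M(2) unfolding composition_factors_def by blast
  note cs = Ns(1)[unfolded composition_series_def]
  have sub: "Module.submodule (Ns ! Suc i) R M" using cs Ns(2) by auto
  interpret q: module_quotient R "M\<lparr>carrier := Ns ! Suc i\<rparr>" "Ns ! i"
    using cs Ns(2) by (intro module_quotientI restrict_left_module submodule_restrict M(1)) auto
  obtain m where m: "m \<in> Ns ! Suc i" "y = Ns ! i +>\<^bsub>M\<lparr>carrier := Ns ! Suc i\<rparr>\<^esub> m"
    using y F by (auto simp: q.carrier_quot)
  then have "m \<in> carrier M" using submoduleD(1)[OF sub] by auto
  then have "a \<odot>\<^bsub>M\<^esub> m = \<zero>\<^bsub>M\<^esub>" by (rule ann)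
  then show ?thesis using m F a q.smult_quot[OF a, of m] q.N(2) q.M.zero_closed by
    (simp add: q.zero_quot q.coset_eq_N_iff)
qed

section \<open>Complete systems of orthogonal idempotents\<close>

text \<open>The fields copy those of \<open>P_mod\<close>, \<open>undefined\<close> included, so
  that \<open>P_mod K S\<close> is literally an instance (\<open>P_mod_eq\<close>).\<close>

definition left_ideal_module :: "('a, 'm) ring_scheme \<Rightarrow> 'a \<Rightarrow> ('a, 'a) module" where
  "left_ideal_module R u =
     \<lparr>carrier = {a \<otimes>\<^bsub>R\<^esub> u | a. a \<in> carrier R}, mult = undefined, one = undefined,
      zero = \<zero>\<^bsub>R\<^esub>, add = add R, smult = mult R\<rparr>"

lemma left_ideal_module_simps [simp]:
  "carrier (left_ideal_module R u) = {a \<otimes>\<^bsub>R\<^esub> u | a. a \<in> carrier R}"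
  "\<zero>\<^bsub>left_ideal_module R u\<^esub> = \<zero>\<^bsub>R\<^esub>"
  "x \<oplus>\<^bsub>left_ideal_module R u\<^esub> y = x \<oplus>\<^bsub>R\<^esub> y"
  "x \<odot>\<^bsub>left_ideal_module R u\<^esub> y = x \<otimes>\<^bsub>R\<^esub> y"
  by (simp_all add: left_ideal_module_def)

lemma (in ring) left_ideal_module:
  assumes u: "u \<in> carrier R"
  shows "left_module R (left_ideal_module R u)"
proof -
  have add: "\<exists>c. a \<otimes> u \<oplus> b \<otimes> u = c \<otimes> u \<and> c \<in> carrier R" if "a \<in> carrier R" "b \<in> carrier R" for a b
    using that u by (intro exI[of _ "a \<oplus> b"]) (simp add: l_distr)
  have zero: "\<exists>c. \<zero> = c \<otimes> u \<and> c \<in> carrier R" using u by (intro exI[of _ \<zero>]) simp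
  have "abelian_group (left_ideal_module R u)"
  proof (rule abelian_groupI, goal_cases)
    case (6 x)
    then obtain a where a: "a \<in> carrier R" "x = a \<otimes> u" by auto
    show ?case by (rule bexI[of _ "(\<ominus> a) \<otimes> u"])
      (use a u in \<open>auto simp: l_minus[symmetric] l_distr[symmetric] l_neg\<close>)
  qed (use u add zero in \<open>auto simp: a_ac\<close>)
  moreover have "\<exists>c. b \<otimes> (a \<otimes> u) = c \<otimes> u \<and> c \<in> carrier R" if "a \<in> carrier R" "b \<in> carrier R" for a b
    using that u by (intro exI[of _ "b \<otimes> a"]) (simp add: m_assoc)
  ultimately show ?thesis
    using u by (intro left_module.intro left_module_axioms.intro ring_axioms)
      (auto simp: l_distr r_distr m_assoc)
qed

text \<open>In the instance used below, multiplication is composition in reverse, so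
  \<open>e i \<otimes> a \<otimes> e j\<close> is the part of the endomorphism \<open>a\<close> that
  goes from summand \<open>i\<close> to summand \<open>j\<close>.\<close>

locale orthogonal_idempotents = ring R for R (structure) +
  fixes I :: "'i set" and e :: "'i \<Rightarrow> 'a"
  assumes finite_index: "finite I"
    and e_closed: "i \<in> I \<Longrightarrow> e i \<in> carrier R"
    and e_idem: "i \<in> I \<Longrightarrow> e i \<otimes> e i = e i"
    and e_orth: "\<lbrakk>i \<in> I; j \<in> I; i \<noteq> j\<rbrakk> \<Longrightarrow> e i \<otimes> e j = \<zero>"
    and e_sum: "finsum R e I = \<one>"
begin

text \<open>The unit, written as the sum of the idempotents, is inserted between the two
  factors.\<close>

lemma mult_eq_zeroI:
  assumes "x \<in> carrier R" "y \<in> carrier R" "\<And>i. i \<in> I \<Longrightarrow> x \<otimes> e i \<otimes> y = \<zero>"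
  shows "x \<otimes> y = \<zero>"
proof -
  have "x \<otimes> y = x \<otimes> finsum R e I \<otimes> y" using assms e_sum by simp
  also have "\<dots> = (\<Oplus>i\<in>I. x \<otimes> e i) \<otimes> y"
    using assms e_closed by (subst finsum_rdistr[OF finite_index]) auto
  also have "\<dots> = (\<Oplus>i\<in>I. x \<otimes> e i \<otimes> y)"
    using assms e_closed by (subst finsum_ldistr[OF finite_index]) auto
  also have "\<dots> = \<zero>"
    using assms(3) by (simp add: add.finprod_one_eqI)
  finally show ?thesis .
qed

lemma mem_submoduleI:
  assumes "left_module R M" "Module.submodule N R M" "m \<in> carrier M"
    and "\<And>i. i \<in> I \<Longrightarrow> e i \<odot>\<^bsub>M\<^esub> m \<in> N"
  shows "m \<in> N"
proof -
  interpret M: left_module R M by fact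
  have "m = finsum R e I \<odot>\<^bsub>M\<^esub> m" using assms(3) by (simp add: e_sum M.smult_one)
  also have "\<dots> = finsum M (\<lambda>i. e i \<odot>\<^bsub>M\<^esub> m) I"
    using e_closed assms(3) by (intro M.finsum_smult finite_index) auto
  also have "\<dots> \<in> N" by (rule M.submodule_finsum[OF assms(2) finite_index assms(4)])
  finally show ?thesis .
qed

abbreviation "P i \<equiv> left_ideal_module R (e i)"

text \<open>The candidate for the radical of \<open>P i\<close>, confirmed in
  \<open>module_rad_P\<close>.\<close>

definition "J i = {f \<in> carrier (P i). e i \<otimes> f = \<zero>}"

lemma P_left_module: "i \<in> I \<Longrightarrow> left_module R (P i)"
  by (rule left_ideal_module[OF e_closed])

lemma mem_P_iff: "i \<in> I \<Longrightarrow> f \<in> carrier (P i) \<longleftrightarrow> f \<in> carrier R \<and> f \<otimes> e i = f"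
  using e_closed e_idem by (auto simp: m_assoc) metis

lemma e_mem_P: "i \<in> I \<Longrightarrow> e i \<in> carrier (P i)"
  using mem_P_iff e_closed e_idem by blast

lemma P_mem_closed: "i \<in> I \<Longrightarrow> f \<in> carrier (P i) \<Longrightarrow> f \<in> carrier R"
  using mem_P_iff by blast

lemma e_mult_e_mult_orth: "\<lbrakk>i \<in> I; j \<in> I; i \<noteq> j; f \<in> carrier R\<rbrakk> \<Longrightarrow> e i \<otimes> (e j \<otimes> f) = \<zero>"
  by (simp add: m_assoc[symmetric] e_closed e_orth)

text \<open>To see \<open>e i \<otimes> (a \<otimes> x) = \<zero>\<close>, split at the middle
  idempotents \<open>e j\<close>. For \<open>j\<close> in \<open>E\<close> the factor
  \<open>e j \<otimes> x\<close> is zero; for the other \<open>j\<close> the hypothesis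
  \<open>zero\<close> applies, since \<open>x = x \<otimes> e s\<close>. The case
  \<open>E = {s}\<close> gives the radical, a larger \<open>E\<close> the kernel of the standard
  module.\<close>

lemma vanishing_submodule:
  assumes s: "s \<in> I" and E: "E \<subseteq> I"
    and zero: "\<And>i j a b. \<lbrakk>i \<in> E; j \<in> I - E; a \<in> carrier R; b \<in> carrier R\<rbrakk> \<Longrightarrow>
      e i \<otimes> a \<otimes> e j \<otimes> b \<otimes> e s = \<zero>"
  shows "Module.submodule {f \<in> carrier (P s). \<forall>i\<in>E. e i \<otimes> f = \<zero>} R (P s)"
proof -
  interpret P: left_module R "P s" by (rule P_left_module[OF s])
  have ec: "i \<in> E \<Longrightarrow> e i \<in> carrier R" for i using E e_closed by auto
  show ?thesis
  proof (rule P.submoduleI, goal_cases)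
    case (3 x y)
    then have "x \<in> carrier R" "y \<in> carrier R" using P_mem_closed[OF s] by blast+
    then show ?case using 3 P.M.a_closed[of x y] ec by
      (auto simp: r_distr simp del: left_ideal_module_simps(1))
  next
    case (4 a x)
    then have x: "x \<in> carrier R" "x \<otimes> e s = x" using mem_P_iff[OF s] by blast+
    have "e i \<otimes> (a \<otimes> x) = \<zero>" if i: "i \<in> E" for i
    proof -
      have "e i \<otimes> a \<otimes> x = \<zero>"
      proof (rule mult_eq_zeroI)
        fix j assume j: "j \<in> I"
        show "e i \<otimes> a \<otimes> e j \<otimes> x = \<zero>"
        proof (cases "j \<in> E")
          case True
          then have "e j \<otimes> x = \<zero>" using 4(2) by simp
          then show ?thesis using x(1) 4(1) ec i j e_closed by (simp add: m_assoc)
        next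
          case False
          then have "e i \<otimes> a \<otimes> e j \<otimes> x \<otimes> e s = \<zero>" using zero i j 4(1) x(1) by blast
          then show ?thesis using x 4(1) ec i j s e_closed by (simp add: m_assoc)
        qed
      qed (use ec i 4(1) x(1) in auto)
      then show ?thesis using x(1) 4(1) ec i by (simp add: m_assoc)
    qed
    moreover have "a \<otimes> x \<in> carrier (P s)" using P.smult_closed[of a x] 4 by simp
    ultimately show ?case by simp
  qed (use P.M.zero_closed ec in \<open>auto simp del: left_ideal_module_simps(1)\<close>)
qed

end

text \<open>\<open>e_nonzero\<close> and \<open>e_local\<close> make each corner
  \<open>e i \<otimes> R \<otimes> e i\<close> a division ring. \<open>e_factor\<close> forbids
  nonzero loops through another index, which is exactly what closes \<open>J i\<close> under
  multiplication by the ring.\<close>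

locale basic_idempotents = orthogonal_idempotents +
  assumes e_nonzero: "i \<in> I \<Longrightarrow> e i \<noteq> \<zero>"
    and e_local: "\<lbrakk>i \<in> I; a \<in> carrier R; e i \<otimes> a \<otimes> e i \<noteq> \<zero>\<rbrakk> \<Longrightarrow>
      \<exists>b\<in>carrier R. b \<otimes> (e i \<otimes> a \<otimes> e i) = e i"
    and e_factor: "\<lbrakk>i \<in> I; j \<in> I; i \<noteq> j; a \<in> carrier R; b \<in> carrier R\<rbrakk> \<Longrightarrow>
      e i \<otimes> a \<otimes> e j \<otimes> b \<otimes> e i = \<zero>"
begin

abbreviation "L i \<equiv> quot_module (P i) (module_rad R (P i))"

lemma J_submodule:
  assumes "i \<in> I" shows "Module.submodule (J i) R (P i)"
  using vanishing_submodule[OF assms, of "{i}"] e_factor[OF assms] assms by (auto simp: J_def)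

text \<open>If some \<open>f\<close> in \<open>X\<close> has
  \<open>e i \<otimes> f \<noteq> \<zero>\<close>, this element lies in the corner because
  \<open>f = f \<otimes> e i\<close>. Its left inverse there brings the generator \<open>e i\<close>
  into \<open>X\<close>.\<close>

lemma submodule_le_J:
  assumes i: "i \<in> I" and X: "Module.submodule X R (P i)" and "X \<noteq> carrier (P i)"
  shows "X \<subseteq> J i"
proof (rule ccontr)
  assume "\<not> X \<subseteq> J i"
  then obtain f where f: "f \<in> X" "e i \<otimes> f \<noteq> \<zero>"
    using submoduleD(1)[OF X] by (auto simp: J_def simp del: left_ideal_module_simps(1))
  then have fR: "f \<in> carrier R" "f \<otimes> e i = f"
    using submoduleD(1)[OF X] mem_P_iff[OF i] by blast+
  have eq: "e i \<otimes> f \<otimes> e i = e i \<otimes> f" using fR i e_closed by (simp add: m_assoc)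
  then obtain b where b: "b \<in> carrier R" "b \<otimes> (e i \<otimes> f) = e i" using e_local[OF i fR(1)] f(2) by auto
  then have "e i = (b \<otimes> e i) \<odot>\<^bsub>P i\<^esub> f" using i e_closed fR by (simp add: m_assoc)
  also have "\<dots> \<in> X" using submoduleD(4)[OF X _ f(1)] b(1) i e_closed by blast
  finally have "e i \<in> X" .
  then have "a \<otimes> e i \<in> X" if "a \<in> carrier R" for a using submoduleD(4)[OF X that] by simp
  then have "carrier (P i) \<subseteq> X" by auto
  then show False using submoduleD(1)[OF X] assms(3) by auto
qed

lemma J_proper: "i \<in> I \<Longrightarrow> J i \<noteq> carrier (P i)"
  using e_mem_P[of i] e_idem[of i] e_nonzero[of i] unfolding J_def by force

text \<open>By \<open>submodule_le_J\<close> every proper submodule lies in \<open>J i\<close>, so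
  the intersection defining the radical is over one maximal submodule.\<close>

lemma module_rad_P:
  assumes i: "i \<in> I"
  shows "module_rad R (P i) = J i"
proof -
  have "{X. maximal_submodule R (P i) X} = {J i}"
    unfolding maximal_submodule_def
    using submodule_le_J[OF i] J_submodule[OF i] J_proper[OF i] submoduleD(1)[OF J_submodule[OF i]]
    by blast
  then show ?thesis unfolding module_rad_def using submoduleD(1)[OF J_submodule[OF i]] by auto
qed

lemma simple_isomorphic_L:
  assumes F: "left_module R F" "simple_module R F" and i: "i \<in> I"
    and y: "y \<in> carrier F" "e i \<odot>\<^bsub>F\<^esub> y \<noteq> \<zero>\<^bsub>F\<^esub>"
  shows "module_isomorphic R F (L i)"
proof -
  interpret F: left_module R F by fact
  interpret q: module_quotient R "P i" "J i"
    by (rule module_quotientI[OF P_left_module[OF i] J_submodule[OF i]])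
  let ?h = "\<lambda>p. p \<odot>\<^bsub>F\<^esub> y"
  have hom: "?h \<in> module_hom R (P i) F"
    unfolding module_hom_def using P_mem_closed[OF i] y(1)
    by (auto simp: F.smult_assoc F.smult_l_distr intro!: F.smult_closed simp del: left_ideal_module_simps(1))
  have image: "Module.submodule (?h ` X) R F" if X: "Module.submodule X R (P i)" for X
  proof -
    note X' = submoduleD[OF X]
    have c: "x \<in> carrier R" if "x \<in> X" for x using that X'(1) P_mem_closed[OF i] by blast
    show ?thesis
    proof (rule F.submoduleI, goal_cases)
      case 2
      then show ?case using X'(2) F.smult_l_null[OF y(1)] by force
    next
      case (3 u v)
      then obtain p q where "p \<in> X" "q \<in> X" "u = ?h p" "v = ?h q" by blast
      then show ?case using X'(3)[of p q] c y(1) by (intro image_eqI[of _ _ "p \<oplus> q"])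
        (auto simp: F.smult_l_distr)
    next
      case (4 a u)
      then obtain p where "p \<in> X" "u = ?h p" by blast
      then show ?case using X'(4)[of a p] c y(1) 4(1) by (intro image_eqI[of _ _ "a \<otimes> p"])
        (auto simp: F.smult_assoc)
    qed (use c y(1) in \<open>auto intro: F.smult_closed\<close>)
  qed
  have sub: "Module.submodule {p \<in> carrier (P i). ?h p = \<zero>\<^bsub>F\<^esub>} R (P i)"
  proof (rule q.submoduleI, goal_cases)
    case (3 u v)
    then have "u \<in> carrier R" "v \<in> carrier R" using P_mem_closed[OF i] by blast+
    then show ?case using 3 q.M.a_closed[of u v] y(1)
      by (simp add: F.smult_l_distr del: left_ideal_module_simps(1))
  next
    case (4 a u)
    then have "u \<in> carrier R" using P_mem_closed[OF i] by blast+
    then show ?case using 4 q.smult_closed[of a u] y(1)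
      by (simp add: F.smult_assoc F.smult_r_null del: left_ideal_module_simps(1))
  qed (use q.M.zero_closed F.smult_l_null[OF y(1)] in \<open>auto simp del: left_ideal_module_simps(1)\<close>)
  have surj: "?h ` carrier (P i) = carrier F"
    using image[OF q.carrier_submodule] F(2) y(2) e_mem_P[OF i] unfolding simple_module_def by blast
  have "?h ` J i \<noteq> carrier F"
  proof
    assume "?h ` J i = carrier F"
    then obtain p where p: "p \<in> J i" "e i \<odot>\<^bsub>F\<^esub> y = ?h p"
      using F.smult_closed[OF e_closed[OF i] y(1)] by (metis (no_types, lifting) imageE)
    then have pR: "p \<in> carrier R" "e i \<otimes> p = \<zero>" unfolding J_def using P_mem_closed[OF i] by blast+
    have "e i \<odot>\<^bsub>F\<^esub> y = e i \<odot>\<^bsub>F\<^esub> (e i \<odot>\<^bsub>F\<^esub> y)"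
      by (metis F.smult_assoc e_closed e_idem i y(1))
    also have "\<dots> = (e i \<otimes> p) \<odot>\<^bsub>F\<^esub> y" using p(2) F.smult_assoc[OF e_closed[OF i] pR(1) y(1)] by simp
    also have "\<dots> = \<zero>\<^bsub>F\<^esub>" using pR(2) F.smult_l_null y(1) by simp
    finally show False using y(2) by simp
  qed
  then have "?h ` J i = {\<zero>\<^bsub>F\<^esub>}" using image[OF J_submodule[OF i]] F(2) unfolding simple_module_def
    by blast
  moreover have "{p \<in> carrier (P i). ?h p = \<zero>\<^bsub>F\<^esub>} \<subseteq> J i"
    using submodule_le_J[OF i sub] e_mem_P[OF i] y(2) by blast
  ultimately have ker: "?h p = \<zero>\<^bsub>F\<^esub> \<longleftrightarrow> p \<in> J i" if "p \<in> carrier (P i)" for p using that by blast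
  show ?thesis unfolding module_rad_P[OF i] by (rule q.first_isomorphism[OF F(1) hom surj ker])
qed

text \<open>Since \<open>e i \<otimes> e j = \<zero>\<close>, all of
  \<open>e j \<otimes> P i\<close> lies in \<open>J i\<close>. With
  \<open>simple_isomorphic_L\<close> this lets the idempotents tell the simple modules
  apart.\<close>

lemma e_L:
  assumes i: "i \<in> I" and j: "j \<in> I" "i \<noteq> j" and x: "x \<in> carrier (L i)"
  shows "e j \<odot>\<^bsub>L i\<^esub> x = \<zero>\<^bsub>L i\<^esub>"
proof -
  interpret q: module_quotient R "P i" "J i"
    by (rule module_quotientI[OF P_left_module[OF i] J_submodule[OF i]])
  obtain p where p: "p \<in> carrier (P i)" "x = J i +>\<^bsub>P i\<^esub> p"
    using x by (auto simp: module_rad_P[OF i] q.carrier_quot simp del: left_ideal_module_simps(1))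
  have ep: "e j \<odot>\<^bsub>P i\<^esub> p \<in> carrier (P i)" by (rule q.smult_closed[OF e_closed[OF j(1)] p(1)])
  have "e i \<otimes> (e j \<odot>\<^bsub>P i\<^esub> p) = \<zero>"
    unfolding left_ideal_module_simps by (rule e_mult_e_mult_orth[OF i j P_mem_closed[OF i p(1)]])
  then have "e j \<odot>\<^bsub>P i\<^esub> p \<in> J i" unfolding J_def using ep by blast
  then show ?thesis
    unfolding module_rad_P[OF i] p(2) q.smult_quot[OF e_closed[OF j(1)] p(1)] q.zero_quot
      q.coset_eq_N_iff[OF ep] .
qed

lemma e_isomorphic_L:
  assumes F: "left_module R F" "module_isomorphic R F (L i)" and i: "i \<in> I" and j: "j \<in> I" "i \<noteq> j"
    and y: "y \<in> carrier F"
  shows "e j \<odot>\<^bsub>F\<^esub> y = \<zero>\<^bsub>F\<^esub>"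
proof -
  interpret F: left_module R F by fact
  interpret q: module_quotient R "P i" "J i"
    by (rule module_quotientI[OF P_left_module[OF i] J_submodule[OF i]])
  interpret L: left_module R "L i" using q.quot_left_module by (simp add: module_rad_P[OF i])
  obtain h where h: "h \<in> module_hom R F (L i)" "bij_betw h (carrier F) (carrier (L i))"
    using F(2) unfolding module_isomorphic_def by blast
  have hy: "h y \<in> carrier (L i)" using h(2) y by (rule bij_betw_apply)
  have "h (e j \<odot>\<^bsub>F\<^esub> y) = e j \<odot>\<^bsub>L i\<^esub> h y" using module_hom_smult[OF h(1) e_closed[OF j(1)] y] .
  also have "\<dots> = \<zero>\<^bsub>L i\<^esub>" by (rule e_L[OF i j hy])
  also have "\<dots> = h (\<zero> \<odot>\<^bsub>F\<^esub> y)" using module_hom_smult[OF h(1) zero_closed y] L.smult_l_null[OF hy]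
    by simp
  finally show ?thesis
    using bij_betw_imp_inj_on[OF h(2)] F.smult_closed y j(1) e_closed F.smult_l_null[OF y]
    by (metis zero_closed inj_onD)
qed

text \<open>
  The assumption \<open>gen\<close> says that the kernel is contained in the submodule generated by the
  \<open>e i \<otimes> P s\<close> with \<open>i \<notin> B\<close>, that is, in the trace of the projectives \<open>P i\<close> with \<open>i \<notin> B\<close>.
\<close>

lemma standard_kernel:
  assumes s: "s \<in> I" and E: "E \<subseteq> B" "B \<subseteq> I"
    and zero: "\<And>i j a b. \<lbrakk>i \<in> E; j \<in> I - E; a \<in> carrier R; b \<in> carrier R\<rbrakk> \<Longrightarrow>
      e i \<otimes> a \<otimes> e j \<otimes> b \<otimes> e s = \<zero>"
    and gen: "\<And>X f. \<lbrakk>Module.submodule X R (P s); \<And>i f. \<lbrakk>i \<in> I - B; f \<in> carrier (P s)\<rbrakk> \<Longrightarrow> e i \<otimes> f \<in> X;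
        f \<in> carrier (P s); \<And>i. i \<in> E \<Longrightarrow> e i \<otimes> f = \<zero>\<rbrakk> \<Longrightarrow> f \<in> X"
    and series: "\<And>X. Module.submodule X R (P s) \<Longrightarrow> \<exists>Ns. composition_series R (quot_module (P s) X) Ns"
  defines "below \<equiv> \<lambda>M :: ('a, 'a set) module.
    \<forall>F\<in>composition_factors R M. \<exists>i\<in>B. module_isomorphic R F (L i)"
  shows "(THE N. Module.submodule N R (P s) \<and> below (quot_module (P s) N) \<and>
             (\<forall>N'. Module.submodule N' R (P s) \<and> below (quot_module (P s) N') \<longrightarrow> N \<subseteq> N'))
         = {f \<in> carrier (P s). \<forall>i\<in>E. e i \<otimes> f = \<zero>}" (is "_ = ?N")
proof -
  have N: "Module.submodule ?N R (P s)" by (rule vanishing_submodule) (use s E zero in auto)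
  interpret q: module_quotient R "P s" ?N by (rule module_quotientI[OF P_left_module[OF s] N])
  have "below (quot_module (P s) ?N)"
    unfolding below_def
  proof
    fix F assume F: "F \<in> composition_factors R (quot_module (P s) ?N)"
    have Fm: "left_module R F" "simple_module R F"
      using composition_factor_left_module[OF q.quot_left_module F] by blast+
    interpret F: left_module R F by (rule Fm(1))
    obtain y where y: "y \<in> carrier F" "y \<noteq> \<zero>\<^bsub>F\<^esub>"
      using Fm(2) F.M.zero_closed unfolding simple_module_def by blast
    then obtain i where i: "i \<in> I" "e i \<odot>\<^bsub>F\<^esub> y \<noteq> \<zero>\<^bsub>F\<^esub>"
      using mem_submoduleI[OF Fm(1) F.zero_submodule y(1)] by blast
    \<comment> \<open>For \<open>i\<close> outside \<open>E\<close>, orthogonality puts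
      \<open>e i \<otimes> p\<close> into \<open>?N\<close> for every \<open>p\<close>, so
      \<open>e i\<close> kills the quotient and with it the factor \<open>F\<close>, contrary to the
      choice of \<open>i\<close>.\<close>
    have "i \<in> E"
    proof (rule ccontr)
      assume iE: "i \<notin> E"
      have "e i \<odot>\<^bsub>q.Q\<^esub> m = \<zero>\<^bsub>q.Q\<^esub>" if m: "m \<in> carrier q.Q" for m
      proof -
        obtain p where p: "p \<in> carrier (P s)" "m = ?N +>\<^bsub>P s\<^esub> p" using m unfolding q.carrier_quot
          by blast
        have ep: "e i \<odot>\<^bsub>P s\<^esub> p \<in> carrier (P s)" by (rule q.smult_closed[OF e_closed[OF i(1)] p(1)])
        have "e j \<otimes> (e i \<otimes> p) = \<zero>" if "j \<in> E" for j
          using that iE E i(1) P_mem_closed[OF s p(1)] by (intro e_mult_e_mult_orth) auto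
        then have "e i \<odot>\<^bsub>P s\<^esub> p \<in> ?N" using ep by simp
        then show ?thesis using q.smult_quot[OF e_closed[OF i(1)] p(1)] p(2) q.coset_eq_N_iff[OF ep] q.zero_quot by metis
      qed
      then show False using composition_factor_annihilated[OF q.quot_left_module F e_closed[OF i(1)] _ y(1)] i(2) by blast
    qed
    then show "\<exists>i\<in>B. module_isomorphic R F (L i)"
      using simple_isomorphic_L[OF Fm i(1) y(1) i(2)] E by blast
  qed
  \<comment> \<open>Minimality. Each factor of the quotient by \<open>X\<close> is some
    \<open>L j\<close> with \<open>j\<close> in \<open>B\<close>, so an \<open>e i\<close> with
    \<open>i\<close> outside \<open>B\<close> kills all factors. As a series exists, it kills the
    quotient, which means that \<open>e i \<otimes> f\<close> is in \<open>X\<close>; then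
    \<open>gen\<close> applies.\<close>
  moreover have "?N \<subseteq> X" if X: "Module.submodule X R (P s)" "below (quot_module (P s) X)" for X
  proof -
    interpret x: module_quotient R "P s" X by (rule module_quotientI[OF P_left_module[OF s] X(1)])
    obtain Ns where Ns: "composition_series R x.Q Ns" using series[OF X(1)] by blast
    have "e i \<otimes> f \<in> X" if i: "i \<in> I - B" and f: "f \<in> carrier (P s)" for i f
    proof -
      have ei: "e i \<in> carrier R" "e i \<otimes> e i = e i" using i e_closed e_idem by auto
      have "e i \<odot>\<^bsub>x.Q\<^esub> (X +>\<^bsub>P s\<^esub> f) = \<zero>\<^bsub>x.Q\<^esub>"
      proof (rule idempotent_annihilates[OF x.quot_left_module Ns ei _ x.coset_mem[OF f]])
        fix F y assume F: "F \<in> composition_factors R x.Q" "y \<in> carrier F"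
        then obtain j where "j \<in> B" "module_isomorphic R F (L j)" using X(2) unfolding below_def
          by blast
        then show "e i \<odot>\<^bsub>F\<^esub> y = \<zero>\<^bsub>F\<^esub>"
          using e_isomorphic_L[OF composition_factor_left_module(1)[OF x.quot_left_module F(1)] _ _ _ _ F(2)] i E by blast
      qed
      then show ?thesis
        using x.smult_quot[OF ei(1) f] x.coset_eq_N_iff[OF q.smult_closed[OF ei(1) f]] x.zero_quot
        by simp
    qed
    then show ?thesis using gen[OF X(1)] by blast
  qed
  ultimately show ?thesis using N by (intro the_equality) blast+
qed

end

section \<open>Finite length from coordinates\<close>

text \<open>
  The set of leading positions of the elements of a subspace determines the subspace among those
  that contain it; its cardinality replaces the dimension.
\<close>

lemma leading_index_strict_mono:
  fixes K :: "('k, 'l) ring_scheme" and c :: "nat \<Rightarrow> 'b \<Rightarrow> 'k"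
  assumes M: "left_module R M" and K: "field K"
    and c_closed: "\<And>i x. x \<in> carrier M \<Longrightarrow> c i x \<in> carrier K"
    and c_add: "\<And>i x y. \<lbrakk>x \<in> carrier M; y \<in> carrier M\<rbrakk> \<Longrightarrow> c i (x \<oplus>\<^bsub>M\<^esub> y) = c i x \<oplus>\<^bsub>K\<^esub> c i y"
    and s_closed: "\<And>k. k \<in> carrier K \<Longrightarrow> s k \<in> carrier R"
    and c_smult: "\<And>i k x. \<lbrakk>k \<in> carrier K; x \<in> carrier M\<rbrakk> \<Longrightarrow> c i (s k \<odot>\<^bsub>M\<^esub> x) = k \<otimes>\<^bsub>K\<^esub> c i x"
    and inj: "\<And>x. \<lbrakk>x \<in> carrier M; \<And>i. i < n \<Longrightarrow> c i x = \<zero>\<^bsub>K\<^esub>\<rbrakk> \<Longrightarrow> x = \<zero>\<^bsub>M\<^esub>"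
    and X: "Module.submodule X R M" and Y: "Module.submodule Y R M" and XY: "X \<subset> Y"
  defines "lead \<equiv> \<lambda>X. {i. i < n \<and> (\<exists>x\<in>X. c i x \<noteq> \<zero>\<^bsub>K\<^esub> \<and> (\<forall>j<i. c j x = \<zero>\<^bsub>K\<^esub>))}"
  shows "card (lead X) < card (lead Y)"
proof (rule psubset_card_mono)
  interpret M: left_module R M by fact
  interpret K: field K by fact
  note X' = submoduleD[OF X] and Y' = submoduleD[OF Y]
  show "finite (lead Y)" by (simp add: lead_def)
  have "lead X \<subseteq> lead Y" using XY by (auto simp: lead_def)
  moreover have "lead X \<noteq> lead Y"
  proof
    assume eq: "lead X = lead Y"
    \<comment> \<open>Downward induction from \<open>m = n\<close>, where \<open>inj\<close> leaves
      only zero; \<open>m = 0\<close> yields \<open>Y \<subseteq> X\<close>, contradicting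
      strictness.\<close>
    have "\<forall>y\<in>Y. (\<forall>j<m. c j y = \<zero>\<^bsub>K\<^esub>) \<longrightarrow> y \<in> X" if "m \<le> n" for m
      using that
    proof (induction rule: inc_induct)
      case base
      then show ?case using inj Y'(1) X'(2) by blast
    next
      case (step m)
      show ?case
      proof (intro ballI impI)
        fix y assume y: "y \<in> Y" "\<forall>j<m. c j y = \<zero>\<^bsub>K\<^esub>"
        have yM: "y \<in> carrier M" using y Y'(1) by blast
        show "y \<in> X"
        proof (cases "c m y = \<zero>\<^bsub>K\<^esub>")
          case True
          then show ?thesis using step.IH y by (metis less_Suc_eq)
        next
          case False
          then have "m \<in> lead X" using eq y step.hyps by (auto simp: lead_def)
          then obtain x where x: "x \<in> X" "c m x \<noteq> \<zero>\<^bsub>K\<^esub>" "\<forall>j<m. c j x = \<zero>\<^bsub>K\<^esub>"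
            by (auto simp: lead_def)
          have xM: "x \<in> carrier M" using x X'(1) by blast
          have units: "c m x \<in> Units K" using x(2) c_closed[OF xM] K.field_Units by simp
          \<comment> \<open>Gaussian elimination: \<open>k\<close> is chosen so that adding the
            \<open>k\<close>-multiple of \<open>x\<close> to \<open>y\<close> clears position
            \<open>m\<close> too. Since \<open>x\<close> lies in \<open>X\<close>, so does
            \<open>y\<close> once the sum does.\<close>
          define k where "k = (\<ominus>\<^bsub>K\<^esub> c m y) \<otimes>\<^bsub>K\<^esub> inv\<^bsub>K\<^esub> c m x"
          have k: "k \<in> carrier K" unfolding k_def using c_closed xM yM units by simp
          have kx: "s k \<odot>\<^bsub>M\<^esub> x \<in> carrier M" "s k \<odot>\<^bsub>M\<^esub> x \<in> X"
            using M.smult_closed s_closed k xM X'(4) x(1) by blast+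
          have cm: "k \<otimes>\<^bsub>K\<^esub> c m x = \<ominus>\<^bsub>K\<^esub> c m y"
            unfolding k_def using c_closed xM yM units by (simp add: K.m_assoc)
          let ?z = "y \<oplus>\<^bsub>M\<^esub> s k \<odot>\<^bsub>M\<^esub> x"
          have "c j ?z = \<zero>\<^bsub>K\<^esub>" if "j < Suc m" for j
          proof (cases "j = m")
            case True
            then show ?thesis
              using c_add[OF yM kx(1)] c_smult[OF k xM] cm c_closed[OF yM] by (simp add: K.r_neg)
          next
            case False
            then have "j < m" using that by simp
            then show ?thesis
              using c_add[OF yM kx(1)] c_smult[OF k xM] y(2) x(3) k by simp
          qed
          moreover have "?z \<in> Y" using Y'(3) y(1) kx(2) XY by blast
          ultimately have "?z \<in> X" using step.IH by blast
          then have "?z \<ominus>\<^bsub>M\<^esub> s k \<odot>\<^bsub>M\<^esub> x \<in> X" using M.submodule_minus[OF X] kx(2) by blast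
          moreover have "?z \<ominus>\<^bsub>M\<^esub> s k \<odot>\<^bsub>M\<^esub> x = y"
            using yM kx(1) by (simp add: M.M.minus_eq M.M.add.m_assoc M.M.r_neg)
          ultimately show ?thesis by simp
        qed
      qed
    qed
    from this[of 0] show False using XY by auto
  qed
  ultimately show "lead X \<subset> lead Y" by blast
qed

text \<open>Through \<open>s\<close> the field acts by ring elements, so submodules over the ring
  are stable under the scalars. Any numbering of \<open>J\<close> then makes the count of leading
  positions a strictly increasing measure.\<close>

lemma ex_composition_series_coordinates:
  fixes M :: "('a, 'b) module" and K :: "('k, 'l) ring_scheme" and c :: "'j \<Rightarrow> 'b \<Rightarrow> 'k"
  assumes M: "left_module R M" and N: "Module.submodule N R M" and K: "field K" and J: "finite J"
    and c_closed: "\<And>i x. x \<in> carrier M \<Longrightarrow> c i x \<in> carrier K"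
    and c_add: "\<And>i x y. \<lbrakk>x \<in> carrier M; y \<in> carrier M\<rbrakk> \<Longrightarrow> c i (x \<oplus>\<^bsub>M\<^esub> y) = c i x \<oplus>\<^bsub>K\<^esub> c i y"
    and s_closed: "\<And>k. k \<in> carrier K \<Longrightarrow> s k \<in> carrier R"
    and c_smult: "\<And>i k x. \<lbrakk>k \<in> carrier K; x \<in> carrier M\<rbrakk> \<Longrightarrow> c i (s k \<odot>\<^bsub>M\<^esub> x) = k \<otimes>\<^bsub>K\<^esub> c i x"
    and inj: "\<And>x. \<lbrakk>x \<in> carrier M; \<And>i. i \<in> J \<Longrightarrow> c i x = \<zero>\<^bsub>K\<^esub>\<rbrakk> \<Longrightarrow> x = \<zero>\<^bsub>M\<^esub>"
  shows "\<exists>Ns. composition_series R (quot_module M N) Ns"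
proof -
  obtain h where h: "bij_betw h {0..<card J} J" using ex_bij_betw_nat_finite[OF J] by blast
  have "x = \<zero>\<^bsub>M\<^esub>" if "x \<in> carrier M" "\<And>i. i < card J \<Longrightarrow> c (h i) x = \<zero>\<^bsub>K\<^esub>" for x
  proof (rule inj[OF that(1)])
    fix j assume "j \<in> J"
    then obtain i where "i < card J" "j = h i" using bij_betw_imp_surj_on[OF h] by fastforce
    then show "c j x = \<zero>\<^bsub>K\<^esub>" using that(2) by simp
  qed
  note mono = leading_index_strict_mono[where c = "\<lambda>i. c (h i)" and n = "card J" and s = s, OF M K
      c_closed c_add s_closed c_smult this]
  show ?thesis by (rule ex_composition_series_quotient[OF M N mono])
qed

section \<open>Endomorphism rings of poset representations\<close>

lemma rep_homI:
  assumes "\<And>x. f x \<in> extensional (carrier (space V x))"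
    "\<And>x v. v \<in> carrier (space V x) \<Longrightarrow> f x v \<in> carrier (space W x)"
    "\<And>x v w. \<lbrakk>v \<in> carrier (space V x); w \<in> carrier (space V x)\<rbrakk> \<Longrightarrow>
      f x (v \<oplus>\<^bsub>space V x\<^esub> w) = f x v \<oplus>\<^bsub>space W x\<^esub> f x w"
    "\<And>x k v. \<lbrakk>k \<in> carrier K; v \<in> carrier (space V x)\<rbrakk> \<Longrightarrow>
      f x (k \<odot>\<^bsub>space V x\<^esub> v) = k \<odot>\<^bsub>space W x\<^esub> f x v"
    "\<And>x y v. \<lbrakk>x \<le> y; v \<in> carrier (space V x)\<rbrakk> \<Longrightarrow> rmap W x y (f x v) = f y (rmap V x y v)"
  shows "f \<in> rep_hom K V W"
  using assms by (auto simp: rep_hom_def module_hom_def)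

lemma rep_homD:
  assumes "f \<in> rep_hom K V W"
  shows "f x \<in> extensional (carrier (space V x))"
    "v \<in> carrier (space V x) \<Longrightarrow> f x v \<in> carrier (space W x)"
    "\<lbrakk>v \<in> carrier (space V x); w \<in> carrier (space V x)\<rbrakk> \<Longrightarrow>
      f x (v \<oplus>\<^bsub>space V x\<^esub> w) = f x v \<oplus>\<^bsub>space W x\<^esub> f x w"
    "\<lbrakk>k \<in> carrier K; v \<in> carrier (space V x)\<rbrakk> \<Longrightarrow>
      f x (k \<odot>\<^bsub>space V x\<^esub> v) = k \<odot>\<^bsub>space W x\<^esub> f x v"
    "\<lbrakk>x \<le> y; v \<in> carrier (space V x)\<rbrakk> \<Longrightarrow> rmap W x y (f x v) = f y (rmap V x y v)"
  using assms by (auto simp: rep_hom_def module_hom_def)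

lemma rep_hom_ext:
  assumes "f \<in> rep_hom K V W" "g \<in> rep_hom K V W"
    and "\<And>x v. v \<in> carrier (space V x) \<Longrightarrow> f x v = g x v"
  shows "f = g"
proof (intro ext)
  fix x v
  show "f x v = g x v"
    using assms(3)[of v x] extensional_arb[OF rep_homD(1)[OF assms(1)]]
      extensional_arb[OF rep_homD(1)[OF assms(2)]] by (cases "v \<in> carrier (space V x)") simp_all
qed

lemma rep_comp_apply: "v \<in> carrier (space V x) \<Longrightarrow> rep_comp V g f x v = g x (f x v)"
  by (simp add: rep_comp_def compose_def)

lemma rep_comp_closed:
  assumes V: "\<And>x. module K (space V x)"
    and maps: "\<And>x y. x \<le> y \<Longrightarrow> rmap V x y \<in> module_hom K (space V x) (space V y)"
    and f: "f \<in> rep_hom K V W" and g: "g \<in> rep_hom K W U"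
  shows "rep_comp V g f \<in> rep_hom K V U"
proof (rule rep_homI)
  show "rep_comp V g f x \<in> extensional (carrier (space V x))" for x by (simp add: rep_comp_def)
qed (use maps in \<open>auto simp: rep_comp_apply rep_homD[OF f] rep_homD[OF g] module.smult_closed[OF V]
    abelian_monoid.a_closed[OF abelian_group.axioms(1)[OF module.axioms(2)[OF V]]] module_hom_def Pi_iff\<close>)

lemma ring_End_op:
  fixes V :: "('p::order, 'k, 'v) poset_rep"
  assumes V: "\<And>x. module K (space V x)"
    and maps: "\<And>x y. x \<le> y \<Longrightarrow> rmap V x y \<in> module_hom K (space V x) (space V y)"
  shows "ring (End_op K V)"
proof -
  let ?E = "End_op K V"
  interpret V: module K "space V x" for x by (rule V)
  have mapc: "rmap V x y v \<in> carrier (space V y)" if "x \<le> y" "v \<in> carrier (space V x)" for x y v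
    using maps[OF that(1)] that(2) by (auto simp: module_hom_def)
  have mapa: "rmap V x y (v \<oplus>\<^bsub>space V x\<^esub> w) = rmap V x y v \<oplus>\<^bsub>space V y\<^esub> rmap V x y w"
    if "x \<le> y" "v \<in> carrier (space V x)" "w \<in> carrier (space V x)" for x y v w
    using maps[OF that(1)] that(2,3) by (auto simp: module_hom_def)
  have maps: "rmap V x y (k \<odot>\<^bsub>space V x\<^esub> v) = k \<odot>\<^bsub>space V y\<^esub> rmap V x y v"
    if "x \<le> y" "k \<in> carrier K" "v \<in> carrier (space V x)" for x y k v
    using maps[OF that(1)] that(2,3) by (auto simp: module_hom_def)
  have map0: "rmap V x y \<zero>\<^bsub>space V x\<^esub> = \<zero>\<^bsub>space V y\<^esub>" if "x \<le> y" for x y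
    using maps[OF that, of "\<zero>\<^bsub>K\<^esub>" "\<zero>\<^bsub>space V x\<^esub>"] mapc[OF that, of "\<zero>\<^bsub>space V x\<^esub>"] by simp
  have E [simp]: "carrier ?E = rep_hom K V V" "\<one>\<^bsub>?E\<^esub> = rep_id V" "f \<otimes>\<^bsub>?E\<^esub> g = rep_comp V g f" for f g
    by (simp_all add: End_op_def)
  have add: "(f \<oplus>\<^bsub>?E\<^esub> g) x v = f x v \<oplus>\<^bsub>space V x\<^esub> g x v" if "v \<in> carrier (space V x)" for f g x v
    using that by (simp add: End_op_def)
  have zero: "\<zero>\<^bsub>?E\<^esub> x v = \<zero>\<^bsub>space V x\<^esub>" if "v \<in> carrier (space V x)" for x v
    using that by (simp add: End_op_def)
  have one: "rep_id V x v = v" if "v \<in> carrier (space V x)" for x v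
    using that by (simp add: rep_id_def)
  have add_closed: "f \<oplus>\<^bsub>?E\<^esub> g \<in> rep_hom K V V" if f: "f \<in> rep_hom K V V" and g: "g \<in> rep_hom K V V" for f g
  proof (rule rep_homI)
    show "(f \<oplus>\<^bsub>?E\<^esub> g) x \<in> extensional (carrier (space V x))" for x by (simp add: End_op_def)
  qed (auto simp: add rep_homD[OF f] rep_homD[OF g] V.M.a_ac V.smult_r_distr mapc mapa)
  have zero_closed: "\<zero>\<^bsub>?E\<^esub> \<in> rep_hom K V V"
  proof (rule rep_homI)
    show "\<zero>\<^bsub>?E\<^esub> x \<in> extensional (carrier (space V x))" for x by (simp add: End_op_def)
  qed (auto simp: zero mapc map0)
  have one_closed: "rep_id V \<in> rep_hom K V V"
  proof (rule rep_homI)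
    show "rep_id V x \<in> extensional (carrier (space V x))" for x by (simp add: rep_id_def)
  qed (auto simp: one mapc)
  have comp_closed: "rep_comp V g f \<in> rep_hom K V V" if "f \<in> rep_hom K V V" "g \<in> rep_hom K V V" for f g
    by (rule rep_comp_closed[OF V assms(2) that])
  have ab: "abelian_group ?E"
  proof (rule abelian_groupI, goal_cases)
    case (6 f)
    then have f: "f \<in> rep_hom K V V" by simp
    \<comment> \<open>The negative is written as the scalar multiple by minus one, so that linearity
      and naturality are those of scalar multiples.\<close>
    let ?g = "\<lambda>x. \<lambda>v \<in> carrier (space V x). \<ominus>\<^bsub>K\<^esub> \<one>\<^bsub>K\<^esub> \<odot>\<^bsub>space V x\<^esub> f x v"
    have g: "?g \<in> rep_hom K V V"
      by (rule rep_homI) (auto simp: rep_homD[OF f] V.smult_r_distr mapc maps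
          V.smult_assoc1[symmetric] V.R.m_comm)
    have neg: "\<ominus>\<^bsub>K\<^esub> \<one>\<^bsub>K\<^esub> \<odot>\<^bsub>space V x\<^esub> w \<oplus>\<^bsub>space V x\<^esub> w = \<zero>\<^bsub>space V x\<^esub>" if "w \<in> carrier (space V x)" for x w
      using that by (simp add: V.smult_l_minus V.M.l_neg)
    have "?g \<oplus>\<^bsub>?E\<^esub> f = \<zero>\<^bsub>?E\<^esub>"
      by (rule rep_hom_ext[OF add_closed[OF g f] zero_closed])
        (auto simp: add zero neg rep_homD(2)[OF f])
    then show ?case using g by auto
  next
    case (3 f g h)
    then show ?case by (intro rep_hom_ext[of _ K V V])
      (auto simp: add_closed add rep_homD(2) V.M.a_assoc)
  next
    case (4 f g)
    then show ?case by (intro rep_hom_ext[of _ K V V])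
      (auto simp: add_closed add rep_homD(2) V.M.a_comm)
  next
    case (5 f)
    then show ?case
      by (intro rep_hom_ext[of _ K V V]) (auto simp: add_closed zero_closed add zero rep_homD(2))
  qed (auto simp: add_closed zero_closed)
  have mon: "Group.monoid ?E"
  proof (rule monoidI, goal_cases)
    case (3 f g h)
    then show ?case by (intro rep_hom_ext[of _ K V V])
      (auto simp: comp_closed rep_comp_apply rep_homD(2))
  next
    case (4 f)
    then show ?case
      by (intro rep_hom_ext[of _ K V V])
        (auto simp: comp_closed one_closed rep_comp_apply rep_homD(2) one)
  next
    case (5 f)
    then show ?case
      by (intro rep_hom_ext[of _ K V V])
        (auto simp: comp_closed one_closed rep_comp_apply rep_homD(2) one)
  qed (auto simp: comp_closed one_closed)
  show ?thesis
  proof (rule ringI[OF ab mon], goal_cases)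
    case (1 f g h)
    then show ?case
      by (intro rep_hom_ext[of _ K V V])
        (auto simp: comp_closed add_closed rep_comp_apply rep_homD(2,3) add)
  next
    case (2 f g h)
    then show ?case
      by (intro rep_hom_ext[of _ K V V])
        (auto simp: comp_closed add_closed rep_comp_apply rep_homD(2,3) add)
  qed
qed

section \<open>The algebra of interval representations\<close>

lemma module_rep_sum:
  assumes K: "cring K" and V: "\<And>i. i \<in> I \<Longrightarrow> module K (space (V i) x)"
  shows "module K (space (rep_sum I V) x)"
proof -
  note ag = module.axioms(2)[OF V] and am = abelian_group.axioms(1)[OF module.axioms(2)[OF V]]
  note cl = abelian_monoid.zero_closed[OF am] abelian_monoid.a_closed[OF am]
    abelian_group.a_inv_closed[OF ag] abelian_group.l_neg[OF ag] abelian_monoid.l_zero[OF am]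
    abelian_monoid.a_comm[OF am] abelian_monoid.a_assoc[OF am]
  have "abelian_group (space (rep_sum I V) x)"
  proof (rule abelian_groupI, goal_cases)
    case (6 v)
    then have v: "v i \<in> carrier (space (V i) x)" if "i \<in> I" for i
      using that by (auto simp: rep_sum_def)
    show ?case
      by (intro bexI[of _ "\<lambda>i\<in>I. \<ominus>\<^bsub>space (V i) x\<^esub> v i"])
        (auto simp: rep_sum_def cl(3,4)[OF _ v] intro!: restrict_ext)
  next
    case (5 v)
    then have v: "v i \<in> carrier (space (V i) x)" if "i \<in> I" for i
      using that by (auto simp: rep_sum_def)
    have "v \<in> extensional I" using 5 by (auto simp: rep_sum_def PiE_def)
    then show ?case
      by (intro extensionalityI[of _ I]) (simp_all add: rep_sum_def cl(5)[OF _ v])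
  next
    case (3 u v w)
    then show ?case by (auto simp: rep_sum_def PiE_iff cl(2,7) intro!: restrict_ext)
  next
    case (4 v w)
    then show ?case by (auto simp: rep_sum_def PiE_iff cl(6) intro!: restrict_ext)
  qed (auto simp: rep_sum_def PiE_iff cl(1,2))
  then show ?thesis
  proof (rule moduleI[OF K], goal_cases)
    case (5 v)
    then show ?case
      by (intro extensionalityI[of _ I]) (auto simp: rep_sum_def PiE_iff module.smult_one[OF V])
  qed (auto simp: rep_sum_def PiE_iff module.smult_closed[OF V] module.smult_l_distr[OF V]
      module.smult_r_distr[OF V] module.smult_assoc1[OF V] intro!: restrict_ext)
qed

text \<open>
  A morphism from \<open>I\<^sub>R\<close> to \<open>I\<^sub>S\<close> acts at each point by a scalar; naturality is the condition on
  the scalars in the definition of \<open>weights\<close>.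
\<close>

definition weights :: "('k, 'm) ring_scheme \<Rightarrow> 'p::order set \<Rightarrow> 'p set \<Rightarrow> ('p \<Rightarrow> 'k) set" where
  "weights K R S = {\<phi>. (\<forall>x. \<phi> x \<in> carrier K) \<and> (\<forall>x. x \<notin> R \<inter> S \<longrightarrow> \<phi> x = \<zero>\<^bsub>K\<^esub>) \<and>
     (\<forall>x\<in>R. \<forall>y\<in>S. x \<le> y \<longrightarrow> \<phi> x = \<phi> y)}"

definition weight_elt ::
  "('k, 'm) ring_scheme \<Rightarrow> 'p::order set \<Rightarrow> 'p set \<Rightarrow> ('p \<Rightarrow> 'k) \<Rightarrow> ('p, 'k) lam" where
  "weight_elt K R S \<phi> =
     op_elt K R S (\<lambda>x. \<lambda>v \<in> carrier (space (interval_rep K R) x). \<phi> x \<otimes>\<^bsub>K\<^esub> v)"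

text \<open>For \<open>x\<close> outside \<open>R\<close> the fibre of the summand at
  \<open>x\<close> is zero, so the vector has to degenerate to zero there in order to stay in the
  carrier.\<close>

definition unit_vec :: "('k, 'm) ring_scheme \<Rightarrow> 'p::order set \<Rightarrow> 'p \<Rightarrow> 'p set \<Rightarrow> 'k" where
  "unit_vec K R x = (\<lambda>j\<in>intervals. if j = R \<and> x \<in> R then \<one>\<^bsub>K\<^esub> else \<zero>\<^bsub>K\<^esub>)"

text \<open>A matrix entry. Fibres of interval representations have dimension at most one, so the
  block of \<open>a x\<close> from the summand of \<open>R\<close> to that of \<open>S\<close> is a
  single scalar.\<close>

definition coef ::
  "('k, 'm) ring_scheme \<Rightarrow> ('p::order, 'k) lam \<Rightarrow> 'p set \<Rightarrow> 'p set \<Rightarrow> 'p \<Rightarrow> 'k" where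
  "coef K a R S x = a x (unit_vec K R x) S"

definition ind :: "('k, 'm) ring_scheme \<Rightarrow> 'p set \<Rightarrow> 'p \<Rightarrow> 'k" where
  "ind K C x = (if x \<in> C then \<one>\<^bsub>K\<^esub> else \<zero>\<^bsub>K\<^esub>)"

lemma weightsD:
  assumes "\<phi> \<in> weights K R S"
  shows "\<phi> x \<in> carrier K" "x \<notin> R \<Longrightarrow> \<phi> x = \<zero>\<^bsub>K\<^esub>" "x \<notin> S \<Longrightarrow> \<phi> x = \<zero>\<^bsub>K\<^esub>"
    "\<lbrakk>x \<in> R; y \<in> S; x \<le> y\<rbrakk> \<Longrightarrow> \<phi> x = \<phi> y"
  using assms by (auto simp: weights_def)

lemma interval_rep_simps:
  "carrier (space (interval_rep K S) x) = (if x \<in> S then carrier K else {\<zero>\<^bsub>K\<^esub>})"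
  "\<zero>\<^bsub>space (interval_rep K S) x\<^esub> = \<zero>\<^bsub>K\<^esub>"
  "v \<oplus>\<^bsub>space (interval_rep K S) x\<^esub> w = v \<oplus>\<^bsub>K\<^esub> w"
  "k \<odot>\<^bsub>space (interval_rep K S) x\<^esub> w = k \<otimes>\<^bsub>K\<^esub> w"
  "rmap (interval_rep K S) x y v = (if x \<in> S \<and> y \<in> S then v else \<zero>\<^bsub>K\<^esub>)"
  by (simp_all add: interval_rep_def)

lemma G_rep_simps:
  "\<zero>\<^bsub>space (G_rep K) x\<^esub> = (\<lambda>i\<in>intervals. \<zero>\<^bsub>K\<^esub>)"
  "v \<oplus>\<^bsub>space (G_rep K) x\<^esub> w = (\<lambda>i\<in>intervals. v i \<oplus>\<^bsub>K\<^esub> w i)"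
  "k \<odot>\<^bsub>space (G_rep K) x\<^esub> w = (\<lambda>i\<in>intervals. k \<otimes>\<^bsub>K\<^esub> w i)"
  "rmap (G_rep K) x y v = (\<lambda>i\<in>intervals. if x \<in> i \<and> y \<in> i then v i else \<zero>\<^bsub>K\<^esub>)"
  by (simp_all add: G_rep_def rep_sum_def interval_rep_simps)

lemma carrier_G_rep_iff:
  "\<zero>\<^bsub>K\<^esub> \<in> carrier K \<Longrightarrow> v \<in> carrier (space (G_rep K) x) \<longleftrightarrow> v \<in> extensional intervals \<and>
     (\<forall>j\<in>intervals. v j \<in> carrier K \<and> (x \<notin> j \<longrightarrow> v j = \<zero>\<^bsub>K\<^esub>))"
  by (auto simp: G_rep_def rep_sum_def interval_rep_simps PiE_iff)

lemma Lambda_simps: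
  "carrier (Lambda K) = rep_hom K (G_rep K) (G_rep K)"
  "f \<otimes>\<^bsub>Lambda K\<^esub> g = rep_comp (G_rep K) g f"
  by (simp_all add: Lambda_def End_op_def)

lemma Lambda_apply:
  assumes "v \<in> carrier (space (G_rep K) x)"
  shows "(f \<otimes>\<^bsub>Lambda K\<^esub> g) x v = g x (f x v)"
    "(f \<oplus>\<^bsub>Lambda K\<^esub> g) x v = (\<lambda>i\<in>intervals. f x v i \<oplus>\<^bsub>K\<^esub> g x v i)"
    "\<zero>\<^bsub>Lambda K\<^esub> x v = (\<lambda>i\<in>intervals. \<zero>\<^bsub>K\<^esub>)" "\<one>\<^bsub>Lambda K\<^esub> x v = v"
    "scalar K k x v = (\<lambda>i\<in>intervals. k \<otimes>\<^bsub>K\<^esub> v i)"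
  using assms
  by (simp_all add: Lambda_def End_op_def rep_comp_apply G_rep_simps rep_id_def scalar_def)

lemma Lambda_ext:
  assumes "f \<in> carrier (Lambda K)" "g \<in> carrier (Lambda K)"
    "\<And>x v. v \<in> carrier (space (G_rep K) x) \<Longrightarrow> f x v = g x v"
  shows "f = g"
  using assms rep_hom_ext unfolding Lambda_simps by blast

section \<open>Endomorphisms of the sum of all interval representations\<close>

locale interval_algebra = field K for K :: "('k, 'm) ring_scheme" (structure)
begin

lemmas carrier_G_iff = carrier_G_rep_iff[OF zero_closed]

lemma G_module: "module K (space (G_rep K) x)"
  unfolding G_rep_def using vectorspace_interval_rep[OF field_axioms] unfolding vectorspace_def
  by (intro module_rep_sum is_cring) blast

lemma G_map:
  fixes x :: "'p::order"
  assumes "x \<le> y" shows "rmap (G_rep K) x y \<in> module_hom K (space (G_rep K) x) (space (G_rep K) y)"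
  by (auto simp: module_hom_def carrier_G_iff G_rep_simps intro!: restrict_ext)

lemma ring_Lambda: "ring (Lambda K :: ('p::order, 'k) lam ring)"
  unfolding Lambda_def by (rule ring_End_op[OF G_module G_map])

sublocale Lam: ring "Lambda K :: ('p::order, 'k) lam ring" by (rule ring_Lambda)

lemma LambdaI:
  assumes "\<And>x. f x \<in> extensional (carrier (space (G_rep K) x))"
    "\<And>x v. v \<in> carrier (space (G_rep K) x) \<Longrightarrow> f x v \<in> carrier (space (G_rep K) x)"
    "\<And>x v w. \<lbrakk>v \<in> carrier (space (G_rep K) x); w \<in> carrier (space (G_rep K) x)\<rbrakk> \<Longrightarrow>
      f x (\<lambda>i\<in>intervals. v i \<oplus> w i) = (\<lambda>i\<in>intervals. f x v i \<oplus> f x w i)"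
    "\<And>x k v. \<lbrakk>k \<in> carrier K; v \<in> carrier (space (G_rep K) x)\<rbrakk> \<Longrightarrow>
      f x (\<lambda>i\<in>intervals. k \<otimes> v i) = (\<lambda>i\<in>intervals. k \<otimes> f x v i)"
    "\<And>x y v. \<lbrakk>x \<le> y; v \<in> carrier (space (G_rep K) x)\<rbrakk> \<Longrightarrow>
      (\<lambda>i\<in>intervals. if x \<in> i \<and> y \<in> i then f x v i else \<zero>) =
      f y (\<lambda>i\<in>intervals. if x \<in> i \<and> y \<in> i then v i else \<zero>)"
  shows "f \<in> carrier (Lambda K)"
  unfolding Lambda_simps by (rule rep_homI) (use assms in \<open>simp_all add: G_rep_simps\<close>)

lemma LambdaD:
  assumes "f \<in> carrier (Lambda K)" "v \<in> carrier (space (G_rep K) x)"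
  shows "f x v \<in> carrier (space (G_rep K) x)"
    "w \<in> carrier (space (G_rep K) x) \<Longrightarrow>
      f x (\<lambda>i\<in>intervals. v i \<oplus> w i) = (\<lambda>i\<in>intervals. f x v i \<oplus> f x w i)"
    "k \<in> carrier K \<Longrightarrow> f x (\<lambda>i\<in>intervals. k \<otimes> v i) = (\<lambda>i\<in>intervals. k \<otimes> f x v i)"
    "x \<le> y \<Longrightarrow> (\<lambda>i\<in>intervals. if x \<in> i \<and> y \<in> i then f x v i else \<zero>) =
      f y (\<lambda>i\<in>intervals. if x \<in> i \<and> y \<in> i then v i else \<zero>)"
  using rep_homD[OF assms(1)[unfolded Lambda_simps]] assms(2) by (simp_all add: G_rep_simps)

lemma weight_elt_apply:
  assumes "R \<in> intervals" "\<phi> \<in> weights K R S" "v \<in> carrier (space (G_rep K) x)"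
  shows "weight_elt K R S \<phi> x v = (\<lambda>j\<in>intervals. if j = S then \<phi> x \<otimes> v R else \<zero>)"
proof -
  have vR: "v R \<in> carrier (space (interval_rep K R) x)"
    using assms(1,3) by (auto simp: carrier_G_iff interval_rep_simps)
  then have "\<phi> x \<otimes> v R \<in> carrier (space (interval_rep K S) x)"
    using weightsD(1,3)[OF assms(2)] by (auto simp: interval_rep_simps split: if_splits)
  then show ?thesis
    using vR assms(3) unfolding weight_elt_def op_elt_def
    by (auto simp: rep_comp_apply rep_proj_def rep_incl_def G_rep_def[symmetric] interval_rep_simps(2)
        intro!: restrict_ext)
qed

lemma weight_elt_closed:
  assumes R: "R \<in> intervals" and phi: "\<phi> \<in> weights K R S"
  shows "weight_elt K R S \<phi> \<in> carrier (Lambda K)"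
proof (rule LambdaI, goal_cases)
  case (1 x)
  then show ?case by (simp add: weight_elt_def op_elt_def rep_comp_def)
next
  case (2 x v)
  then show ?case
    using R weightsD(1,3)[OF phi, of x] by (auto simp: weight_elt_apply[OF R phi] carrier_G_iff)
next
  case (3 x v w)
  then have "(\<lambda>i\<in>intervals. v i \<oplus> w i) \<in> carrier (space (G_rep K) x)" by (simp add: carrier_G_iff)
  then show ?case
    using 3 R weightsD(1)[OF phi, of x]
    by (auto simp: weight_elt_apply[OF R phi] carrier_G_iff r_distr intro!: restrict_ext)
next
  case (4 x k v)
  then have "(\<lambda>i\<in>intervals. k \<otimes> v i) \<in> carrier (space (G_rep K) x)" by (simp add: carrier_G_iff)
  then show ?case
    using 4 R weightsD(1)[OF phi, of x]
    by (auto simp: weight_elt_apply[OF R phi] carrier_G_iff m_lcomm intro!: restrict_ext)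
next
  case (5 x y v)
  then have "(\<lambda>i\<in>intervals. if x \<in> i \<and> y \<in> i then v i else \<zero>) \<in> carrier (space (G_rep K) y)"
    by (simp add: carrier_G_iff)
  \<comment> \<open>Naturality at coordinate \<open>S\<close>. For \<open>x\<close> in
    \<open>R\<close> and \<open>y\<close> in \<open>S\<close> the two values of
    \<open>\<phi>\<close> agree, and both are zero if \<open>x\<close> is outside \<open>S\<close>
    or \<open>y\<close> outside \<open>R\<close>. In the remaining cases both sides vanish.\<close>
  moreover have "(if x \<in> S \<and> y \<in> S then \<phi> x \<otimes> v R else \<zero>) = \<phi> y \<otimes> (if x \<in> R \<and> y \<in> R then v R else \<zero>)"
  proof -
    have vR: "v R \<in> carrier K" "x \<notin> R \<Longrightarrow> v R = \<zero>" using 5(2) R by (auto simp: carrier_G_iff)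
    have xK: "\<phi> x \<in> carrier K" "\<phi> y \<in> carrier K" by (rule weightsD(1)[OF phi])+
    show ?thesis
    proof (cases "x \<in> R \<and> y \<in> S")
      case True
      then have "\<phi> x = \<phi> y" using weightsD(4)[OF phi] 5(1) by blast
      moreover have "x \<notin> S \<Longrightarrow> \<phi> x = \<zero>" "y \<notin> R \<Longrightarrow> \<phi> y = \<zero>"
        by (rule weightsD(2,3)[OF phi], assumption)+
      ultimately show ?thesis using True vR(1) xK by auto
    next
      case False
      moreover have "y \<notin> S \<Longrightarrow> \<phi> y = \<zero>" by (rule weightsD(3)[OF phi])
      ultimately show ?thesis using vR xK by auto
    qed
  qed
  ultimately show ?case
    using 5 R by (auto simp: weight_elt_apply[OF R phi] intro!: restrict_ext)
qed

section \<open>Arithmetic of weights\<close>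

lemma zero_weights: "(\<lambda>_. \<zero>) \<in> weights K R S"
  by (simp add: weights_def)

lemma add_weights:
  assumes "\<phi> \<in> weights K R S" "\<psi> \<in> weights K R S"
  shows "(\<lambda>x. \<phi> x \<oplus> \<psi> x) \<in> weights K R S"
  using assms unfolding weights_def by simp

lemma smult_weights:
  assumes "c \<in> carrier K" "\<phi> \<in> weights K R S"
  shows "(\<lambda>x. c \<otimes> \<phi> x) \<in> weights K R S"
  using assms unfolding weights_def by simp

text \<open>Pointwise products describe composition. The delicate case is \<open>x \<le> y\<close>
  with just one of the two points in the middle interval \<open>R\<close>: one factor is constant
  along the pair and vanishes at the point outside \<open>R\<close>, the other one vanishes there as
  well, so both products are zero.\<close>

lemma mult_weights:
  assumes phi: "\<phi> \<in> weights K Q R" and psi: "\<psi> \<in> weights K R S"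
  shows "(\<lambda>x. \<phi> x \<otimes> \<psi> x) \<in> weights K Q S"
proof -
  have "\<phi> x \<otimes> \<psi> x = \<phi> y \<otimes> \<psi> y" if "x \<in> Q" "y \<in> S" "x \<le> y" for x y
  proof -
    have c: "\<phi> z \<in> carrier K" "\<psi> z \<in> carrier K" "z \<notin> R \<Longrightarrow> \<phi> z = \<zero>" "z \<notin> R \<Longrightarrow> \<psi> z = \<zero>" for z
      using weightsD(1,3)[OF phi] weightsD(1,2)[OF psi] by blast+
    have "y \<in> R \<Longrightarrow> \<phi> x = \<phi> y" "x \<in> R \<Longrightarrow> \<psi> x = \<psi> y"
      using weightsD(4)[OF phi that(1) _ that(3)] weightsD(4)[OF psi _ that(2,3)] by blast+
    then show ?thesis using c(3,4)[of x] c(3,4)[of y] c(1,2)[of x] c(1,2)[of y]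
      by (metis l_null r_null)
  qed
  moreover have "\<phi> x \<otimes> \<psi> x = \<zero>" if "x \<notin> Q \<inter> S" for x
    using that weightsD(1,2)[OF phi, of x] weightsD(1,3)[OF psi, of x] by (metis IntI l_null r_null)
  ultimately show ?thesis
    using weightsD(1)[OF phi] weightsD(1)[OF psi] unfolding weights_def by simp
qed

lemma weight_elt_zero:
  assumes "R \<in> intervals" shows "weight_elt K R S (\<lambda>_. \<zero>) = \<zero>\<^bsub>Lambda K\<^esub>"
  by (rule Lambda_ext[where K = K])
    (use assms in \<open>auto simp: weight_elt_closed zero_weights weight_elt_apply Lambda_apply
    carrier_G_iff intro!: restrict_ext\<close>)

lemma weight_elt_add:
  assumes "R \<in> intervals" "\<phi> \<in> weights K R S" "\<psi> \<in> weights K R S"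
  shows "weight_elt K R S \<phi> \<oplus>\<^bsub>Lambda K\<^esub> weight_elt K R S \<psi> = weight_elt K R S (\<lambda>x. \<phi> x \<oplus> \<psi> x)"
  by (rule Lambda_ext[where K = K]) (use assms weightsD(1)[OF assms(2)] weightsD(1)[OF assms(3)] in
    \<open>auto simp: weight_elt_closed add_weights weight_elt_apply Lambda_apply carrier_G_iff l_distr
      intro!: restrict_ext\<close>)

lemma weight_elt_mult:
  assumes "Q \<in> intervals" "R \<in> intervals" "\<phi> \<in> weights K Q R" "\<psi> \<in> weights K R S"
  shows "weight_elt K Q R \<phi> \<otimes>\<^bsub>Lambda K\<^esub> weight_elt K R S \<psi> = weight_elt K Q S (\<lambda>x. \<phi> x \<otimes> \<psi> x)"
proof (rule Lambda_ext[where K = K], goal_cases)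
  case (3 x v)
  have "weight_elt K Q R \<phi> x v \<in> carrier (space (G_rep K) x)"
    using LambdaD(1)[OF weight_elt_closed 3] assms by blast
  then show ?case
    using 3 assms weightsD(1)[OF assms(3), of x] weightsD(1)[OF assms(4), of x]
    by (auto simp: weight_elt_apply mult_weights Lambda_apply carrier_G_iff m_ac intro!: restrict_ext)
qed (use assms in \<open>auto simp: weight_elt_closed mult_weights\<close>)

lemma weight_elt_mult_orth:
  assumes "Q \<in> intervals" "R \<in> intervals" "R' \<in> intervals" "R \<noteq> R'" "\<phi> \<in> weights K Q R" "\<psi> \<in> weights K R' S"
  shows "weight_elt K Q R \<phi> \<otimes>\<^bsub>Lambda K\<^esub> weight_elt K R' S \<psi> = \<zero>\<^bsub>Lambda K\<^esub>"
proof (rule Lambda_ext[where K = K], goal_cases)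
  case (3 x v)
  have "weight_elt K Q R \<phi> x v \<in> carrier (space (G_rep K) x)"
    using LambdaD(1)[OF weight_elt_closed 3] assms by blast
  then show ?case
    using 3 assms weightsD(1)[OF assms(5), of x] weightsD(1)[OF assms(6), of x]
    by (auto simp: weight_elt_apply Lambda_apply intro!: restrict_ext)
qed (use assms in \<open>auto simp: weight_elt_closed\<close>)

lemma unit_vec_mem: "unit_vec K R x \<in> carrier (space (G_rep K) x)"
  by (auto simp: carrier_G_iff unit_vec_def)

lemma coef_weight_elt:
  assumes "R \<in> intervals" "S \<in> intervals" "\<phi> \<in> weights K R S"
  shows "coef K (weight_elt K R S \<phi>) R S = \<phi>"
proof
  fix x show "coef K (weight_elt K R S \<phi>) R S x = \<phi> x"
    using assms weightsD(1,2)[OF assms(3), of x]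
    by (cases "x \<in> R")
      (auto simp: coef_def weight_elt_apply[OF assms(1,3) unit_vec_mem], auto simp: unit_vec_def)
qed

lemma weight_elt_inject:
  assumes "R \<in> intervals" "S \<in> intervals" "\<phi> \<in> weights K R S" "\<psi> \<in> weights K R S"
    "weight_elt K R S \<phi> = weight_elt K R S \<psi>"
  shows "\<phi> = \<psi>"
  using assms coef_weight_elt by metis

lemma Lambda_zero_vec:
  assumes "a \<in> carrier (Lambda K)"
  shows "a x (\<lambda>i\<in>intervals. \<zero>) = (\<lambda>i\<in>intervals. \<zero>)"
proof -
  let ?z = "\<lambda>i\<in>intervals. \<zero>"
  have z: "?z \<in> carrier (space (G_rep K) x)" by (simp add: carrier_G_iff)
  have "a x ?z \<in> carrier (space (G_rep K) x)" by (rule LambdaD(1)[OF assms z])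
  then have "(\<lambda>i\<in>intervals. \<zero> \<otimes> a x ?z i) = ?z" by (intro restrict_ext) (simp add: carrier_G_iff)
  moreover have "(\<lambda>i\<in>intervals. \<zero> \<otimes> ?z i) = ?z" by (auto intro!: restrict_ext)
  ultimately show ?thesis using LambdaD(3)[OF assms z zero_closed] by metis
qed

lemma coef_weights:
  assumes a: "a \<in> carrier (Lambda K)" and "R \<in> intervals" and S: "S \<in> intervals"
  shows "coef K a R S \<in> weights K R S"
proof -
  have au: "a x (unit_vec K R x) \<in> carrier (space (G_rep K) x)" for x
    by (rule LambdaD(1)[OF a unit_vec_mem])
  have c: "coef K a R S x \<in> carrier K" "x \<notin> S \<Longrightarrow> coef K a R S x = \<zero>" for x
    using au[of x] S by (auto simp: coef_def carrier_G_iff)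
  have u0: "unit_vec K R x = (\<lambda>i\<in>intervals. \<zero>)" if "x \<notin> R" for x
    using that by (auto simp: unit_vec_def intro!: restrict_ext)
  have cR: "coef K a R S x = \<zero>" if "x \<notin> R" for x
    using u0[OF that] Lambda_zero_vec[OF a] S by (simp add: coef_def)
  have "coef K a R S x = coef K a R S y" if xy: "x \<in> R" "y \<in> S" "x \<le> y" for x y
  proof -
    \<comment> \<open>Naturality of \<open>a\<close> at the unit vector, read at coordinate
      \<open>S\<close>. Transport from \<open>x\<close> to \<open>y\<close> yields the unit vector
      at \<open>y\<close> if \<open>y\<close> is in \<open>R\<close>, and zero otherwise.\<close>
    have nat: "(if x \<in> S then coef K a R S x else \<zero>) =
        a y (\<lambda>i\<in>intervals. if x \<in> i \<and> y \<in> i then unit_vec K R x i else \<zero>) S"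
      using fun_cong[OF LambdaD(4)[OF a unit_vec_mem[of R x] xy(3)], of S] S xy(2)
      unfolding coef_def by (simp split del: if_split)
    show ?thesis
    proof (cases "y \<in> R")
      case True
      then have "(\<lambda>i\<in>intervals. if x \<in> i \<and> y \<in> i then unit_vec K R x i else \<zero>) = unit_vec K R y"
        using xy by (auto simp: unit_vec_def intro!: restrict_ext)
      then show ?thesis using nat c(2) by (auto simp: coef_def split: if_splits)
    next
      case False
      then have "(\<lambda>i\<in>intervals. if x \<in> i \<and> y \<in> i then unit_vec K R x i else \<zero>) = (\<lambda>i\<in>intervals. \<zero>)"
        using xy by (auto simp: unit_vec_def intro!: restrict_ext)
      then show ?thesis using nat c(2) S cR[OF False] Lambda_zero_vec[OF a] by
        (auto split: if_splits)
    qed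
  qed
  then show ?thesis using c cR by (auto simp: weights_def)
qed

section \<open>Idempotents, corners and scalars\<close>

lemma ind_closed [simp]: "ind K C x \<in> carrier K"
  by (simp add: ind_def)

lemma ind_self_weights: "ind K S \<in> weights K S S"
  by (auto simp: weights_def ind_def)

lemma idem_eq: "idem K S = weight_elt K S S (ind K S)"
  unfolding idem_def weight_elt_def rep_id_def
  by (rule arg_cong[of _ _ "op_elt K S S"]) (auto simp: ind_def interval_rep_simps intro!: ext)

lemma op_elt_rho:
  "op_elt K R S (rho K R S C) = weight_elt K R S (ind K C)"
  unfolding weight_elt_def rho_def
  by (rule arg_cong[of _ _ "op_elt K R S"]) (auto simp: ind_def interval_rep_simps intro!: ext)

lemma idem_apply:
  assumes "S \<in> intervals" "v \<in> carrier (space (G_rep K) x)"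
  shows "idem K S x v = (\<lambda>j\<in>intervals. if j = S then v j else \<zero>)"
  using assms by
  (auto simp: idem_eq weight_elt_apply[OF _ ind_self_weights] ind_def carrier_G_iff intro!: restrict_ext)

lemma idem_closed: "S \<in> intervals \<Longrightarrow> idem K S \<in> carrier (Lambda K)"
  by (simp add: idem_eq weight_elt_closed ind_self_weights)

text \<open>The idempotent of \<open>R\<close> turns \<open>v\<close> into \<open>v R\<close> times
  the unit vector, so by linearity the corner is known from matrix entries. This identifies e_R
  \<Lambda> e_S with the weights from \<open>R\<close> to \<open>S\<close>.\<close>

lemma corner:
  assumes a: "a \<in> carrier (Lambda K)" and R: "R \<in> intervals" and S: "S \<in> intervals"
  shows "idem K R \<otimes>\<^bsub>Lambda K\<^esub> a \<otimes>\<^bsub>Lambda K\<^esub> idem K S = weight_elt K R S (coef K a R S)"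
proof (rule Lambda_ext[where K = K], goal_cases)
  case (3 x v)
  have vR: "v R \<in> carrier K" "x \<notin> R \<Longrightarrow> v R = \<zero>" using 3 R by (auto simp: carrier_G_iff)
  have ev: "idem K R x v = (\<lambda>i\<in>intervals. v R \<otimes> unit_vec K R x i)"
    using vR by (auto simp: idem_apply[OF R 3] unit_vec_def intro!: restrict_ext)
  have ev_mem: "idem K R x v \<in> carrier (space (G_rep K) x)"
    by (rule LambdaD(1)[OF idem_closed[OF R] 3])
  have "a x (idem K R x v) = (\<lambda>i\<in>intervals. v R \<otimes> a x (unit_vec K R x) i)"
    unfolding ev by (rule LambdaD(3)[OF a unit_vec_mem vR(1)])
  moreover have "a x (idem K R x v) \<in> carrier (space (G_rep K) x)" by (rule LambdaD(1)[OF a ev_mem])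
  ultimately have "idem K S x (a x (idem K R x v)) = (\<lambda>j\<in>intervals. if j = S then v R \<otimes> coef K a R S x else \<zero>)"
    using idem_apply[OF S, of "a x (idem K R x v)" x] S by
    (auto simp: coef_def intro!: restrict_ext)
  then show ?case
    unfolding Lambda_apply(1)[OF 3] weight_elt_apply[OF R coef_weights[OF a R S] 3]
      m_comm[OF vR(1) weightsD(1)[OF coef_weights[OF a R S]]] .
qed (use assms in \<open>auto simp: weight_elt_closed coef_weights idem_closed\<close>)

lemma scalar_closed:
  assumes "k \<in> carrier K" shows "scalar K k \<in> carrier (Lambda K)"
proof (rule LambdaI, goal_cases)
  case (1 x)
  then show ?case by (simp add: scalar_def)
qed (use assms in \<open>auto simp: carrier_G_iff scalar_def G_rep_simps r_distr m_lcomm intro!: restrict_ext\<close>)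

lemma coef_add:
  assumes "S \<in> intervals"
  shows "coef K (a \<oplus>\<^bsub>Lambda K\<^esub> b) R S x = coef K a R S x \<oplus> coef K b R S x"
  using assms by (simp add: coef_def Lambda_apply[OF unit_vec_mem])

lemma coef_scalar:
  assumes "S \<in> intervals" "a \<in> carrier (Lambda K)" "k \<in> carrier K"
  shows "coef K (scalar K k \<otimes>\<^bsub>Lambda K\<^esub> a) R S x = k \<otimes> coef K a R S x"
  using assms LambdaD(3)[OF assms(2) unit_vec_mem assms(3)]
  by (simp add: coef_def Lambda_apply[OF unit_vec_mem])

lemma scalar_weight_elt:
  assumes "R \<in> intervals" "\<phi> \<in> weights K R S" "k \<in> carrier K"
  shows "scalar K k \<otimes>\<^bsub>Lambda K\<^esub> weight_elt K R S \<phi> = weight_elt K R S (\<lambda>x. k \<otimes> \<phi> x)"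
proof (rule Lambda_ext[where K = K], goal_cases)
  case (3 x v)
  then have "(\<lambda>i\<in>intervals. k \<otimes> v i) \<in> carrier (space (G_rep K) x)"
    using assms by (simp add: carrier_G_iff)
  then show ?case using 3 assms weightsD(1)[OF assms(2), of x]
    by (auto simp: Lambda_apply weight_elt_apply smult_weights carrier_G_iff m_ac intro!: restrict_ext)
qed (use assms in \<open>auto simp: weight_elt_closed smult_weights scalar_closed\<close>)

text \<open>Partial sums are coordinate projections, a form that survives induction on
  \<open>A\<close>; the full set of intervals gives the identity.\<close>

lemma finsum_idem:
  assumes "finite A" "A \<subseteq> intervals"
  shows "finsum (Lambda K) (idem K) A =
    (\<lambda>x. \<lambda>v\<in>carrier (space (G_rep K) x). \<lambda>j\<in>intervals. if j \<in> A then v j else \<zero>)"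
  using assms
proof (induction A)
  case empty
  show ?case by (subst Lam.finsum_empty) (auto simp: Lambda_def End_op_def G_rep_simps intro!: ext)
next
  case (insert S A)
  then have "finsum (Lambda K) (idem K) (insert S A) = idem K S \<oplus>\<^bsub>Lambda K\<^esub> finsum (Lambda K) (idem K) A"
    by (intro Lam.finsum_insert) (auto intro: idem_closed)
  also have "\<dots> = (\<lambda>x. \<lambda>v\<in>carrier (space (G_rep K) x). \<lambda>j\<in>intervals. if j \<in> insert S A then v j else \<zero>)"
    using insert by
    (auto simp: Lambda_def End_op_def G_rep_simps idem_apply carrier_G_iff intro!: ext restrict_ext)
  finally show ?case .
qed

lemma orthogonal_idempotents_idem:
  "orthogonal_idempotents (Lambda K) (intervals :: 'p::{finite, order} set set) (idem K)"
proof (unfold_locales, goal_cases)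
  case (2 S)
  then show ?case by (rule idem_closed)
next
  case (3 S)
  have "(\<lambda>x. ind K S x \<otimes> ind K S x) = ind K S" by (auto simp: ind_def)
  then show ?case using 3 weight_elt_mult[OF 3 3 ind_self_weights ind_self_weights] by
    (simp add: idem_eq)
next
  case (4 S T)
  then show ?case unfolding idem_eq by (intro weight_elt_mult_orth ind_self_weights) auto
next
  case 5
  show ?case
    using finsum_idem[of "intervals :: 'p set set"]
    by (auto simp: Lambda_def End_op_def rep_id_def carrier_G_iff extensional_def intro!: ext)
qed simp

end

section \<open>Connected subsets\<close>

lemma poset_connected_constant:
  assumes "poset_connected T" "x \<in> T" "y \<in> T"
    and "\<And>x y. \<lbrakk>x \<in> T; y \<in> T; x \<le> y\<rbrakk> \<Longrightarrow> f x = f y"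
  shows "f x = f y"
proof -
  have "(\<lambda>a b. a \<in> T \<and> b \<in> T \<and> (a \<le> b \<or> b \<le> a))\<^sup>*\<^sup>* x y"
    using assms(1-3) by (simp add: poset_connected_def)
  then show ?thesis by induction (use assms(4) in metis)+
qed

text \<open>Membership in \<open>T\<close> is a function constant along comparable pairs of
  \<open>R\<close>.\<close>

lemma poset_connected_clopen:
  assumes "poset_connected R" "T \<subseteq> R" "T \<noteq> {}"
    and "\<And>x y. \<lbrakk>x \<in> R; y \<in> R; x \<le> y\<rbrakk> \<Longrightarrow> x \<in> T \<longleftrightarrow> y \<in> T"
  shows "T = R"
  using poset_connected_constant[OF assms(1), of _ _ "\<lambda>x. x \<in> T"] assms(2-4) by blast

lemma ex_connected_component:
  assumes "x \<in> A" "poset_convex A"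
  obtains C where "C \<in> intervals" "x \<in> C" "C \<subseteq> A" "\<And>a b. \<lbrakk>a \<in> C; b \<in> A; a \<le> b \<or> b \<le> a\<rbrakk> \<Longrightarrow> b \<in> C"
proof
  let ?r = "\<lambda>A a b. a \<in> A \<and> b \<in> A \<and> (a \<le> b \<or> b \<le> a)"
  let ?C = "{y. (?r A)\<^sup>*\<^sup>* x y}"
  show xC: "x \<in> ?C" by simp
  show sub: "?C \<subseteq> A"
  proof
    fix y assume "y \<in> ?C"
    then have "(?r A)\<^sup>*\<^sup>* x y" by simp
    then show "y \<in> A" by cases (use assms in auto)
  qed
  show closed: "b \<in> ?C" if "a \<in> ?C" "b \<in> A" "a \<le> b \<or> b \<le> a" for a b
  proof -
    have "?r A a b" using that sub by blast
    then show ?thesis using that(1) by (simp add: rtranclp.rtrancl_into_rtrancl)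
  qed
  \<comment> \<open>Connectedness of the component demands paths inside the component, while its
    definition offers paths in \<open>A\<close>; every initial piece of such a path ends in the
    component.\<close>
  have path: "(?r ?C)\<^sup>*\<^sup>* x y" if "(?r A)\<^sup>*\<^sup>* x y" for y
    using that
  proof induction
    case (step y z)
    then have "?r ?C y z" by (auto intro: rtranclp.rtrancl_into_rtrancl)
    then show ?case using step.IH by (rule rtranclp.rtrancl_into_rtrancl[rotated])
  qed simp
  have symp: "symp (?r ?C)" by (auto simp: symp_def)
  have "poset_connected ?C"
    unfolding poset_connected_def
  proof (intro ballI)
    fix y z assume "y \<in> ?C" "z \<in> ?C"
    then have "(?r ?C)\<^sup>*\<^sup>* x y" "(?r ?C)\<^sup>*\<^sup>* x z" using path by simp_all
    then show "(?r ?C)\<^sup>*\<^sup>* y z" using sympD[OF symp_rtranclp[OF symp]] rtranclp_trans[of "?r ?C" y x z] by simp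
  qed
  moreover have "poset_convex ?C"
    unfolding poset_convex_def
  proof (intro ballI allI impI)
    fix y z w assume "y \<in> ?C" "z \<in> ?C" "y \<le> w \<and> w \<le> z"
    moreover have "w \<in> A" using calculation sub assms(2) unfolding poset_convex_def by blast
    ultimately show "w \<in> ?C" using closed by blast
  qed
  ultimately show "?C \<in> intervals" using xC unfolding intervals_def by blast
qed

lemma intervalsD:
  assumes "S \<in> intervals"
  shows "S \<noteq> {}" "poset_connected S" "\<lbrakk>x \<in> S; y \<in> S; x \<le> z; z \<le> y\<rbrakk> \<Longrightarrow> z \<in> S"
  using assms unfolding intervals_def poset_convex_def by blast+

lemma ext_setD:
  assumes "R \<in> ext_set S"
  shows "R \<in> intervals" "S \<in> intervals" "S \<subseteq> R" "\<lbrakk>c \<in> S; x \<in> R; x \<le> c\<rbrakk> \<Longrightarrow> x \<in> S"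
  using assms by (auto simp: ext_set_def downset_intervals_def rel_downset_def)

lemma AdmD:
  assumes "C \<in> Adm R S"
  shows "C \<in> intervals" "C \<subseteq> R" "C \<subseteq> S"
    "\<lbrakk>c \<in> C; x \<in> S; c \<le> x\<rbrakk> \<Longrightarrow> x \<in> C" "\<lbrakk>c \<in> C; x \<in> R; x \<le> c\<rbrakk> \<Longrightarrow> x \<in> C"
proof -
  have C: "C \<in> intervals" "rel_downset R C" "rel_upset S C"
    using assms by (simp_all add: Adm_def downset_intervals_def upset_intervals_def)
  show "C \<in> intervals" by (fact C(1))
  show "C \<subseteq> R" by (rule conjunct1[OF C(2)[unfolded rel_downset_def]])
  show "C \<subseteq> S" by (rule conjunct1[OF C(3)[unfolded rel_upset_def]])
  show "x \<in> C" if "c \<in> C" "x \<in> S" "c \<le> x"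
    by (rule conjunct2[OF C(3)[unfolded rel_upset_def], rule_format, OF that])
  show "x \<in> C" if "c \<in> C" "x \<in> R" "x \<le> c"
    by (rule conjunct2[OF C(2)[unfolded rel_downset_def], rule_format, OF that])
qed

lemma AdmI:
  assumes "C \<in> intervals" "C \<subseteq> R" "C \<subseteq> S"
    "\<And>c x. \<lbrakk>c \<in> C; x \<in> S; c \<le> x\<rbrakk> \<Longrightarrow> x \<in> C" "\<And>c x. \<lbrakk>c \<in> C; x \<in> R; x \<le> c\<rbrakk> \<Longrightarrow> x \<in> C"
  shows "C \<in> Adm R S"
proof -
  have "rel_downset R C" "rel_upset S C"
    unfolding rel_downset_def rel_upset_def using assms(2-5) by blast+
  then show ?thesis using assms(1) by (simp add: Adm_def downset_intervals_def upset_intervals_def)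
qed

lemma ext_set_subset_Adm: "R \<in> ext_set S \<Longrightarrow> S \<in> Adm R S"
  by (simp add: ext_set_def Adm_def upset_intervals_def downset_intervals_def rel_upset_def)

lemma ext_setI:
  assumes "R \<in> intervals" "S \<in> intervals" "S \<subseteq> R" "\<And>c x. \<lbrakk>c \<in> S; x \<in> R; x \<le> c\<rbrakk> \<Longrightarrow> x \<in> S"
  shows "R \<in> ext_set S"
  using assms by (auto simp: ext_set_def downset_intervals_def rel_downset_def)

section \<open>Weights of intervals\<close>

context interval_algebra
begin

lemma weights_constant:
  assumes "\<phi> \<in> weights K R S" "poset_connected T" "T \<subseteq> R" "T \<subseteq> S" "x \<in> T" "y \<in> T"
  shows "\<phi> x = \<phi> y"
  using assms(2,5,6) by (rule poset_connected_constant)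
  (use weightsD(4)[OF assms(1)] assms(3,4) in blast)

text \<open>By connectedness of \<open>S\<close> one value determines the weight.
  \<open>R = S\<close> yields End(I_S) = k; \<open>R\<close> in \<open>ext_set S\<close> yields the
  lines in the standard module.\<close>

lemma weights_eq_smult_ind:
  assumes "\<phi> \<in> weights K R S" "S \<in> intervals" "S \<subseteq> R" "s \<in> S"
  shows "\<phi> = (\<lambda>x. \<phi> s \<otimes> ind K S x)"
proof
  fix x show "\<phi> x = \<phi> s \<otimes> ind K S x"
    using weights_constant[OF assms(1) intervalsD(2)[OF assms(2)] assms(3) subset_refl _ assms(4), of x]
      weightsD(1,3)[OF assms(1)] by (cases "x \<in> S") (auto simp: ind_def)
qed

text \<open>A nonzero value travels downwards: for \<open>x\<close> in \<open>R\<close> below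
  \<open>c\<close> in \<open>S\<close> it passes from \<open>c\<close> to \<open>x\<close>, and
  weights vanish outside \<open>S\<close>.\<close>

lemma ext_set_if_nonzero:
  assumes "\<phi> \<in> weights K R S" "R \<in> intervals" "S \<in> intervals" "\<And>s. s \<in> S \<Longrightarrow> \<phi> s \<noteq> \<zero>"
  shows "R \<in> ext_set S"
proof (rule ext_setI[OF assms(2,3)])
  show "S \<subseteq> R" using weightsD(2)[OF assms(1)] assms(4) by blast
  show "x \<in> S" if "c \<in> S" "x \<in> R" "x \<le> c" for c x
    using weightsD(3)[OF assms(1), of x] weightsD(4)[OF assms(1) that(2,1,3)] assms(4)[OF that(1)]
    by metis
qed

lemma weights_zero_if_zero:
  assumes "\<phi> \<in> weights K R S" "S \<in> intervals" "S \<subseteq> R" "s \<in> S" "\<phi> s = \<zero>"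
  shows "\<phi> = (\<lambda>_. \<zero>)"
  by (subst weights_eq_smult_ind[OF assms(1-4)]) (simp add: assms(5))

lemma ind_weights:
  assumes "C \<in> Adm R S"
  shows "ind K C \<in> weights K R S"
proof -
  have "ind K C x = \<zero>" if "x \<notin> R \<inter> S" for x
    using that AdmD(2,3)[OF assms] by (auto simp: ind_def)
  moreover have "ind K C x = ind K C y" if "x \<in> R" "y \<in> S" "x \<le> y" for x y
    using AdmD(4)[OF assms _ that(2,3)] AdmD(5)[OF assms _ that(1,3)] by (auto simp: ind_def)
  ultimately show ?thesis unfolding weights_def by simp
qed

lemma ind_ext_weights: "R \<in> ext_set S \<Longrightarrow> ind K S \<in> weights K R S"
  by (rule ind_weights[OF ext_set_subset_Adm])

text \<open>A nonzero loop is nowhere zero on the connected set \<open>T\<close>, so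
  \<open>T \<subseteq> R\<close> and both weights are nonzero on \<open>T\<close>. For
  \<open>x \<le> y\<close> in \<open>R\<close>, the weight \<open>\<phi>\<close> carries membership
  in \<open>T\<close> from \<open>x\<close> up to \<open>y\<close>, and \<open>\<psi>\<close>
  carries it from \<open>y\<close> down to \<open>x\<close>. Connectedness of \<open>R\<close> then
  forces \<open>T = R\<close>.\<close>

lemma mult_weights_loop:
  assumes phi: "\<phi> \<in> weights K T R" and psi: "\<psi> \<in> weights K R T"
    and T: "T \<in> intervals" and R: "R \<in> intervals" and "R \<noteq> T"
  shows "(\<lambda>x. \<phi> x \<otimes> \<psi> x) = (\<lambda>_. \<zero>)"
proof (rule ccontr)
  note chi = mult_weights[OF phi psi]
  assume "(\<lambda>x. \<phi> x \<otimes> \<psi> x) \<noteq> (\<lambda>_. \<zero>)"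
  then have "\<phi> s \<otimes> \<psi> s \<noteq> \<zero>" if "s \<in> T" for s
    using weights_zero_if_zero[OF chi T subset_refl that] by blast
  then have nz: "\<phi> s \<noteq> \<zero>" "\<psi> s \<noteq> \<zero>" if "s \<in> T" for s
    using that weightsD(1)[OF phi] weightsD(1)[OF psi] by (metis l_null, metis r_null)
  have "T = R"
  proof (rule poset_connected_clopen[OF intervalsD(2)[OF R]])
    show "T \<subseteq> R" using nz(1) weightsD(3)[OF phi] by blast
    show "x \<in> T \<longleftrightarrow> y \<in> T" if "x \<in> R" "y \<in> R" "x \<le> y" for x y
      using weightsD(4)[OF phi _ that(2,3)] weightsD(4)[OF psi that(1) _ that(3)] nz
        weightsD(2)[OF phi, of y] weightsD(3)[OF psi, of x] by metis
  qed (use T in \<open>simp add: intervalsD\<close>)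
  then show False using assms(5) by simp
qed

lemma mult_weights_ext:
  assumes phi: "\<phi> \<in> weights K Q T" and psi: "\<psi> \<in> weights K T S" and Q: "Q \<in> ext_set S"
    and T: "T \<in> intervals" "T \<notin> ext_set S"
  shows "(\<lambda>x. \<phi> x \<otimes> \<psi> x) = (\<lambda>_. \<zero>)"
proof (rule ccontr)
  note S = ext_setD(2)[OF Q]
  note chi = mult_weights[OF phi psi]
  assume "(\<lambda>x. \<phi> x \<otimes> \<psi> x) \<noteq> (\<lambda>_. \<zero>)"
  then have "\<phi> s \<otimes> \<psi> s \<noteq> \<zero>" if "s \<in> S" for s
    using weights_zero_if_zero[OF chi S ext_setD(3)[OF Q] that] by blast
  then have "\<psi> s \<noteq> \<zero>" if "s \<in> S" for s
    using that weightsD(1)[OF phi] by (metis r_null)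
  then show False using ext_set_if_nonzero[OF psi T(1) S] T(2) by blast
qed

text \<open>
  The support of a weight is a relative upset of \<open>S\<close> and a relative downset of \<open>R\<close>, so a weight
  can be split along the connected components of its support.
\<close>

lemma weights_split_component:
  assumes phi: "\<phi> \<in> weights K R S" and RS: "R \<in> intervals" "S \<in> intervals" and x: "\<phi> x \<noteq> \<zero>"
  obtains C where "C \<in> Adm R S" "x \<in> C"
    "(\<lambda>y. if y \<in> C then \<zero> else \<phi> y) \<in> weights K R S"
    "\<phi> = (\<lambda>y. (\<phi> x \<otimes> ind K C y) \<oplus> (if y \<in> C then \<zero> else \<phi> y))"
proof -
  let ?A = "{x. \<phi> x \<noteq> \<zero>}"
  have A: "?A \<subseteq> R" "?A \<subseteq> S" using weightsD(2,3)[OF phi] by blast+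
  have "poset_convex ?A"
    unfolding poset_convex_def
  proof (intro ballI allI impI)
    fix a b z assume *: "a \<in> ?A" "b \<in> ?A" "a \<le> z \<and> z \<le> b"
    then have "a \<in> R" "z \<in> S" using A intervalsD(3)[OF RS(2), of a b z] by blast+
    then show "z \<in> ?A" using weightsD(4)[OF phi, of a z] * by simp
  qed
  then obtain C where C: "C \<in> intervals" "x \<in> C" "C \<subseteq> ?A"
    "\<And>a b. \<lbrakk>a \<in> C; b \<in> ?A; a \<le> b \<or> b \<le> a\<rbrakk> \<Longrightarrow> b \<in> C"
    using ex_connected_component[of x ?A] x by auto
  \<comment> \<open>A point of \<open>S\<close> above \<open>C\<close> carries the same nonzero
    value, so it belongs to the support and, being comparable to \<open>C\<close>, to the same
    component. The downward case is dual, inside \<open>R\<close>.\<close>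
  have up: "b \<in> C" if "a \<in> C" "b \<in> S" "a \<le> b" for a b
    using C(3) C(4)[of a b] weightsD(4)[OF phi _ that(2,3)] that A by fastforce
  have down: "b \<in> C" if "a \<in> C" "b \<in> R" "b \<le> a" for a b
    using C(3) C(4)[of a b] weightsD(4)[OF phi that(2) _ that(3)] that A by fastforce
  have "C \<in> Adm R S"
    using C(1,3) A up down by (intro AdmI) blast+
  moreover have "(\<lambda>y. if y \<in> C then \<zero> else \<phi> y) \<in> weights K R S"
  proof -
    have "(if a \<in> C then \<zero> else \<phi> a) = (if b \<in> C then \<zero> else \<phi> b)" if "a \<in> R" "b \<in> S" "a \<le> b" for a b
      using up[OF _ that(2,3)] down[OF _ that(1,3)] weightsD(4)[OF phi that] by auto
    moreover have "(if a \<in> C then \<zero> else \<phi> a) = \<zero>" if "a \<notin> R \<inter> S" for a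
      using that weightsD(2,3)[OF phi] by auto
    moreover have "(if a \<in> C then \<zero> else \<phi> a) \<in> carrier K" for a
      using weightsD(1)[OF phi] by simp
    ultimately show ?thesis unfolding weights_def by blast
  qed
  moreover have "\<phi> = (\<lambda>y. (\<phi> x \<otimes> ind K C y) \<oplus> (if y \<in> C then \<zero> else \<phi> y))"
  proof
    fix y
    have "\<phi> y = \<phi> x" if "y \<in> C"
      by (rule weights_constant[OF phi intervalsD(2)[OF C(1)]]) (use C(2,3) A that in auto)
    then show "\<phi> y = (\<phi> x \<otimes> ind K C y) \<oplus> (if y \<in> C then \<zero> else \<phi> y)"
      using weightsD(1)[OF phi] by (simp add: ind_def)
  qed
  ultimately show thesis using that C(2) by blast
qed

section \<open>Corners of products and the basic idempotents\<close>

lemma idem_mult_weight_elt: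
  assumes "R \<in> intervals" "\<phi> \<in> weights K R S"
  shows "idem K R \<otimes>\<^bsub>Lambda K\<^esub> weight_elt K R S \<phi> = weight_elt K R S \<phi>"
proof -
  have "(\<lambda>x. ind K R x \<otimes> \<phi> x) = \<phi>"
    using weightsD(1,2)[OF assms(2)] by (auto simp: ind_def)
  then show ?thesis
    unfolding idem_eq weight_elt_mult[OF assms(1,1) ind_self_weights assms(2)] by simp
qed

lemma weight_elt_mult_idem:
  assumes "R \<in> intervals" "S \<in> intervals" "\<phi> \<in> weights K R S"
  shows "weight_elt K R S \<phi> \<otimes>\<^bsub>Lambda K\<^esub> idem K S = weight_elt K R S \<phi>"
proof -
  have "(\<lambda>x. \<phi> x \<otimes> ind K S x) = \<phi>"
    using weightsD(1,3)[OF assms(3)] by (auto simp: ind_def)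
  then show ?thesis
    unfolding idem_eq weight_elt_mult[OF assms(1,2,3) ind_self_weights] by simp
qed

text \<open>Doubling the middle idempotent splits the product into two corners, whose weights
  multiply.\<close>

lemma corner_mult:
  fixes Q R S :: "'p::{finite, order} set"
  assumes "a \<in> carrier (Lambda K)" "b \<in> carrier (Lambda K)" "Q \<in> intervals" "R \<in> intervals" "S \<in> intervals"
  shows "idem K Q \<otimes>\<^bsub>Lambda K\<^esub> a \<otimes>\<^bsub>Lambda K\<^esub> idem K R \<otimes>\<^bsub>Lambda K\<^esub> b \<otimes>\<^bsub>Lambda K\<^esub> idem K S =
    weight_elt K Q S (\<lambda>x. coef K a Q R x \<otimes> coef K b R S x)"
proof -
  interpret E: orthogonal_idempotents "Lambda K" "intervals :: 'p set set" "idem K"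
    by (rule orthogonal_idempotents_idem)
  note c = idem_closed[OF assms(3)] idem_closed[OF assms(4)] idem_closed[OF assms(5)]
  have "idem K Q \<otimes>\<^bsub>Lambda K\<^esub> a \<otimes>\<^bsub>Lambda K\<^esub> idem K R \<otimes>\<^bsub>Lambda K\<^esub> b \<otimes>\<^bsub>Lambda K\<^esub> idem K S =
      idem K Q \<otimes>\<^bsub>Lambda K\<^esub> a \<otimes>\<^bsub>Lambda K\<^esub> (idem K R \<otimes>\<^bsub>Lambda K\<^esub> idem K R) \<otimes>\<^bsub>Lambda K\<^esub> b \<otimes>\<^bsub>Lambda K\<^esub> idem K S"
    using E.e_idem[OF assms(4)] by simp
  also have "\<dots> = (idem K Q \<otimes>\<^bsub>Lambda K\<^esub> a \<otimes>\<^bsub>Lambda K\<^esub> idem K R) \<otimes>\<^bsub>Lambda K\<^esub>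
      (idem K R \<otimes>\<^bsub>Lambda K\<^esub> b \<otimes>\<^bsub>Lambda K\<^esub> idem K S)"
    using assms(1,2) c by (simp add: Lam.m_assoc del: E.e_idem)
  also have "\<dots> = weight_elt K Q S (\<lambda>x. coef K a Q R x \<otimes> coef K b R S x)"
    unfolding corner[OF assms(1,3,4)] corner[OF assms(2,4,5)]
    by (rule weight_elt_mult[OF assms(3,4) coef_weights coef_weights]) (use assms in auto)
  finally show ?thesis .
qed

text \<open>The corner at \<open>S\<close> consists of the multiples of \<open>idem K S\<close>, so
  a nonzero element is inverted by the inverse scalar. Loops are excluded by
  \<open>mult_weights_loop\<close>.\<close>

lemma basic_idempotents_idem:
  "basic_idempotents (Lambda K) (intervals :: 'p::{finite, order} set set) (idem K)"
proof (intro basic_idempotents.intro orthogonal_idempotents_idem basic_idempotents_axioms.intro, goal_cases)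
  case (1 S)
  obtain s where s: "s \<in> S" using intervalsD(1)[OF 1] by blast
  show ?case
  proof
    assume "idem K S = \<zero>\<^bsub>Lambda K\<^esub>"
    then have "ind K S = (\<lambda>_. \<zero>)"
      using weight_elt_inject[OF 1 1 ind_self_weights zero_weights] weight_elt_zero[OF 1, of S] by
      (simp add: idem_eq)
    then have "ind K S s = \<zero>" by simp
    then show False using s by (simp add: ind_def)
  qed
next
  case (2 S a)
  obtain s where s: "s \<in> S" using intervalsD(1)[OF 2(1)] by blast
  define c where "c = coef K a S S s"
  note cw = coef_weights[OF 2(2,1,1)]
  have c: "c \<in> carrier K" unfolding c_def by (rule weightsD(1)[OF cw])
  have eq: "coef K a S S = (\<lambda>x. c \<otimes> ind K S x)"
    unfolding c_def by (rule weights_eq_smult_ind[OF cw 2(1) subset_refl s])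
  have corner': "idem K S \<otimes>\<^bsub>Lambda K\<^esub> a \<otimes>\<^bsub>Lambda K\<^esub> idem K S = weight_elt K S S (\<lambda>x. c \<otimes> ind K S x)"
    unfolding corner[OF 2(2,1,1)] eq ..
  have "c \<noteq> \<zero>"
  proof
    assume "c = \<zero>"
    then have "weight_elt K S S (\<lambda>x. c \<otimes> ind K S x) = \<zero>\<^bsub>Lambda K\<^esub>" using weight_elt_zero[OF 2(1)]
      by simp
    then show False using 2(3) corner' by simp
  qed
  then have ci: "inv c \<in> carrier K" "inv c \<otimes> c = \<one>" using c field_Units by auto
  note w = smult_weights[OF c ind_self_weights] and wi = smult_weights[OF ci(1) ind_self_weights]
  have "(\<lambda>x. (inv c \<otimes> ind K S x) \<otimes> (c \<otimes> ind K S x)) = ind K S"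
    using ci c by (auto simp: ind_def)
  then have "weight_elt K S S (\<lambda>x. inv c \<otimes> ind K S x) \<otimes>\<^bsub>Lambda K\<^esub> weight_elt K S S (\<lambda>x. c \<otimes> ind K S x) = idem K S"
    unfolding idem_eq weight_elt_mult[OF 2(1,1) wi w] by simp
  then show ?case unfolding corner' using weight_elt_closed[OF 2(1) wi] by blast
next
  case (3 S R a b)
  show ?case
    unfolding corner_mult[OF 3(4,5,1,2,1)]
    using mult_weights_loop[OF coef_weights[OF 3(4,1,2)] coef_weights[OF 3(5,2,1)] 3(1,2)] 3(3) weight_elt_zero[OF 3(1)]
    by simp
qed

end

section \<open>The standard module\<close>

text \<open>The first two conclusions allow \<open>v\<close> to be zero, which covers the components
  off the support.\<close>

lemma vectorspace_one_dim:
  assumes "vectorspace K V" "v \<in> carrier V" "\<And>w. w \<in> carrier V \<Longrightarrow> \<exists>c\<in>carrier K. w = c \<odot>\<^bsub>V\<^esub> v"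
  shows "vectorspace.fin_dim K V" "vectorspace.dim K V \<le> 1"
    "v \<noteq> \<zero>\<^bsub>V\<^esub> \<Longrightarrow> vectorspace.basis K V {v}"
proof -
  interpret V: vectorspace K V by fact
  have sub: "{v} \<subseteq> carrier V" using assms(2) by simp
  have "w \<in> V.span {v}" if w: "w \<in> carrier V" for w
  proof -
    obtain c where c: "c \<in> carrier K" "w = c \<odot>\<^bsub>V\<^esub> v" using assms(3)[OF w] by blast
    have "v \<in> V.span {v}" using V.in_own_span[OF sub] by simp
    then show ?thesis
      using LinearCombinations.submodule.smult_closed[OF V.span_is_submodule[OF sub] c(1)] c(2)
      by simp
  qed
  then have gen: "V.gen_set {v}" using V.span_is_subset2[OF sub] by blast
  then show "V.fin_dim" unfolding V.fin_dim_def using sub by blast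
  show "V.dim \<le> 1" by (rule V.dim_le1I[OF gen assms(2)])
  assume "v \<noteq> \<zero>\<^bsub>V\<^esub>"
  then have "V.dim = 1" by (rule V.dim1I[OF gen _ assms(2)])
  then show "V.basis {v}" using V.dim_gen_is_basis[of "{v}"] gen sub by simp
qed

context interval_algebra
begin

section \<open>Components as vector spaces over the base field\<close>

lemma scalar_add:
  assumes "k \<in> carrier K" "l \<in> carrier K"
  shows "scalar K (k \<oplus> l) = scalar K k \<oplus>\<^bsub>Lambda K\<^esub> scalar K l"
  by (rule Lambda_ext[where K = K]) (use assms in
    \<open>auto simp: scalar_closed Lambda_apply carrier_G_iff l_distr intro!: restrict_ext\<close>)

lemma scalar_mult:
  assumes "k \<in> carrier K" "l \<in> carrier K"
  shows "scalar K (k \<otimes> l) = scalar K k \<otimes>\<^bsub>Lambda K\<^esub> scalar K l"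
proof (rule Lambda_ext[where K = K], goal_cases)
  case (3 x v)
  then have "(\<lambda>i\<in>intervals. k \<otimes> v i) \<in> carrier (space (G_rep K) x)"
    using assms by (simp add: carrier_G_iff)
  then show ?case
    using 3 assms by (auto simp: Lambda_apply carrier_G_iff m_ac intro!: restrict_ext)
qed (use assms in \<open>auto simp: scalar_closed\<close>)

lemma scalar_one: "scalar K \<one> = \<one>\<^bsub>Lambda K\<^esub>"
proof (rule Lambda_ext[where K = K], goal_cases)
  case (3 x v)
  then have "(\<lambda>i\<in>intervals. \<one> \<otimes> v i) = v"
    by (intro extensionalityI[of _ intervals]) (auto simp: carrier_G_iff)
  then show ?case using 3 by (simp add: Lambda_apply)
qed (auto simp: scalar_closed)

text \<open>Linearity of \<open>a\<close> at every point is the same as commuting with scalars.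
  Centrality is what keeps e_R M stable under the field.\<close>

lemma scalar_central:
  assumes k: "k \<in> carrier K" and a: "a \<in> carrier (Lambda K)"
  shows "scalar K k \<otimes>\<^bsub>Lambda K\<^esub> a = a \<otimes>\<^bsub>Lambda K\<^esub> scalar K k"
proof (rule Lambda_ext[where K = K], goal_cases)
  case (3 x v)
  then show ?case
    using LambdaD(3)[OF a 3 k] LambdaD(1)[OF a 3] by (simp add: Lambda_apply)
qed (use assms in \<open>auto simp: scalar_closed\<close>)

text \<open>For an idempotent, the image is the set of fixed elements, and fixedness is easier to
  check under the module operations.\<close>

lemma component_mem_iff:
  fixes R :: "'p::{finite, order} set" and M :: "(('p, 'k) lam, 'b) module"
  assumes M: "left_module (Lambda K) M" and R: "R \<in> intervals"
  shows "y \<in> carrier (component K R M) \<longleftrightarrow> y \<in> carrier M \<and> idem K R \<odot>\<^bsub>M\<^esub> y = y"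
proof -
  interpret M: left_module "Lambda K" M by fact
  interpret E: orthogonal_idempotents "Lambda K" "intervals :: 'p set set" "idem K"
    by (rule orthogonal_idempotents_idem)
  have "idem K R \<odot>\<^bsub>M\<^esub> (idem K R \<odot>\<^bsub>M\<^esub> m) = idem K R \<odot>\<^bsub>M\<^esub> m" if "m \<in> carrier M" for m
    using M.smult_assoc[OF idem_closed[OF R] idem_closed[OF R] that] E.e_idem[OF R] by simp
  then show ?thesis
    unfolding component_def using M.smult_closed[OF idem_closed[OF R]] by auto metis
qed

lemma component_vectorspace:
  fixes R :: "'p::{finite, order} set" and M :: "(('p, 'k) lam, 'b) module"
  assumes M: "left_module (Lambda K) M" and R: "R \<in> intervals"
  shows "vectorspace K (component K R M)"
proof -
  interpret M: left_module "Lambda K" M by fact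
  let ?V = "component K R M"
  note eR = idem_closed[OF R]
  have mem: "y \<in> carrier ?V \<longleftrightarrow> y \<in> carrier M \<and> idem K R \<odot>\<^bsub>M\<^esub> y = y" for y
    by (rule component_mem_iff[OF assms])
  have ops: "\<zero>\<^bsub>?V\<^esub> = \<zero>\<^bsub>M\<^esub>" "x \<oplus>\<^bsub>?V\<^esub> y = x \<oplus>\<^bsub>M\<^esub> y" "c \<odot>\<^bsub>?V\<^esub> y = scalar K c \<odot>\<^bsub>M\<^esub> y" for c x y
    by (simp_all add: component_def)
  have smult: "scalar K c \<odot>\<^bsub>M\<^esub> y \<in> carrier ?V" if c: "c \<in> carrier K" and y: "y \<in> carrier ?V" for c y
  proof -
    have yM: "y \<in> carrier M" "idem K R \<odot>\<^bsub>M\<^esub> y = y" using y mem by blast+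
    have "idem K R \<odot>\<^bsub>M\<^esub> (scalar K c \<odot>\<^bsub>M\<^esub> y) = (idem K R \<otimes>\<^bsub>Lambda K\<^esub> scalar K c) \<odot>\<^bsub>M\<^esub> y"
      by (rule M.smult_assoc[OF eR scalar_closed[OF c] yM(1), symmetric])
    also have "\<dots> = scalar K c \<odot>\<^bsub>M\<^esub> (idem K R \<odot>\<^bsub>M\<^esub> y)"
      unfolding scalar_central[OF c eR, symmetric]
        by (rule M.smult_assoc[OF scalar_closed[OF c] eR yM(1)])
    finally show ?thesis using M.smult_closed[OF scalar_closed[OF c] yM(1)] yM(2) mem by simp
  qed
  have zero: "\<zero>\<^bsub>M\<^esub> \<in> carrier ?V" using M.smult_r_null[OF eR] mem by simp
  have add: "x \<oplus>\<^bsub>M\<^esub> y \<in> carrier ?V" if "x \<in> carrier ?V" "y \<in> carrier ?V" for x y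
    using that M.smult_r_distr[OF eR] mem by simp
  have "abelian_group ?V"
  proof (rule abelian_groupI, goal_cases)
    case (6 x)
    then have x: "x \<in> carrier M" "idem K R \<odot>\<^bsub>M\<^esub> x = x" using mem by blast+
    have "scalar K (\<ominus> \<one>) \<odot>\<^bsub>M\<^esub> x \<oplus>\<^bsub>M\<^esub> x = (scalar K (\<ominus> \<one>) \<oplus>\<^bsub>Lambda K\<^esub> \<one>\<^bsub>Lambda K\<^esub>) \<odot>\<^bsub>M\<^esub> x"
      using M.smult_l_distr[OF scalar_closed Lam.one_closed x(1), of "\<ominus> \<one>"] M.smult_one[OF x(1)]
      by simp
    also have "\<dots> = scalar K (\<ominus> \<one> \<oplus> \<one>) \<odot>\<^bsub>M\<^esub> x"
      unfolding scalar_one[symmetric] by (subst scalar_add) simp_all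
    also have "\<dots> = scalar K (\<zero> \<otimes> \<zero>) \<odot>\<^bsub>M\<^esub> x" by (simp add: l_neg)
    also have "scalar K (\<zero> \<otimes> \<zero>) = \<zero>\<^bsub>Lambda K\<^esub>"
      by (rule Lambda_ext[where K = K])
        (auto simp: scalar_closed Lambda_apply carrier_G_iff intro!: restrict_ext)
    also have "\<zero>\<^bsub>Lambda K\<^esub> \<odot>\<^bsub>M\<^esub> x = \<zero>\<^bsub>M\<^esub>" by (rule M.smult_l_null[OF x(1)])
    finally show ?case
      unfolding ops using smult[OF _ 6, of "\<ominus> \<one>"] by (intro bexI[of _ "scalar K (\<ominus> \<one>) \<odot>\<^bsub>M\<^esub> x"]) auto
  qed (use mem zero add in \<open>auto simp: ops M.M.a_ac\<close>)
  then have "module K ?V"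
  proof (rule moduleI[OF is_cring], goal_cases)
    case (2 a b x)
    then show ?case
      using mem by (simp add: ops scalar_add M.smult_l_distr scalar_closed)
  next
    case (3 a x y)
    then show ?case using mem by (simp add: ops M.smult_r_distr scalar_closed)
  next
    case (4 a b x)
    then show ?case using mem by (simp add: ops scalar_mult M.smult_assoc scalar_closed)
  next
    case (5 x)
    then show ?case using mem by (simp add: ops scalar_one M.smult_one)
  qed (simp add: ops smult)
  then show ?thesis using field_axioms by (simp add: vectorspace_def)
qed

section \<open>The kernel of the projection onto the standard module\<close>

lemma P_mod_eq: "P_mod K S = left_ideal_module (Lambda K) (idem K S)"
  by (simp add: P_mod_def left_ideal_module_def)

text \<open>The coordinates of \<open>f\<close> are its matrix entries into the summand of
  \<open>S\<close>, indexed by an interval and a point, hence finitely many. If all are zero, every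
  e_R f is zero, and so is \<open>f\<close>.\<close>

lemma composition_series_P:
  fixes S :: "'p::{finite, order} set"
  assumes S: "S \<in> intervals"
    and X: "Module.submodule X (Lambda K) (left_ideal_module (Lambda K) (idem K S))"
  shows "\<exists>Ns. composition_series (Lambda K) (quot_module (left_ideal_module (Lambda K) (idem K S)) X) Ns"
proof -
  interpret E: basic_idempotents "Lambda K" "intervals :: 'p set set" "idem K"
    by (rule basic_idempotents_idem)
  interpret P: left_module "Lambda K" "E.P S" by (rule E.P_left_module[OF S])
  show ?thesis
  \<comment> \<open>Coordinates must lie in the field for every index, so pairs whose first entry is
    no interval get the value zero.\<close>
  proof (rule ex_composition_series_coordinates[where J = "intervals \<times> UNIV" and s = "scalar K"
        and c = "\<lambda>(R, x) f. if R \<in> intervals then coef K f R S x else \<zero>", OF E.P_left_module[OF S] X field_axioms],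
      goal_cases)
    case 1
    show ?case by simp
  next
    case (2 i x)
    then show ?case using weightsD(1)[OF coef_weights[OF E.P_mem_closed[OF S 2] _ S]] by
      (auto split: prod.split)
  next
    case (3 i x y)
    then show ?case using coef_add[OF S] by (auto split: prod.split)
  next
    case (5 i k x)
    then show ?case using coef_scalar[OF S E.P_mem_closed[OF S 5(2)] 5(1)] by
      (auto split: prod.split)
  next
    case (6 f)
    note f = E.P_mem_closed[OF S 6(1)]
    have "f \<in> {\<zero>\<^bsub>E.P S\<^esub>}"
    proof (rule E.mem_submoduleI[OF E.P_left_module[OF S] P.zero_submodule 6(1)])
      fix R :: "'p set" assume R: "R \<in> intervals"
      have "f \<otimes>\<^bsub>Lambda K\<^esub> idem K S = f" using 6(1) E.mem_P_iff[OF S] by blast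
      then have "idem K R \<otimes>\<^bsub>Lambda K\<^esub> f = idem K R \<otimes>\<^bsub>Lambda K\<^esub> f \<otimes>\<^bsub>Lambda K\<^esub> idem K S"
        using Lam.m_assoc[OF idem_closed[OF R] f idem_closed[OF S]] by simp
      also have "\<dots> = weight_elt K R S (coef K f R S)" by (rule corner[OF f R S])
      also have "coef K f R S = (\<lambda>_. \<zero>)" using 6(2)[of "(R, x)" for x] R by auto
      also have "weight_elt K R S (\<lambda>_. \<zero>) = \<zero>\<^bsub>Lambda K\<^esub>" by (rule weight_elt_zero[OF R])
      finally show "idem K R \<odot>\<^bsub>E.P S\<^esub> f \<in> {\<zero>\<^bsub>E.P S\<^esub>}" by simp
    qed
    then show ?case by simp
  qed (auto simp: scalar_closed)
qed

lemma idem_mult_P: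
  fixes S :: "'p::{finite, order} set"
  assumes "R \<in> intervals" "S \<in> intervals" "f \<in> carrier (left_ideal_module (Lambda K) (idem K S))"
  shows "idem K R \<otimes>\<^bsub>Lambda K\<^esub> f = weight_elt K R S (coef K f R S)" "coef K f R S \<in> weights K R S"
proof -
  interpret E: basic_idempotents "Lambda K" "intervals :: 'p set set" "idem K"
    by (rule basic_idempotents_idem)
  have f: "f \<in> carrier (Lambda K)" "f \<otimes>\<^bsub>Lambda K\<^esub> idem K S = f"
    using assms(3) E.mem_P_iff[OF assms(2)] by blast+
  then show "idem K R \<otimes>\<^bsub>Lambda K\<^esub> f = weight_elt K R S (coef K f R S)"
    using corner[OF f(1) assms(1,2)] Lam.m_assoc[OF idem_closed[OF assms(1)] f(1) idem_closed[OF assms(2)]]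
    by simp
  show "coef K f R S \<in> weights K R S" by (rule coef_weights[OF f(1) assms(1,2)])
qed

lemma weight_elt_mem_P:
  fixes S :: "'p::{finite, order} set"
  assumes "R \<in> intervals" "S \<in> intervals" "\<phi> \<in> weights K R S"
  shows "weight_elt K R S \<phi> \<in> carrier (left_ideal_module (Lambda K) (idem K S))"
proof -
  interpret E: basic_idempotents "Lambda K" "intervals :: 'p set set" "idem K"
    by (rule basic_idempotents_idem)
  show ?thesis using E.mem_P_iff[OF assms(2)] weight_elt_closed[OF assms(1,3)] weight_elt_mult_idem[OF assms] by blast
qed

text \<open>A morphism supported on a proper subset \<open>C\<close> of \<open>S\<close> factors through \<open>I\<^sub>C\<close>.\<close>

lemma weight_elt_mem_submodule:
  fixes S :: "'p::{finite, order} set"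
  assumes S: "S \<in> intervals" and R: "R \<in> intervals" "R \<notin> ext_set S"
    and X: "Module.submodule X (Lambda K) (left_ideal_module (Lambda K) (idem K S))"
    and gen: "\<And>C f. \<lbrakk>C \<in> intervals; \<not> qh_le C S; f \<in> carrier (left_ideal_module (Lambda K) (idem K S))\<rbrakk> \<Longrightarrow>
      idem K C \<otimes>\<^bsub>Lambda K\<^esub> f \<in> X"
    and phi: "\<phi> \<in> weights K R S"
  shows "weight_elt K R S \<phi> \<in> X"
  using phi
\<comment> \<open>Each round removes one connected component of the support.\<close>
proof (induction "card {x. \<phi> x \<noteq> \<zero>}" arbitrary: \<phi> rule: less_induct)
  case less
  note X' = submoduleD[OF X]
  show ?case
  proof (cases "\<exists>x. \<phi> x \<noteq> \<zero>")
    case False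
    then have "\<phi> = (\<lambda>_. \<zero>)" by auto
    then show ?thesis using weight_elt_zero[OF R(1), of S] X'(2) by simp
  next
    case True
    then obtain x where x: "\<phi> x \<noteq> \<zero>" by blast
    obtain C where C: "C \<in> Adm R S" "x \<in> C"
      and rest: "(\<lambda>y. if y \<in> C then \<zero> else \<phi> y) \<in> weights K R S"
      and split: "\<phi> = (\<lambda>y. (\<phi> x \<otimes> ind K C y) \<oplus> (if y \<in> C then \<zero> else \<phi> y))"
      using weights_split_component[OF less.prems R(1) S x] by blast
    let ?\<psi> = "\<lambda>y. if y \<in> C then \<zero> else \<phi> y"
    have c: "\<phi> x \<in> carrier K" by (rule weightsD(1)[OF less.prems])
    have CI: "C \<in> intervals" by (rule AdmD(1)[OF C(1)])
    have "C \<noteq> S"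
    proof
      assume "C = S"
      then have "R \<in> ext_set S" using C(1) R(1) unfolding ext_set_def Adm_def by blast
      then show False using R(2) by simp
    qed
    \<comment> \<open>A proper subset of \<open>S\<close> has fewer points, and fewer points means
      not below \<open>S\<close> in the order; so \<open>gen\<close> covers
      \<open>C\<close>.\<close>
    then have large: "\<not> qh_le C S"
      using AdmD(3)[OF C(1)] card_mono[of S C] by (simp add: qh_le_def not_less)
    have CS: "C \<in> Adm C S"
      by (rule AdmI[OF CI subset_refl AdmD(3)[OF C(1)] AdmD(4)[OF C(1)]])
    have RC: "C \<in> Adm R C"
      by (rule AdmI[OF CI AdmD(2)[OF C(1)] subset_refl _ AdmD(5)[OF C(1)]])
    note iw = ind_weights[OF CS] ind_weights[OF RC]
    \<comment> \<open>The morphism from I_C to I_S equals its own multiple by the idempotent of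
      \<open>C\<close>, so \<open>gen\<close> puts it into \<open>X\<close>. Multiplying on the left
      by the morphism from I_R to I_C stays in \<open>X\<close>.\<close>
    have "weight_elt K C S (ind K C) \<in> X"
      using gen[OF CI large weight_elt_mem_P[OF CI S iw(1)]] idem_mult_weight_elt[OF CI iw(1)]
      by simp
    moreover have "weight_elt K R C (\<lambda>y. \<phi> x \<otimes> ind K C y) \<in> carrier (Lambda K)"
      by (rule weight_elt_closed[OF R(1) smult_weights[OF c iw(2)]])
    ultimately have "weight_elt K R C (\<lambda>y. \<phi> x \<otimes> ind K C y) \<otimes>\<^bsub>Lambda K\<^esub> weight_elt K C S (ind K C) \<in> X"
      using X'(4) by fastforce
    moreover have "(\<lambda>y. (\<phi> x \<otimes> ind K C y) \<otimes> ind K C y) = (\<lambda>y. \<phi> x \<otimes> ind K C y)"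
      using c by (auto simp: ind_def)
    ultimately have "weight_elt K R S (\<lambda>y. \<phi> x \<otimes> ind K C y) \<in> X"
      using weight_elt_mult[OF R(1) CI smult_weights[OF c iw(2)] iw(1)] by simp
    moreover have "weight_elt K R S ?\<psi> \<in> X"
    proof (rule less.hyps[OF _ rest])
      have "{y. ?\<psi> y \<noteq> \<zero>} \<subset> {y. \<phi> y \<noteq> \<zero>}" using x C(2) by auto
      then show "card {y. ?\<psi> y \<noteq> \<zero>} < card {y. \<phi> y \<noteq> \<zero>}" by (intro psubset_card_mono) auto
    qed
    ultimately have "weight_elt K R S (\<lambda>y. \<phi> x \<otimes> ind K C y) \<oplus>\<^bsub>Lambda K\<^esub> weight_elt K R S ?\<psi> \<in> X"
      using X'(3) by fastforce
    then show ?thesis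
      unfolding weight_elt_add[OF R(1) smult_weights[OF c ind_weights[OF C(1)]] rest] split[symmetric] .
  qed
qed

lemma corner_mult_ext_set:
  fixes S :: "'p::{finite, order} set"
  assumes Q: "Q \<in> ext_set S" and T: "T \<in> intervals - ext_set S"
    and ab: "a \<in> carrier (Lambda K)" "b \<in> carrier (Lambda K)"
  shows "idem K Q \<otimes>\<^bsub>Lambda K\<^esub> a \<otimes>\<^bsub>Lambda K\<^esub> idem K T \<otimes>\<^bsub>Lambda K\<^esub> b \<otimes>\<^bsub>Lambda K\<^esub> idem K S =
    \<zero>\<^bsub>Lambda K\<^esub>"
proof -
  have T': "T \<in> intervals" "T \<notin> ext_set S" using T by auto
  note QI = ext_setD(1)[OF Q] and S = ext_setD(2)[OF Q]
  show ?thesis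
    unfolding corner_mult[OF ab QI T'(1) S]
      mult_weights_ext[OF coef_weights[OF ab(1) QI T'(1)] coef_weights[OF ab(2) T'(1) S] Q T']
    by (rule weight_elt_zero[OF QI])
qed

lemma Delta_ker_eq:
  fixes S :: "'p::{finite, order} set"
  assumes S: "S \<in> intervals"
  shows "Delta_ker K S = {f \<in> carrier (P_mod K S). \<forall>R\<in>ext_set S. idem K R \<otimes>\<^bsub>Lambda K\<^esub> f = \<zero>\<^bsub>Lambda K\<^esub>}"
proof -
  interpret E: basic_idempotents "Lambda K" "intervals :: 'p set set" "idem K"
    by (rule basic_idempotents_idem)
  let ?B = "{R \<in> intervals. qh_le R S}"
  have below: "factors_below K S M \<longleftrightarrow> (\<forall>F\<in>composition_factors (Lambda K) M.
      \<exists>R\<in>?B. module_isomorphic (Lambda K) F (E.L R))" for M :: "(('p, 'k) lam, ('p, 'k) lam set) module"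
    unfolding factors_below_def L_mod_def P_mod_eq by blast
  show ?thesis
    unfolding Delta_ker_def below P_mod_eq
  proof (rule E.standard_kernel[OF S])
    show "ext_set S \<subseteq> ?B"
    proof
      fix R assume R: "R \<in> ext_set S"
      have "R = S \<or> card S < card R"
        using ext_setD(3)[OF R] psubset_card_mono[of R S] by auto
      then show "R \<in> ?B" using ext_setD(1)[OF R] by (auto simp: qh_le_def)
    qed
    show "idem K Q \<otimes>\<^bsub>Lambda K\<^esub> a \<otimes>\<^bsub>Lambda K\<^esub> idem K T \<otimes>\<^bsub>Lambda K\<^esub> b \<otimes>\<^bsub>Lambda K\<^esub> idem K S =
        \<zero>\<^bsub>Lambda K\<^esub>"
      if "Q \<in> ext_set S" "T \<in> intervals - ext_set S" "a \<in> carrier (Lambda K)" "b \<in> carrier (Lambda K)"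
      for Q T a b
      by (rule corner_mult_ext_set[OF that])
    show "f \<in> X" if X: "Module.submodule X (Lambda K) (E.P S)"
      and gen: "\<And>i f. \<lbrakk>i \<in> intervals - ?B; f \<in> carrier (E.P S)\<rbrakk> \<Longrightarrow> idem K i \<otimes>\<^bsub>Lambda K\<^esub> f \<in> X"
      and f: "f \<in> carrier (E.P S)" "\<And>i. i \<in> ext_set S \<Longrightarrow> idem K i \<otimes>\<^bsub>Lambda K\<^esub> f = \<zero>\<^bsub>Lambda K\<^esub>" for X f
    \<comment> \<open>Tested component by component: those in \<open>ext_set S\<close> vanish by
      assumption, the others lie in \<open>X\<close> by the factorization through smaller
      intervals.\<close>
    proof (rule E.mem_submoduleI[OF E.P_left_module[OF S] X f(1)])
      fix R :: "'p set" assume R: "R \<in> intervals"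
      show "idem K R \<odot>\<^bsub>E.P S\<^esub> f \<in> X"
      proof (cases "R \<in> ext_set S")
        case True
        then show ?thesis using f(2) submoduleD(2)[OF X] by simp
      next
        case False
        have "weight_elt K R S (coef K f R S) \<in> X"
          by (rule weight_elt_mem_submodule[OF S R False X _ idem_mult_P(2)[OF R S f(1)]])
            (use gen in blast)
        then show ?thesis using idem_mult_P(1)[OF R S f(1)] by simp
      qed
    qed
  qed (use composition_series_P[OF S] in auto)
qed

lemma Delta_ker_submodule:
  fixes S :: "'p::{finite, order} set"
  assumes S: "S \<in> intervals"
  shows "Module.submodule (Delta_ker K S) (Lambda K) (P_mod K S)"
proof -
  interpret E: basic_idempotents "Lambda K" "intervals :: 'p set set" "idem K"
    by (rule basic_idempotents_idem)
  show ?thesis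
    unfolding Delta_ker_eq[OF S] P_mod_eq
    by (rule E.vanishing_submodule[OF S _ corner_mult_ext_set]) (use ext_setD(1) in blast)
qed

lemma Delta_quotient:
  fixes S :: "'p::{finite, order} set"
  assumes S: "S \<in> intervals"
  shows "module_quotient (Lambda K) (P_mod K S) (Delta_ker K S)"
  using ring.left_ideal_module[OF ring_Lambda idem_closed[OF S]] Delta_ker_submodule[OF S]
  by (intro module_quotientI) (simp_all add: P_mod_eq)

section \<open>Components of the standard module and the action on them\<close>

lemma Delta_class_q: "Delta_class K S R (q_mor K R S) = Delta_ker K S +>\<^bsub>P_mod K S\<^esub> weight_elt K R S (ind K S)"
  by (simp add: Delta_class_def q_mor_def op_elt_rho)

text \<open>An element starting at \<open>R\<close> is killed by every other idempotent, so of all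
  conditions defining the kernel only the one at \<open>R\<close> can fail, and it does so only if
  \<open>R\<close> is in \<open>ext_set S\<close>.\<close>

lemma weight_elt_mem_Delta_ker_iff:
  fixes S :: "'p::{finite, order} set"
  assumes S: "S \<in> intervals" and R: "R \<in> intervals" and phi: "\<phi> \<in> weights K R S"
  shows "weight_elt K R S \<phi> \<in> Delta_ker K S \<longleftrightarrow> R \<notin> ext_set S \<or> \<phi> = (\<lambda>_. \<zero>)"
proof -
  have orth: "idem K Q \<otimes>\<^bsub>Lambda K\<^esub> weight_elt K R S \<phi> = \<zero>\<^bsub>Lambda K\<^esub>" if "Q \<in> intervals" "Q \<noteq> R" for Q
    unfolding idem_eq by (rule weight_elt_mult_orth[OF that(1,1) R that(2) ind_self_weights phi])
  have "(\<forall>Q\<in>ext_set S. idem K Q \<otimes>\<^bsub>Lambda K\<^esub> weight_elt K R S \<phi> = \<zero>\<^bsub>Lambda K\<^esub>) \<longleftrightarrow>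
      (R \<in> ext_set S \<longrightarrow> weight_elt K R S \<phi> = \<zero>\<^bsub>Lambda K\<^esub>)"
    using orth idem_mult_weight_elt[OF R phi] ext_setD(1) by metis
  moreover have "weight_elt K R S \<phi> = \<zero>\<^bsub>Lambda K\<^esub> \<longleftrightarrow> \<phi> = (\<lambda>_. \<zero>)"
    using weight_elt_inject[OF R S phi zero_weights] weight_elt_zero[OF R, of S] by metis
  ultimately show ?thesis
    using weight_elt_mem_P[OF R S phi] unfolding Delta_ker_eq[OF S] P_mod_eq by blast
qed

text \<open>The idempotent of \<open>R\<close> fixes \<open>w\<close>, so a lift \<open>p\<close>
  may be replaced by e_R p, which is given by a weight.\<close>

lemma component_Delta:
  fixes S :: "'p::{finite, order} set"
  assumes S: "S \<in> intervals" and R: "R \<in> intervals" and w: "w \<in> carrier (component K R (Delta K S))"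
  obtains \<phi> where "\<phi> \<in> weights K R S" "w = Delta_ker K S +>\<^bsub>P_mod K S\<^esub> weight_elt K R S \<phi>"
proof -
  interpret D: module_quotient "Lambda K" "P_mod K S" "Delta_ker K S" by (rule Delta_quotient[OF S])
  have w': "w \<in> carrier D.Q" "idem K R \<odot>\<^bsub>D.Q\<^esub> w = w"
    using w component_mem_iff[OF D.quot_left_module R] by (simp_all add: Delta_def)
  then obtain p where p: "p \<in> carrier (P_mod K S)" "w = Delta_ker K S +>\<^bsub>P_mod K S\<^esub> p"
    unfolding D.carrier_quot by blast
  have "w = Delta_ker K S +>\<^bsub>P_mod K S\<^esub> (idem K R \<odot>\<^bsub>P_mod K S\<^esub> p)"
    using w'(2) D.smult_quot[OF idem_closed[OF R] p(1)] p(2) by simp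
  also have "idem K R \<odot>\<^bsub>P_mod K S\<^esub> p = weight_elt K R S (coef K p R S)"
    using idem_mult_P(1)[OF R S p(1)[unfolded P_mod_eq]] by (simp add: P_mod_eq)
  finally show thesis using that idem_mult_P(2)[OF R S p(1)[unfolded P_mod_eq]] by blast
qed

lemma component_Delta_outside:
  fixes S :: "'p::{finite, order} set"
  assumes S: "S \<in> intervals" and R: "R \<in> intervals" "R \<notin> ext_set S"
  shows "carrier (component K R (Delta K S)) = {\<zero>\<^bsub>Delta K S\<^esub>}"
proof -
  interpret D: module_quotient "Lambda K" "P_mod K S" "Delta_ker K S" by (rule Delta_quotient[OF S])
  interpret Q: left_module "Lambda K" D.Q by (rule D.quot_left_module)
  have "w = \<zero>\<^bsub>D.Q\<^esub>" if w: "w \<in> carrier (component K R (Delta K S))" for w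
  proof -
    obtain \<phi> where phi: "\<phi> \<in> weights K R S" "w = Delta_ker K S +>\<^bsub>P_mod K S\<^esub> weight_elt K R S \<phi>"
      by (rule component_Delta[OF S R(1) w])
    then show ?thesis
      using weight_elt_mem_Delta_ker_iff[OF S R(1) phi(1)] R(2)
        D.coset_eq_N_iff[OF weight_elt_mem_P[OF R(1) S phi(1), folded P_mod_eq]] D.zero_quot by simp
  qed
  moreover have "\<zero>\<^bsub>D.Q\<^esub> \<in> carrier (component K R (Delta K S))"
    using component_mem_iff[OF D.quot_left_module R(1), of "\<zero>\<^bsub>D.Q\<^esub>"] Q.smult_r_null[OF idem_closed[OF R(1)]]
    by (simp add: Delta_def)
  ultimately show ?thesis unfolding Delta_def by blast
qed

lemma component_Delta_inside:
  fixes S :: "'p::{finite, order} set"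
  assumes S: "S \<in> intervals" and R: "R \<in> ext_set S"
  defines "q \<equiv> Delta_class K S R (q_mor K R S)"
  shows "q \<in> carrier (component K R (Delta K S))" "q \<noteq> \<zero>\<^bsub>Delta K S\<^esub>"
    "w \<in> carrier (component K R (Delta K S)) \<Longrightarrow> \<exists>c\<in>carrier K. w = c \<odot>\<^bsub>component K R (Delta K S)\<^esub> q"
proof -
  interpret D: module_quotient "Lambda K" "P_mod K S" "Delta_ker K S" by (rule Delta_quotient[OF S])
  note RI = ext_setD(1)[OF R] and iw = ind_ext_weights[OF R]
  note iP = weight_elt_mem_P[OF RI S iw, folded P_mod_eq]
  obtain s where s: "s \<in> S" using intervalsD(1)[OF S] by blast
  have q: "q = Delta_ker K S +>\<^bsub>P_mod K S\<^esub> weight_elt K R S (ind K S)"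
    unfolding q_def Delta_class_q ..
  have "idem K R \<odot>\<^bsub>D.Q\<^esub> q = q"
    unfolding q D.smult_quot[OF idem_closed[OF RI] iP]
    using idem_mult_weight_elt[OF RI iw] by (simp add: P_mod_eq)
  then show "q \<in> carrier (component K R (Delta K S))"
    using component_mem_iff[OF D.quot_left_module RI, of q] D.coset_mem[OF iP] by
    (simp add: Delta_def q)
  have "ind K S \<noteq> (\<lambda>_. \<zero>)"
    using s by (auto simp: ind_def fun_eq_iff)
  then show "q \<noteq> \<zero>\<^bsub>Delta K S\<^esub>"
    using weight_elt_mem_Delta_ker_iff[OF S RI iw] R D.coset_eq_N_iff[OF iP] D.zero_quot
    by (simp add: Delta_def q)
  assume "w \<in> carrier (component K R (Delta K S))"
  then obtain \<phi> where phi: "\<phi> \<in> weights K R S" "w = Delta_ker K S +>\<^bsub>P_mod K S\<^esub> weight_elt K R S \<phi>"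
    by (rule component_Delta[OF S RI])
  have c: "\<phi> s \<in> carrier K" by (rule weightsD(1)[OF phi(1)])
  have "weight_elt K R S \<phi> = weight_elt K R S (\<lambda>x. \<phi> s \<otimes> ind K S x)"
    using weights_eq_smult_ind[OF phi(1) S ext_setD(3)[OF R] s] by simp
  also have "\<dots> = scalar K (\<phi> s) \<odot>\<^bsub>P_mod K S\<^esub> weight_elt K R S (ind K S)"
    using scalar_weight_elt[OF RI iw c] by (simp add: P_mod_eq)
  finally have "w = scalar K (\<phi> s) \<odot>\<^bsub>D.Q\<^esub> q"
    unfolding phi(2) q D.smult_quot[OF scalar_closed[OF c] iP] by simp
  then show "\<exists>c\<in>carrier K. w = c \<odot>\<^bsub>component K R (Delta K S)\<^esub> q"
    using c by (auto simp: component_def Delta_def)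
qed

text \<open>The product has as its weight the indicator of \<open>C \<inter> S\<close>. For
  \<open>Q\<close> outside \<open>ext_set S\<close> its class is zero; for \<open>Q\<close> inside,
  the weight is constant on \<open>S\<close>, so one point of \<open>S\<close> missing from
  \<open>C\<close> makes it vanish.\<close>

lemma rho_Delta:
  fixes S :: "'p::{finite, order} set"
  assumes S: "S \<in> intervals" and Q: "Q \<in> intervals" and R: "R \<in> ext_set S" and C: "C \<in> Adm Q R"
  shows "op_elt K Q R (rho K Q R C) \<odot>\<^bsub>Delta K S\<^esub> Delta_class K S R (q_mor K R S) =
    (if Q \<in> ext_set S \<and> S \<subseteq> C then Delta_class K S Q (q_mor K Q S) else \<zero>\<^bsub>Delta K S\<^esub>)"
proof -
  interpret D: module_quotient "Lambda K" "P_mod K S" "Delta_ker K S" by (rule Delta_quotient[OF S])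
  note RI = ext_setD(1)[OF R] and iw = ind_ext_weights[OF R] and cw = ind_weights[OF C]
  let ?\<chi> = "\<lambda>x. ind K C x \<otimes> ind K S x"
  have chi: "?\<chi> \<in> weights K Q S" by (rule mult_weights[OF cw iw])
  have "op_elt K Q R (rho K Q R C) \<odot>\<^bsub>D.Q\<^esub> Delta_class K S R (q_mor K R S) =
      Delta_ker K S +>\<^bsub>P_mod K S\<^esub> (weight_elt K Q R (ind K C) \<odot>\<^bsub>P_mod K S\<^esub> weight_elt K R S (ind K S))"
    unfolding Delta_class_q op_elt_rho
    by (rule D.smult_quot[OF weight_elt_closed[OF Q cw] weight_elt_mem_P[OF RI S iw, folded P_mod_eq]])
  also have "weight_elt K Q R (ind K C) \<odot>\<^bsub>P_mod K S\<^esub> weight_elt K R S (ind K S) = weight_elt K Q S ?\<chi>"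
    using weight_elt_mult[OF Q RI cw iw] by (simp add: P_mod_eq)
  finally have action: "op_elt K Q R (rho K Q R C) \<odot>\<^bsub>Delta K S\<^esub> Delta_class K S R (q_mor K R S) =
      Delta_ker K S +>\<^bsub>P_mod K S\<^esub> weight_elt K Q S ?\<chi>"
    by (simp add: Delta_def)
  show ?thesis
  proof (cases "Q \<in> ext_set S \<and> S \<subseteq> C")
    case True
    then have "?\<chi> = ind K S" by (intro ext) (auto simp: ind_def)
    then show ?thesis using True unfolding action by (simp add: Delta_class_q)
  next
    case False
    have "Q \<notin> ext_set S \<or> ?\<chi> = (\<lambda>_. \<zero>)"
    proof (cases "Q \<in> ext_set S")
      case True
      then obtain s where s: "s \<in> S" "s \<notin> C" using False by blast
      then have "?\<chi> s = \<zero>" by (simp add: ind_def)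
      then show ?thesis using weights_zero_if_zero[OF chi S ext_setD(3)[OF True] s(1)] by blast
    qed simp
    then have "Delta_ker K S +>\<^bsub>P_mod K S\<^esub> weight_elt K Q S ?\<chi> = \<zero>\<^bsub>Delta K S\<^esub>"
      using weight_elt_mem_Delta_ker_iff[OF S Q chi]
        D.coset_eq_N_iff[OF weight_elt_mem_P[OF Q S chi, folded P_mod_eq]] D.zero_quot
      by (simp add: Delta_def)
    then show ?thesis unfolding action if_not_P[OF False] .
  qed
qed

text \<open>The class of the idempotent of \<open>S\<close> generates, since
  \<open>p = p \<otimes> e_S\<close> for \<open>p\<close> in P(S).\<close>

lemma Delta_finitely_generated:
  fixes S :: "'p::{finite, order} set"
  assumes S: "S \<in> intervals"
  shows "finitely_generated (Lambda K) (Delta K S)"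
proof -
  interpret D: module_quotient "Lambda K" "P_mod K S" "Delta_ker K S" by (rule Delta_quotient[OF S])
  interpret E: basic_idempotents "Lambda K" "intervals :: 'p set set" "idem K"
    by (rule basic_idempotents_idem)
  let ?g = "Delta_ker K S +>\<^bsub>P_mod K S\<^esub> idem K S"
  note eP = E.e_mem_P[OF S, folded P_mod_eq]
  have "N = carrier D.Q" if N: "Module.submodule N (Lambda K) D.Q" and g: "?g \<in> N" for N
  proof
    show "carrier D.Q \<subseteq> N"
    proof
      fix w assume "w \<in> carrier D.Q"
      then obtain p where p: "p \<in> carrier (P_mod K S)" "w = Delta_ker K S +>\<^bsub>P_mod K S\<^esub> p"
        unfolding D.carrier_quot by blast
      have p': "p \<in> carrier (Lambda K)" "p \<odot>\<^bsub>P_mod K S\<^esub> idem K S = p"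
        using p(1) E.mem_P_iff[OF S] unfolding P_mod_eq by auto
      have "p \<odot>\<^bsub>D.Q\<^esub> ?g \<in> N" by (rule submoduleD(4)[OF N p'(1) g])
      then show "w \<in> N" using D.smult_quot[OF p'(1) eP] p'(2) p(2) by simp
    qed
  qed (rule submoduleD(1)[OF N])
  then show ?thesis
    unfolding finitely_generated_def Delta_def using D.coset_mem[OF eP]
      by (intro exI[of _ "{?g}"]) auto
qed

end

theorem proposition4p2:
  fixes K :: "('k, 'm) ring_scheme" and S :: "'p::{finite, order} set"
  assumes "field K"
    and "poset_connected (UNIV :: 'p set)"
    and "S \<in> intervals"
  shows
    "(\<forall>R\<in>intervals.
        if R \<in> ext_set S
        then vectorspace K (component K R (Delta K S)) \<and>
             vectorspace.basis K (component K R (Delta K S)) {Delta_class K S R (q_mor K R S)}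
        else carrier (component K R (Delta K S)) = {\<zero>\<^bsub>Delta K S\<^esub>}) \<and>
     (\<forall>Q\<in>intervals. \<forall>R\<in>intervals. \<forall>C\<in>Adm Q R. R \<in> ext_set S \<longrightarrow>
        op_elt K Q R (rho K Q R C) \<odot>\<^bsub>Delta K S\<^esub> Delta_class K S R (q_mor K R S) =
          (if Q \<in> ext_set S \<and> S \<subseteq> C then Delta_class K S Q (q_mor K Q S) else \<zero>\<^bsub>Delta K S\<^esub>)) \<and>
     (left_module (Lambda K) (Delta K S) \<and> finitely_generated (Lambda K) (Delta K S) \<and>
      thin K (Delta K S) \<and> supp K (Delta K S) = ext_set S)"
proof -
  interpret interval_algebra K using assms(1) by (simp add: interval_algebra_def)
  note S = assms(3)
  have left: "left_module (Lambda K) (Delta K S)"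
    using module_quotient.quot_left_module[OF Delta_quotient[OF S]] by (simp add: Delta_def)
  note vs = component_vectorspace[OF left]
  note inside = component_Delta_inside[OF S] and outside = component_Delta_outside[OF S]
  have zero: "\<zero>\<^bsub>component K R (Delta K S)\<^esub> = \<zero>\<^bsub>Delta K S\<^esub>" for R
    by (simp add: component_def)
  have basis: "vectorspace.basis K (component K R (Delta K S)) {Delta_class K S R (q_mor K R S)}"
    if R: "R \<in> ext_set S" for R
    using vectorspace_one_dim(3)[OF vs[OF ext_setD(1)[OF R]] inside(1)[OF R] inside(3)[OF R]] inside(2)[OF R]
    by (simp add: zero)
  have thin: "thin K (Delta K S)"
    unfolding thin_def
  proof
    fix R :: "'p set" assume R: "R \<in> intervals"
    let ?V = "component K R (Delta K S)"
    \<comment> \<open>One spanning vector treats both cases: the class of \<open>q_mor K R S\<close>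
      on the support, the zero vector off it.\<close>
    have "\<exists>v\<in>carrier ?V. \<forall>w\<in>carrier ?V. \<exists>c\<in>carrier K. w = c \<odot>\<^bsub>?V\<^esub> v"
    proof (cases "R \<in> ext_set S")
      case True
      then show ?thesis using inside(1,3) by blast
    next
      case False
      interpret V: vectorspace K ?V by (rule vs[OF R])
      have "\<one>\<^bsub>K\<^esub> \<odot>\<^bsub>?V\<^esub> \<zero>\<^bsub>?V\<^esub> = \<zero>\<^bsub>?V\<^esub>" by (rule V.smult_r_null) simp
      then show ?thesis
        using outside[OF R False] one_closed by (intro bexI[of _ "\<zero>\<^bsub>?V\<^esub>"] ballI bexI[of _ "\<one>\<^bsub>K\<^esub>"])
        (auto simp: zero)
    qed
    then obtain v where v: "v \<in> carrier ?V" "\<And>w. w \<in> carrier ?V \<Longrightarrow> \<exists>c\<in>carrier K. w = c \<odot>\<^bsub>?V\<^esub> v"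
      by blast
    show "vectorspace K ?V \<and> vectorspace.fin_dim K ?V \<and> vectorspace.dim K ?V \<le> 1"
      by (intro conjI vs[OF R] vectorspace_one_dim(1,2)[OF vs[OF R] v])
  qed
  have "R \<in> supp K (Delta K S) \<longleftrightarrow> R \<in> ext_set S" for R
    unfolding supp_def using inside(1,2)[of R] outside[of R] ext_setD(1)[of R S] by blast
  then have supp: "supp K (Delta K S) = ext_set S" by blast
  show ?thesis
  proof (intro conjI ballI impI)
    fix R :: "'p set" assume R: "R \<in> intervals"
    show "if R \<in> ext_set S
        then vectorspace K (component K R (Delta K S)) \<and>
             vectorspace.basis K (component K R (Delta K S)) {Delta_class K S R (q_mor K R S)}
        else carrier (component K R (Delta K S)) = {\<zero>\<^bsub>Delta K S\<^esub>}"
      using basis[of R] vs[OF R] outside[OF R] by simp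
  qed (rule rho_Delta[OF S], assumption+, rule left, rule Delta_finitely_generated[OF S], rule thin, rule supp)
qed

end
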